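(* Let $n\ge 2$, $s\in(0,1)$, and let $p\in\left(1,\frac{n+2}{n-2}\right)$ if $n>2$, $p\in(1,+\infty)$ if $n=2$. Let $u\in H^1(\mathbb{R}^n)$ be a bounded weak solution of $-\Delta u+(-\Delta)^su+u=u^p$ in $\mathbb{R}^n$. Then $u\in C^{2,\alpha}(\mathbb{R}^n)$ for any $\alpha\in(0,1)$ and $$\|u\|_{C^{2,\alpha}(\mathbb{R}^n)}\le C\max\left\{\|u\|^{p^2}_{L^\infty(\mathbb{R}^n)},\ \|u\|_{L^\infty(\mathbb{R}^n)}\right\},$$ for some $C>0$ depending only on $n$, $s$, $p$ and $\alpha$.
   Context: Weak solution: $u\in H^1(\mathbb{R}^n)$ is a weak solution of the equation $-\Delta u+(-\Delta)^su+u=u^p$ in $\mathbb{R}^n$ if for all $v\in H^1(\mathbb{R}^n)$ $$\int_{\mathbb{R}^n}\big(u(x)v(x)+\nabla u(x)\cdot\nabla v(x)\big)\,dx+\iint_{\mathbb{R}^{2n}}\frac{(u(x)-u(y))(v(x)-v(y))}{|x-y|^{n+2s}}\,dx\,dy=\int_{\mathbb{R}^n}|u(x)|^{p-1}u(x)v(x)\,dx.$$ Bounded means $u\in L^\infty(\mathbb{R}^n)$. The space $C^{2,\alpha}(\mathbb{R}^n)$ has its usual norm (sup norms of $u$, $\nabla u$, $D^2u$ plus the $\alpha$-Hölder seminorm of $D^2u$); membership is understood up to a.e. modification. *)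

theory Defs
  imports "HOL-Analysis.Analysis" "HOL-Probability.Essential_Supremum"
begin

definition partial :: "'n::finite \<Rightarrow> (real^'n \<Rightarrow> real) \<Rightarrow> real^'n \<Rightarrow> real" where
  "partial i f x = frechet_derivative f (at x) (axis i 1)"

definition gradient :: "(real^'n::finite \<Rightarrow> real) \<Rightarrow> real^'n \<Rightarrow> real^'n" where
  "gradient f x = (\<chi> i. partial i f x)"

definition hessian :: "(real^'n::finite \<Rightarrow> real) \<Rightarrow> real^'n \<Rightarrow> real^'n^'n" where
  "hessian f x = (\<chi> i j. partial i (partial j f) x)"

primrec Ck :: "nat \<Rightarrow> (real^'n::finite \<Rightarrow> real) \<Rightarrow> bool" where
  "Ck 0 f \<longleftrightarrow> continuous_on UNIV f"
| "Ck (Suc k) f \<longleftrightarrow> (\<forall>x. f differentiable (at x)) \<and> (\<forall>i. Ck k (partial i f))"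

definition test_function :: "(real^'n::finite \<Rightarrow> real) \<Rightarrow> bool" where
  "test_function \<phi> \<longleftrightarrow> (\<forall>k. Ck k \<phi>) \<and> compact (closure {x. \<phi> x \<noteq> 0})"

definition locally_integrable :: "(real^'n::finite \<Rightarrow> 'b::euclidean_space) \<Rightarrow> bool" where
  "locally_integrable f \<longleftrightarrow> (\<forall>K. compact K \<longrightarrow> set_integrable lebesgue K f)"

definition square_integrable :: "(real^'n::finite \<Rightarrow> 'b::euclidean_space) \<Rightarrow> bool" where
  "square_integrable f \<longleftrightarrow>
     f \<in> borel_measurable lebesgue \<and> integrable lebesgue (\<lambda>x. (norm (f x))\<^sup>2)"

definition has_weak_gradient ::
    "(real^'n::finite \<Rightarrow> real) \<Rightarrow> (real^'n \<Rightarrow> real^'n) \<Rightarrow> bool" where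
  "has_weak_gradient u G \<longleftrightarrow> locally_integrable u \<and> locally_integrable G \<and>
     (\<forall>\<phi> i. test_function \<phi> \<longrightarrow>
        (LINT x|lebesgue. u x * partial i \<phi> x) = - (LINT x|lebesgue. (G x $ i) * \<phi> x))"

text \<open>Functions are not identified almost everywhere, so a weak gradient is determined only up to
  a null set; \<open>weak_gradient\<close> picks one representative.\<close>

definition weak_gradient :: "(real^'n::finite \<Rightarrow> real) \<Rightarrow> real^'n \<Rightarrow> real^'n" where
  "weak_gradient u = (SOME G. has_weak_gradient u G)"

definition H1 :: "(real^'n::finite \<Rightarrow> real) set" where
  "H1 = {u. square_integrable u \<and> (\<exists>G. has_weak_gradient u G \<and> square_integrable G)}"

text \<open>The double integral is an integral over the product space. On the diagonal, a null set, its
  integrand is \<open>0 / 0 = 0\<close>. For \<open>u = 0\<close> the value \<open>0 powr (p - 1) = 0\<close> is the intended one, as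
  \<open>p > 1\<close>.\<close>

definition weak_solution :: "real \<Rightarrow> real \<Rightarrow> (real^'n::finite \<Rightarrow> real) \<Rightarrow> bool" where
  "weak_solution s p u \<longleftrightarrow> u \<in> H1 \<and>
     (\<forall>v\<in>H1.
        (LINT x|lebesgue. u x * v x + weak_gradient u x \<bullet> weak_gradient v x)
        + (LINT (x, y)|lebesgue. (u x - u y) * (v x - v y) / norm (x - y) powr (real CARD('n) + 2 * s))
        = (LINT x|lebesgue. \<bar>u x\<bar> powr (p - 1) * u x * v x))"

definition Linfty :: "(real^'n::finite \<Rightarrow> real) set" where
  "Linfty = {u. u \<in> borel_measurable lebesgue \<and> esssup lebesgue (\<lambda>x. ereal \<bar>u x\<bar>) < \<infinity>}"

definition Linfty_norm :: "(real^'n::finite \<Rightarrow> real) \<Rightarrow> real" where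
  "Linfty_norm u = real_of_ereal (esssup lebesgue (\<lambda>x. ereal \<bar>u x\<bar>))"

definition holder_quotients ::
    "real \<Rightarrow> (real^'n::finite \<Rightarrow> 'b::real_normed_vector) \<Rightarrow> real set" where
  "holder_quotients \<alpha> f = {norm (f x - f y) / norm (x - y) powr \<alpha> | x y. x \<noteq> y}"

definition C2_holder :: "real \<Rightarrow> (real^'n::finite \<Rightarrow> real) set" where
  "C2_holder \<alpha> = {w. Ck 2 w \<and> bounded (range w) \<and> bounded (range (gradient w)) \<and>
     bounded (range (hessian w)) \<and> bdd_above (holder_quotients \<alpha> (hessian w))}"

text \<open>A norm only for members of \<open>C2_holder \<alpha>\<close>, where all four suprema are of bounded sets.
  Matrices carry the Euclidean (Frobenius) norm.\<close>

definition C2_holder_norm :: "real \<Rightarrow> (real^'n::finite \<Rightarrow> real) \<Rightarrow> real" where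
  "C2_holder_norm \<alpha> w = (SUP x. \<bar>w x\<bar>) + (SUP x. norm (gradient w x)) + (SUP x. norm (hessian w x))
     + Sup (holder_quotients \<alpha> (hessian w))"

end

theory Submission
  imports Defs
begin

text \<open>Let \<open>w\<close> and \<open>Q\<close> be radial smooth bumps with \<open>\<nabla>Q(z) = - z w(z)\<close>, and let \<open>A\<^sub>r\<close>, \<open>B\<^sub>r\<close> denote the
  averages \<open>\<integral> u(x + r z) w(z) dz\<close> and \<open>\<integral> u(x + r z) Q(z) dz\<close>. Testing the weak equation with a rescaled translate
  of \<open>Q\<close> gives \<open>d/dr A\<^sub>r u = r\<^bsup>1-2s\<^esup> N\<^sub>r u + r B\<^sub>r u - r B\<^sub>r f\<close>, where \<open>f = \<bar>u\<bar>\<^bsup>p-1\<^esup>u\<close> and \<open>\<bar>N\<^sub>r u\<bar> \<le> C sup \<bar>u\<bar>\<close>,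
  because the fractional Laplacian has been moved onto \<open>Q\<close>. Since \<open>1 - 2s > -1\<close>, integrating over a short
  interval \<open>(0, R)\<close> lets the nonlocal term be absorbed, so \<open>sup \<bar>u\<bar>\<close> is controlled by \<open>A\<^sub>R u\<close> and \<open>f\<close>. The
  identity is linear and translation invariant, hence it also holds for iterated finite differences of \<open>u\<close>
  and \<open>f\<close>: one difference gives a Lipschitz bound for \<open>u\<close>, and thus for \<open>f\<close>; two and three differences
  give the bounds on the second derivatives and on their Hoelder quotients.\<close>

section \<open>Smooth kernels\<close>

text \<open>Since the gradient of Q is - z w(z), the Laplacian of Q is minus the divergence of z
  w(z), and this is the kernel that arises when the average against w is differentiated in its
  radius. A difference of step a, moved from f onto Q, becomes one of step - a / r and costs a
  factor norm a / r. Against the weight r in the identity this is integrable up to r = 0 for one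
  difference, but two differences leave 1 / r, whose integral diverges logarithmically.
  Interpolating the second factor down to (norm a / r) powr \<alpha> with \<alpha> < 1 restores
  convergence; it explains the Hoelder range, and also why f must be known to be Lipschitz before
  second and third differences are estimated. Absorption requires the supremum to be finite
  beforehand; boundedness of u supplies this for all iterated differences. In the nonlocal term the
  weak gradient serves to make the bilinear form absolutely integrable near the diagonal. The power
  p^2 in the final bound dominates 2 p - 1, the largest exponent that arises.\<close>

lemma partial_eqI:
  assumes "(f has_derivative D) (at x)"
  shows "partial i f x = D (axis i 1)"
  unfolding partial_def using frechet_derivative_at[OF assms] by simp

lemma has_derivative_partials:
  fixes f :: "real^'n::finite \<Rightarrow> real"
  assumes "f differentiable (at x)"
  shows "(f has_derivative (\<lambda>v. \<Sum>i\<in>UNIV. v $ i * partial i f x)) (at x)"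
proof -
  let ?D = "frechet_derivative f (at x)"
  have D: "(f has_derivative ?D) (at x)" using assms frechet_derivative_works by blast
  then interpret bounded_linear ?D by (rule has_derivative_bounded_linear)
  have "?D v = (\<Sum>i\<in>UNIV. v $ i * partial i f x)" for v
  proof -
    have "?D v = ?D (\<Sum>i\<in>UNIV. v $ i *\<^sub>R axis i 1)"
      using basis_expansion[of v] by (simp add: scalar_mult_eq_scaleR)
    also have "\<dots> = (\<Sum>i\<in>UNIV. v $ i * partial i f x)"
      by (simp add: sum scale partial_def)
    finally show ?thesis .
  qed
  then have "?D = (\<lambda>v. \<Sum>i\<in>UNIV. v $ i * partial i f x)" by blast
  with D show ?thesis by metis
qed

section \<open>Closure properties of the classes \<open>Ck\<close>\<close>

lemma Ck_imp_continuous: "Ck k f \<Longrightarrow> continuous_on UNIV f"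
  by (cases k) (auto simp: continuous_on_eq_continuous_at intro: differentiable_imp_continuous_within)

lemma Ck_Suc_imp: "Ck (Suc k) f \<Longrightarrow> Ck k f"
proof (induction k arbitrary: f)
  case 0
  then show ?case using Ck_imp_continuous by fastforce
next
  case (Suc k)
  show ?case
    unfolding Ck.simps
  proof (intro conjI allI)
    fix x show "f differentiable at x" using Suc.prems by simp
  next
    fix i
    have "Ck (Suc k) (partial i f)" using Suc.prems unfolding Ck.simps(2)[of "Suc k"] by blast
    then show "Ck k (partial i f)" by (rule Suc.IH)
  qed
qed

lemma Ck_const: "Ck k (\<lambda>x. c)"
proof (induction k arbitrary: c)
  case (Suc k)
  have "partial i (\<lambda>x::real^'a. c) = (\<lambda>x. 0)" for i
    by (rule ext, rule trans[OF partial_eqI[OF has_derivative_const]]) simp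
  with Suc show ?case by simp
qed simp

lemma Ck_nth: "Ck k (\<lambda>x. x $ j)"
proof (cases k)
  case (Suc m)
  have d: "((\<lambda>x::real^'a. x $ j) has_derivative (\<lambda>x. x $ j)) (at x)" for x
    by (intro bounded_linear_imp_has_derivative bounded_linear_vec_nth)
  then have "partial i (\<lambda>x::real^'a. x $ j) = (\<lambda>x. if i = j then 1 else 0)" for i
    using partial_eqI[OF d] by (auto simp: axis_def)
  with d show ?thesis unfolding Suc Ck.simps differentiable_def by (auto intro!: Ck_const)
qed (auto intro: continuous_intros)

lemma partial_add:
  assumes "f differentiable (at x)" "g differentiable (at x)"
  shows "partial i (\<lambda>x. f x + g x) x = partial i f x + partial i g x"
  using partial_eqI[OF has_derivative_add[OF assms[unfolded frechet_derivative_works]]] by (simp add: partial_def)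

lemma Ck_add: "Ck k f \<Longrightarrow> Ck k g \<Longrightarrow> Ck k (\<lambda>x. f x + g x)"
proof (induction k arbitrary: f g)
  case (Suc k)
  then have "partial i (\<lambda>x. f x + g x) = (\<lambda>x. partial i f x + partial i g x)" for i
    by (auto simp: partial_add)
  with Suc show ?case by auto
qed (auto intro: continuous_intros)

lemma partial_mult:
  fixes f g :: "real^'n::finite \<Rightarrow> real"
  assumes "f differentiable (at x)" "g differentiable (at x)"
  shows "partial i (\<lambda>x. f x * g x) x = f x * partial i g x + partial i f x * g x"
  using partial_eqI[OF has_derivative_mult[OF assms[unfolded frechet_derivative_works]]] by (simp add: partial_def)

lemma Ck_mult: "Ck k f \<Longrightarrow> Ck k g \<Longrightarrow> Ck k (\<lambda>x. f x * g x)"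
proof (induction k arbitrary: f g)
  case (Suc k)
  then have "partial i (\<lambda>x. f x * g x) = (\<lambda>x. f x * partial i g x + partial i f x * g x)" for i
    by (auto simp: partial_mult)
  moreover have "Ck k f" "Ck k g" using Suc.prems Ck_Suc_imp by blast+
  ultimately show ?case using Suc by (auto intro!: Ck_add)
qed (auto intro: continuous_intros)

lemma partial_affine:
  fixes f :: "real^'n::finite \<Rightarrow> real"
  assumes "f differentiable (at (c *\<^sub>R (y - a)))"
  shows "((\<lambda>y. f (c *\<^sub>R (y - a))) has_derivative (\<lambda>v. \<Sum>i\<in>UNIV. v $ i * (c * partial i f (c *\<^sub>R (y - a))))) (at y)"
    and "partial i (\<lambda>y. f (c *\<^sub>R (y - a))) y = c * partial i f (c *\<^sub>R (y - a))"
proof -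
  have g: "((\<lambda>y. c *\<^sub>R (y - a)) has_derivative (\<lambda>v. c *\<^sub>R v)) (at y)"
    by (auto intro!: derivative_eq_intros)
  from has_derivative_compose[OF g has_derivative_partials[OF assms]]
  show 1: "((\<lambda>y. f (c *\<^sub>R (y - a))) has_derivative (\<lambda>v. \<Sum>i\<in>UNIV. v $ i * (c * partial i f (c *\<^sub>R (y - a))))) (at y)"
    by (simp add: mult_ac)
  show "partial i (\<lambda>y. f (c *\<^sub>R (y - a))) y = c * partial i f (c *\<^sub>R (y - a))"
    unfolding partial_eqI[OF 1] by (simp add: axis_def if_distrib[where f="\<lambda>z. z * _"] cong: if_cong)
qed

lemma Ck_affine: "Ck k f \<Longrightarrow> Ck k (\<lambda>y. f (c *\<^sub>R (y - a)))"
proof (induction k arbitrary: f)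
  case 0
  then have "continuous_on UNIV f" by simp
  then show ?case
    by (auto intro!: continuous_on_compose2[of UNIV f] continuous_intros)
next
  case (Suc k)
  then have f: "\<And>x. f differentiable at x" and p: "\<And>i. Ck k (partial i f)" by auto
  have "partial i (\<lambda>y. f (c *\<^sub>R (y - a))) = (\<lambda>y. c * partial i f (c *\<^sub>R (y - a)))" for i
    using partial_affine(2)[OF f] by auto
  moreover have "(\<lambda>y. f (c *\<^sub>R (y - a))) differentiable at y" for y
    using partial_affine(1)[OF f] unfolding differentiable_def by blast
  ultimately show ?case
    using Suc.IH[OF p] by (auto intro!: Ck_mult Ck_const)
qed

text \<open>Derivatives of members of this family are linear combinations of members, so one induction shows that all
  of them are smooth.\<close>

definition cusp :: "nat \<Rightarrow> real \<Rightarrow> real" where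
  "cusp j t = (if t > 0 then exp (- (1 / t)) / t ^ j else 0)"

lemma power_over_fact_le_exp:
  fixes x :: real
  assumes "x \<ge> 0"
  shows "x ^ m / fact m \<le> exp x"
proof -
  have "sum (\<lambda>n. x ^ n /\<^sub>R fact n) {m} \<le> (\<Sum>n. x ^ n /\<^sub>R fact n)"
    using assms by (intro sum_le_suminf summable_exp_generic) auto
  then show ?thesis by (simp add: exp_def divide_inverse mult.commute)
qed

text \<open>The term of order j + 2 in the series of exp (1 / t) beats the denominator t ^ j with
  two powers of t to spare. Quadratic vanishing is more than differentiability at 0 asks
  for.\<close>

lemma cusp_le_square: "\<bar>cusp j t\<bar> \<le> fact (j + 2) * t\<^sup>2"
proof (cases "t > 0")
  case True
  have "(1 / t) ^ (j + 2) / fact (j + 2) \<le> exp (1 / t)"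
    using power_over_fact_le_exp[of "1 / t" "j + 2"] True by simp
  then have "exp (- (1 / t)) \<le> fact (j + 2) * t ^ (j + 2)"
    using True by (simp only: exp_minus) (simp add: power_divide divide_simps mult_ac del: fact_Suc power_Suc add_2_eq_Suc')
  then have "exp (- (1 / t)) \<le> (fact (j + 2) * t\<^sup>2) * t ^ j"
    by (simp only: power_add mult_ac)
  then show ?thesis using True
    by (simp only: cusp_def if_True abs_of_nonneg exp_ge_zero zero_le_power divide_nonneg_nonneg less_imp_le pos_divide_le_eq zero_less_power)
qed (simp add: cusp_def)

lemma cusp_deriv: "(cusp j has_real_derivative (cusp (j + 2) t - real j * cusp (j + 1) t)) (at t)"
proof -
  consider "t > 0" | "t < 0" | "t = 0" by linarith
  then show ?thesis
  proof cases
    case 1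
    have "((\<lambda>t. exp (- (1 / t)) / t ^ j) has_real_derivative
        (exp (- (1 / t)) / t^2 * t ^ j - exp (- (1 / t)) * (real j * t ^ (j - 1))) / (t ^ j * t ^ j)) (at t)"
      using 1 by (auto intro!: derivative_eq_intros simp: power2_eq_square)
    moreover have "(exp (- (1 / t)) / t^2 * t ^ j - exp (- (1 / t)) * (real j * t ^ (j - 1))) / (t ^ j * t ^ j)
        = cusp (j + 2) t - real j * cusp (j + 1) t"
      using 1 by (cases j) (auto simp: cusp_def field_simps power2_eq_square)
    ultimately have "((\<lambda>t. exp (- (1 / t)) / t ^ j) has_real_derivative (cusp (j + 2) t - real j * cusp (j + 1) t)) (at t)"
      by simp
    then show ?thesis
      by (rule has_field_derivative_transform_within_open[where S="{0<..}"]) (use 1 in \<open>auto simp: cusp_def\<close>)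
  next
    case 2
    have "((\<lambda>t. 0) has_real_derivative (cusp (j + 2) t - real j * cusp (j + 1) t)) (at t)"
      using 2 by (auto simp: cusp_def)
    then show ?thesis
      by (rule has_field_derivative_transform_within_open[where S="{..<0}"]) (use 2 in \<open>auto simp: cusp_def\<close>)
  next
    \<comment> \<open>Both cusps in the claimed derivative vanish at 0, so the derivative there must
      be 0; the quadratic bound keeps the difference quotients below a multiple of
      \<open>\<bar>h\<bar>\<close>.\<close>
    case 3
    have "((\<lambda>h. cusp j h / h) \<longlongrightarrow> 0) (at 0)"
    proof (rule tendsto_rabs_zero_cancel, rule tendsto_sandwich[OF _ _ tendsto_const])
      show "\<forall>\<^sub>F h in at 0. 0 \<le> \<bar>cusp j h / h\<bar>" by simp
      show "\<forall>\<^sub>F h in at (0::real). \<bar>cusp j h / h\<bar> \<le> fact (j + 2) * \<bar>h\<bar>"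
      proof (rule eventually_at_topological[THEN iffD2], intro exI[of _ UNIV] conjI ballI impI)
        fix h :: real assume "h \<noteq> 0"
        then have "\<bar>cusp j h\<bar> / \<bar>h\<bar> \<le> (fact (j + 2) * h\<^sup>2) / \<bar>h\<bar>"
          by (intro divide_right_mono cusp_le_square) auto
        also have "\<dots> = fact (j + 2) * \<bar>h\<bar>"
          using \<open>h \<noteq> 0\<close> power2_abs[of h] by (simp add: power2_eq_square nonzero_divide_eq_eq mult.assoc)
        finally show "\<bar>cusp j h / h\<bar> \<le> fact (j + 2) * \<bar>h\<bar>" by simp
      qed auto
      have "((\<lambda>h::real. fact (j + 2) * \<bar>h\<bar>) \<longlongrightarrow> fact (j + 2) * \<bar>0\<bar>) (at 0)"
        by (intro tendsto_intros)
      then show "((\<lambda>h::real. fact (j + 2) * \<bar>h\<bar>) \<longlongrightarrow> 0) (at 0)" by simp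
    qed
    then show ?thesis using 3 by (simp add: has_field_derivative_iff cusp_def)
  qed
qed

text \<open>Composition with \<open>1 - z \<bullet> z\<close> places the support in the unit ball.
  The index is kept because differentiation raises it: \<open>bump 0\<close> serves as Q, and its
  gradient involves \<open>bump 2\<close>.\<close>

definition bump :: "nat \<Rightarrow> real^'n::finite \<Rightarrow> real" where
  "bump j z = cusp j (1 - z \<bullet> z)"

lemma bump_has_derivative:
  "(bump j has_derivative (\<lambda>v. (bump (j + 2) z - real j * bump (j + 1) z) * (-2 * (z \<bullet> v)))) (at z)"
proof -
  have "((\<lambda>z. 1 - z \<bullet> z) has_derivative (\<lambda>v. -2 * (z \<bullet> v))) (at z)"
    by (auto intro!: derivative_eq_intros simp: inner_commute)
  from has_derivative_compose[OF this cusp_deriv[unfolded has_field_derivative_def]]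
  show ?thesis unfolding bump_def .
qed

lemma partial_bump:
  "partial i (bump j) z = -2 * (z $ i) * (bump (j + 2) z - real j * bump (j + 1) z)"
  unfolding partial_eqI[OF bump_has_derivative] by (simp add: inner_axis)

lemma Ck_bump: "Ck k (bump j :: real^'n::finite \<Rightarrow> real)"
proof (induction k arbitrary: j)
  case 0
  show ?case 
    using bump_has_derivative by (auto simp: continuous_on_eq_continuous_at intro: has_derivative_continuous)
next
  case (Suc k)
  have "partial i (bump j :: real^'n \<Rightarrow> real) = (\<lambda>z. (-2 * (z $ i)) * (bump (j + 2) z + (- real j) * bump (j + 1) z))" for i
    by (auto simp: partial_bump)
  moreover have "Ck k (\<lambda>z::real^'n. (-2 * (z $ i)) * (bump (j + 2) z + (- real j) * bump (j + 1) z))" for i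
    by (intro Ck_mult Ck_add Ck_const Ck_nth Suc)
  ultimately show ?case
    using bump_has_derivative unfolding Ck.simps differentiable_def by metis
qed

lemma bump_eq_0: "norm z \<ge> 1 \<Longrightarrow> bump j z = 0"
  using one_le_power[of "norm z" 2] by (simp add: bump_def cusp_def dot_square_norm not_less)

lemma bump_nonneg: "bump j z \<ge> 0"
  by (simp add: bump_def cusp_def)

lemma bump_pos: "norm z < 1 \<Longrightarrow> bump j z > 0"
  using power_strict_mono[of "norm z" 1 2] by (simp add: bump_def cusp_def dot_square_norm)

section \<open>Calculus of test functions\<close>

lemma test_functionI:
  fixes f :: "real^'n::finite \<Rightarrow> real"
  assumes "\<And>k. Ck k f" "\<And>z. norm z \<ge> \<rho> \<Longrightarrow> f z = 0"
  shows "test_function f"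
proof -
  have "{x. f x \<noteq> 0} \<subseteq> cball 0 \<rho>" using assms(2) by (force simp: not_le[symmetric] less_imp_le)
  then have "bounded {x. f x \<noteq> 0}" using bounded_cball bounded_subset by blast
  then show ?thesis using assms(1) by (simp add: test_function_def compact_closure)
qed

lemma test_functionD:
  assumes "test_function f"
  shows "Ck k f" "\<exists>\<rho>>0. \<forall>z. norm z \<ge> \<rho> \<longrightarrow> f z = 0"
proof -
  show "Ck k f" using assms by (simp add: test_function_def)
  from assms have "bounded (closure {x. f x \<noteq> 0})"
    by (auto simp: test_function_def intro: compact_imp_bounded)
  then have "bounded {x. f x \<noteq> 0}" using bounded_subset closure_subset by metis
  then obtain B where B: "B > 0" "\<And>x. f x \<noteq> 0 \<Longrightarrow> norm x \<le> B" by (auto simp: bounded_pos)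
  show "\<exists>\<rho>>0. \<forall>z. norm z \<ge> \<rho> \<longrightarrow> f z = 0"
    using B by (intro exI[of _ "B + 1"]) force
qed

lemma test_function_differentiable: "test_function f \<Longrightarrow> f differentiable at x"
  using test_functionD(1)[of f "Suc 0"] by simp

lemma test_function_continuous: "test_function f \<Longrightarrow> continuous_on S f"
  using test_functionD(1)[of f 0] continuous_on_subset by fastforce

lemma test_function_measurable: "test_function f \<Longrightarrow> f \<in> borel_measurable borel"
  by (simp add: borel_measurable_continuous_onI test_function_continuous)

lemma test_function_bump: "test_function (bump j)"
  by (rule test_functionI[where \<rho>=1]) (auto intro: Ck_bump bump_eq_0)

lemma test_function_partial:
  fixes f :: "real^'n::finite \<Rightarrow> real"
  assumes "test_function f"
  shows "test_function (partial i f)"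
proof -
  obtain \<rho> where \<rho>: "\<rho> > 0" "\<And>z. norm z \<ge> \<rho> \<Longrightarrow> f z = 0" using test_functionD(2)[OF assms] by blast
  show ?thesis
  \<comment> \<open>The radius grows by 1 so that all points concerned lie in the open set
    \<open>- cball 0 \<rho>\<close>, on which f is constantly 0.\<close>
  proof (rule test_functionI[where \<rho>="\<rho> + 1"])
    fix k show "Ck k (partial i f)" using test_functionD(1)[OF assms, of "Suc k"] by simp
  next
    fix z :: "real^'n" assume "\<rho> + 1 \<le> norm z"
    then have z: "z \<in> - cball 0 \<rho>" by auto
    have "((\<lambda>x. 0) has_derivative (\<lambda>v. 0)) (at z)" by simp
    then have "(f has_derivative (\<lambda>v. 0)) (at z)"
      by (rule has_derivative_transform_within_open[of _ _ _ _ "- cball 0 \<rho>"]) (use z \<rho> in auto)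
    from partial_eqI[OF this] show "partial i f z = 0" by simp
  qed
qed

lemma test_function_mult_left:
  assumes "\<And>k. Ck k g" "test_function f"
  shows "test_function (\<lambda>z. g z * f z)"
proof -
  obtain \<rho> where \<rho>: "\<rho> > 0" "\<And>z. norm z \<ge> \<rho> \<Longrightarrow> f z = 0" using test_functionD(2)[OF assms(2)] by blast
  show ?thesis
    by (rule test_functionI[where \<rho>=\<rho>]) (use assms \<rho> test_functionD in \<open>auto intro!: Ck_mult\<close>)
qed

lemma test_function_add:
  assumes "test_function f" "test_function g"
  shows "test_function (\<lambda>z. f z + g z)"
proof -
  obtain \<rho> where \<rho>: "\<rho> > 0" "\<And>z. norm z \<ge> \<rho> \<Longrightarrow> f z = 0" using test_functionD(2)[OF assms(1)] by blast
  obtain \<rho>' where \<rho>': "\<rho>' > 0" "\<And>z. norm z \<ge> \<rho>' \<Longrightarrow> g z = 0" using test_functionD(2)[OF assms(2)] by blast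
  show ?thesis
    by (rule test_functionI[where \<rho>="max \<rho> \<rho>'"]) (use assms \<rho> \<rho>' test_functionD in \<open>auto intro!: Ck_add\<close>)
qed

lemma test_function_sum:
  "finite A \<Longrightarrow> (\<And>a. a \<in> A \<Longrightarrow> test_function (f a)) \<Longrightarrow> test_function (\<lambda>z. \<Sum>a\<in>A. f a z)"
proof (induction A rule: finite_induct)
  case empty
  show ?case by (rule test_functionI[where \<rho>=0]) (auto intro: Ck_const)
qed (auto intro: test_function_add)

lemma test_function_affine:
  fixes f :: "real^'n::finite \<Rightarrow> real"
  assumes "test_function f" "c > 0"
  shows "test_function (\<lambda>y. f (c *\<^sub>R (y - a)))"
proof -
  obtain \<rho> where \<rho>: "\<rho> > 0" "\<And>z. norm z \<ge> \<rho> \<Longrightarrow> f z = 0" using test_functionD(2)[OF assms(1)] by blast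
  show ?thesis
  proof (rule test_functionI[where \<rho>="norm a + \<rho> / c"])
    fix z :: "real^'n" assume "norm a + \<rho> / c \<le> norm z"
    then have "\<rho> / c \<le> norm (z - a)" using norm_triangle_ineq2[of z a] by linarith
    then have "\<rho> \<le> norm (c *\<^sub>R (z - a))"
      unfolding norm_scaleR using assms(2) by (simp add: pos_divide_le_eq mult.commute)
    then show "f (c *\<^sub>R (z - a)) = 0" by (rule \<rho>(2))
  qed (use assms test_functionD in \<open>auto intro!: Ck_affine\<close>)
qed

lemma test_function_bounded:
  fixes f :: "real^'n::finite \<Rightarrow> real"
  assumes "test_function f"
  shows "\<exists>B\<ge>0. \<forall>x. \<bar>f x\<bar> \<le> B"
proof -
  obtain \<rho> where \<rho>: "\<rho> > 0" "\<And>z. norm z \<ge> \<rho> \<Longrightarrow> f z = 0" using test_functionD(2)[OF assms] by blast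
  have "compact (f ` cball 0 \<rho>)"
    by (intro compact_continuous_image test_function_continuous assms compact_cball)
  then obtain B where B: "\<And>x. x \<in> cball 0 \<rho> \<Longrightarrow> \<bar>f x\<bar> \<le> B" "B > 0"
    by (force dest: compact_imp_bounded simp: bounded_pos)
  show ?thesis
  proof (intro exI[of _ B] conjI allI)
    fix x show "\<bar>f x\<bar> \<le> B" using B \<rho>(2)[of x] by (cases "norm x \<le> \<rho>") auto
  qed (use B in auto)
qed

section \<open>Mean value estimates for finite differences\<close>

lemma mean_value_partials:
  fixes f :: "real^'n::finite \<Rightarrow> real"
  assumes "\<And>x. f differentiable at x"
  shows "\<exists>t. 0 < t \<and> t < 1 \<and> f (x + v) - f x = (\<Sum>i\<in>UNIV. v $ i * partial i f (x + t *\<^sub>R v))"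
proof -
  have d: "((\<lambda>t. f (x + t *\<^sub>R v)) has_derivative (\<lambda>\<tau>. \<tau> * (\<Sum>i\<in>UNIV. v $ i * partial i f (x + t *\<^sub>R v)))) (at t)" for t
  proof -
    have "((\<lambda>t. x + t *\<^sub>R v) has_derivative (\<lambda>\<tau>. \<tau> *\<^sub>R v)) (at t)"
      by (auto intro!: derivative_eq_intros)
    from has_derivative_compose[OF this has_derivative_partials[OF assms]]
    show ?thesis by (simp add: sum_distrib_left mult_ac)
  qed
  have "continuous_on {0..1} (\<lambda>t. f (x + t *\<^sub>R v))"
    using d by (intro continuous_at_imp_continuous_on ballI has_derivative_continuous) blast
  from mvt[OF zero_less_one this d]
  obtain t where "t \<in> {0<..<1}" "f (x + 1 *\<^sub>R v) - f (x + 0 *\<^sub>R v) = (1 - 0) * (\<Sum>i\<in>UNIV. v $ i * partial i f (x + t *\<^sub>R v))"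
    by auto
  then show ?thesis by auto
qed

lemma partials_bounded_imp_Lipschitz:
  fixes f :: "real^'n::finite \<Rightarrow> real"
  assumes "\<And>x. f differentiable at x" "\<And>i x. \<bar>partial i f x\<bar> \<le> L"
  shows "\<bar>f (x + v) - f x\<bar> \<le> real CARD('n) * L * norm v"
proof -
  obtain t where "f (x + v) - f x = (\<Sum>i\<in>UNIV. v $ i * partial i f (x + t *\<^sub>R v))"
    using mean_value_partials[OF assms(1)] by blast
  also have "\<bar>\<dots>\<bar> \<le> (\<Sum>i\<in>(UNIV::'n set). norm v * L)"
  proof (rule order_trans[OF sum_abs], intro sum_mono)
    fix i show "\<bar>v $ i * partial i f (x + t *\<^sub>R v)\<bar> \<le> norm v * L"
      unfolding abs_mult by (intro mult_mono assms component_le_norm_cart) auto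
  qed
  finally show ?thesis by (simp add: mult_ac)
qed

text \<open>Iterated differences take the place of derivatives of the solution, whose existence is
  only deduced at the end from bounds on these differences.\<close>

definition diff :: "real^'n::finite \<Rightarrow> (real^'n \<Rightarrow> real) \<Rightarrow> real^'n \<Rightarrow> real" where
  "diff a f x = f (x + a) - f x"

lemma test_function_Lipschitz:
  fixes f :: "real^'n::finite \<Rightarrow> real"
  assumes "test_function f"
  shows "\<exists>L\<ge>0. \<forall>a x. \<bar>diff a f x\<bar> \<le> L * norm a"
proof -
  have "\<forall>i. \<exists>B\<ge>0. \<forall>x. \<bar>partial i f x\<bar> \<le> B"
    using test_function_bounded test_function_partial assms by blast
  then obtain B where B: "\<And>i. B i \<ge> 0" "\<And>i x. \<bar>partial i f x\<bar> \<le> B i" by metis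
  have "\<bar>partial i f x\<bar> \<le> (\<Sum>i\<in>UNIV. B i)" for i x
    by (rule order_trans[OF B(2)[of i x]]) (auto intro!: member_le_sum B)
  then show ?thesis
    using partials_bounded_imp_Lipschitz[of f "\<Sum>i\<in>UNIV. B i"] test_function_differentiable[OF assms] B(1)
    by (intro exI[of _ "real CARD('n) * (\<Sum>i\<in>UNIV. B i)"]) (auto simp: diff_def sum_nonneg)
qed

lemma test_function_Lipschitz_partials:
  fixes f :: "real^'n::finite \<Rightarrow> real"
  assumes "test_function f"
  shows "\<exists>L\<ge>0. \<forall>i a x. \<bar>diff a (partial i f) x\<bar> \<le> L * norm a"
proof -
  have "\<forall>i. \<exists>B\<ge>0. \<forall>a x. \<bar>diff a (partial i f) x\<bar> \<le> B * norm a"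
    using test_function_Lipschitz test_function_partial assms by blast
  then obtain B where B: "\<And>i. B i \<ge> 0" "\<And>i a x. \<bar>diff a (partial i f) x\<bar> \<le> B i * norm a" by metis
  have "\<bar>diff a (partial i f) x\<bar> \<le> (\<Sum>i\<in>UNIV. B i) * norm a" for i a x
    by (rule order_trans[OF B(2)[of a i x]]) (auto intro!: mult_right_mono member_le_sum B)
  then show ?thesis using B(1)
    by (intro exI[of _ "\<Sum>i\<in>UNIV. B i"]) (auto intro!: sum_nonneg)
qed

text \<open>The difference \<open>diff b f\<close> is differentiable with partials
  \<open>diff b (partial i f)\<close>, which are O(\<open>norm b\<close>) because the partials of a
  test function are Lipschitz. The mean value bound in direction a supplies the other
  factor.\<close>

lemma test_function_diff2:
  fixes f :: "real^'n::finite \<Rightarrow> real"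
  assumes "test_function f"
  shows "\<exists>L\<ge>0. \<forall>a b x. \<bar>diff a (diff b f) x\<bar> \<le> L * norm a * norm b"
proof -
  obtain L where L: "L \<ge> 0" "\<And>i a x. \<bar>diff a (partial i f) x\<bar> \<le> L * norm a"
    using test_function_Lipschitz_partials[OF assms] by blast
  have d: "(diff b f has_derivative (\<lambda>v. \<Sum>i\<in>UNIV. v $ i * diff b (partial i f) x)) (at x)" for b x
  proof -
    have g: "((\<lambda>x. x + b) has_derivative (\<lambda>v. v)) (at x)" by (auto intro!: derivative_eq_intros)
    from has_derivative_diff[OF has_derivative_compose[OF g has_derivative_partials[OF test_function_differentiable[OF assms]]]
        has_derivative_partials[OF test_function_differentiable[OF assms]]]
    show ?thesis unfolding diff_def by (simp add: sum_subtractf right_diff_distrib)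
  qed
  have p: "partial i (diff b f) x = diff b (partial i f) x" for i b x
    unfolding partial_eqI[OF d] by (simp add: axis_def if_distrib[where f="\<lambda>z. z * _"] cong: if_cong)
  have "\<bar>diff a (diff b f) x\<bar> \<le> real CARD('n) * (L * norm b) * norm a" for a b x
    unfolding diff_def[of a "diff b f"]
    using d L by (intro partials_bounded_imp_Lipschitz) (auto simp: p differentiable_def)
  then show ?thesis using L(1)
    by (intro exI[of _ "real CARD('n) * L"]) (auto simp: mult_ac)
qed

text \<open>The mean value theorem evaluates the partials at an intermediate point; their Lipschitz
  bound pays for moving back to x.\<close>

lemma test_function_Taylor:
  fixes f :: "real^'n::finite \<Rightarrow> real"
  assumes "test_function f"
  shows "\<exists>L\<ge>0. \<forall>x v. \<bar>f (x + v) - f x - (\<Sum>i\<in>UNIV. v $ i * partial i f x)\<bar> \<le> L * (norm v)\<^sup>2"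
proof -
  obtain L where L: "L \<ge> 0" "\<And>i a x. \<bar>diff a (partial i f) x\<bar> \<le> L * norm a"
    using test_function_Lipschitz_partials[OF assms] by blast
  have "\<bar>f (x + v) - f x - (\<Sum>i\<in>UNIV. v $ i * partial i f x)\<bar> \<le> (real CARD('n) * L) * (norm v)\<^sup>2" for x v
  proof -
    obtain t where t: "0 < t" "t < 1" "f (x + v) - f x = (\<Sum>i\<in>UNIV. v $ i * partial i f (x + t *\<^sub>R v))"
      using mean_value_partials[OF test_function_differentiable[OF assms]] by blast
    have "f (x + v) - f x - (\<Sum>i\<in>UNIV. v $ i * partial i f x) = (\<Sum>i\<in>UNIV. v $ i * diff (t *\<^sub>R v) (partial i f) x)"
      unfolding t(3) diff_def by (simp add: sum_subtractf right_diff_distrib)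
    also have "\<bar>\<dots>\<bar> \<le> (\<Sum>i\<in>(UNIV::'n set). norm v * (L * norm v))"
    proof (rule order_trans[OF sum_abs], intro sum_mono)
      fix i
      have "\<bar>diff (t *\<^sub>R v) (partial i f) x\<bar> \<le> L * norm (t *\<^sub>R v)" by (rule L)
      also have "\<dots> \<le> L * norm v" using t L by (intro mult_left_mono) (auto intro: mult_left_le_one_le)
      finally show "\<bar>v $ i * diff (t *\<^sub>R v) (partial i f) x\<bar> \<le> norm v * (L * norm v)"
        by (auto simp: abs_mult intro!: mult_mono component_le_norm_cart)
    qed
    finally show ?thesis by (simp add: power2_eq_square mult_ac)
  qed
  then show ?thesis using L(1) by (intro exI[of _ "real CARD('n) * L"]) auto
qed

section \<open>Averages against a kernel\<close>

lemma integrable_on_finite_measure_set: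
  fixes g :: "real^'n::finite \<Rightarrow> real"
  assumes g: "g \<in> borel_measurable borel" and A: "A \<in> sets borel" "emeasure lborel A < \<infinity>"
    and b: "\<And>z. \<bar>g z\<bar> \<le> B" "\<And>z. z \<notin> A \<Longrightarrow> g z = 0"
  shows "integrable lborel g" "(LINT z|lborel. \<bar>g z\<bar>) \<le> B * measure lborel A"
proof -
  have i: "integrable lborel (\<lambda>z. B * indicator A z)"
    using A by (intro integrable_mult_right integrable_real_indicator) auto
  have le: "\<bar>g z\<bar> \<le> B * indicator A z" for z using b by (auto simp: indicator_def)
  show int: "integrable lborel g"
    by (rule Bochner_Integration.integrable_bound[OF i]) (use g le abs_ge_self in \<open>auto intro: order_trans\<close>)
  have "(LINT z|lborel. \<bar>g z\<bar>) \<le> (LINT z|lborel. B * indicator A z)"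
    using int i le by (intro integral_mono) auto
  also have "\<dots> = B * measure lborel A" using A by simp
  finally show "(LINT z|lborel. \<bar>g z\<bar>) \<le> B * measure lborel A" .
qed

lemma test_function_integrable:
  assumes "test_function \<kappa>"
  shows "integrable lborel \<kappa>"
proof -
  obtain \<rho> where \<rho>: "\<rho> > 0" "\<And>z. norm z \<ge> \<rho> \<Longrightarrow> \<kappa> z = 0" using test_functionD(2)[OF assms] by blast
  obtain B where B: "\<And>x. \<bar>\<kappa> x\<bar> \<le> B" using test_function_bounded[OF assms] by blast
  show ?thesis
    by (rule integrable_on_finite_measure_set[of _ "cball 0 \<rho>" B])
      (use assms \<rho> B emeasure_bounded_finite[OF bounded_cball, of 0 \<rho>] in \<open>auto simp: test_function_measurable\<close>)
qed

lemma lborel_translate: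
  fixes f :: "'a::euclidean_space \<Rightarrow> real"
  assumes [measurable]: "f \<in> borel_measurable borel"
  shows "(LINT z|lborel. f (z + a)) = (LINT z|lborel. f z)"
    and "integrable lborel (\<lambda>z. f (z + a)) \<longleftrightarrow> integrable lborel f"
proof -
  have e: "distr lborel borel (\<lambda>z. z + a) = (lborel :: 'a measure)"
    using lborel_distr_plus[of a] by (simp add: add.commute[of _ a])
  show "(LINT z|lborel. f (z + a)) = (LINT z|lborel. f z)"
    using integral_distr[of "\<lambda>z. z + a" lborel borel f] by (simp add: e)
  show "integrable lborel (\<lambda>z. f (z + a)) \<longleftrightarrow> integrable lborel f"
    using integrable_distr_eq[of "\<lambda>z. z + a" lborel borel f] by (simp add: e)
qed

lemma lborel_affine_integral:
  fixes f :: "'a::euclidean_space \<Rightarrow> real"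
  assumes [measurable]: "f \<in> borel_measurable borel" and "c \<noteq> 0"
  shows "(LINT z|lborel. f z) = \<bar>c\<bar> ^ DIM('a) * (LINT z|lborel. f (t + c *\<^sub>R z))"
    and "integrable lborel (\<lambda>z. f (t + c *\<^sub>R z)) \<longleftrightarrow> integrable lborel f"
proof -
  have m: "(\<lambda>x. t + c *\<^sub>R x) \<in> measurable lborel borel" by measurable
  show "(LINT z|lborel. f z) = \<bar>c\<bar> ^ DIM('a) * (LINT z|lborel. f (t + c *\<^sub>R z))"
    by (subst lborel_affine[OF \<open>c \<noteq> 0\<close>, of t], subst integral_density) (auto simp: integral_distr)
  have "integrable (density (distr lborel borel (\<lambda>x. t + c *\<^sub>R x)) (\<lambda>_. ennreal (\<bar>c\<bar>^DIM('a)))) f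
      \<longleftrightarrow> integrable lborel (\<lambda>z. f (t + c *\<^sub>R z))"
    using \<open>c \<noteq> 0\<close> by (subst integrable_density) (auto simp: integrable_distr_eq)
  then show "integrable lborel (\<lambda>z. f (t + c *\<^sub>R z)) \<longleftrightarrow> integrable lborel f"
    using lborel_affine[OF \<open>c \<noteq> 0\<close>, of t] by simp
qed

text \<open>S is some bound, not the least one, and it holds at every point. Borel measurability is
  demanded so that compositions with translations, dilations and shears stay measurable.\<close>

definition bounded_borel :: "(real^'n::finite \<Rightarrow> real) \<Rightarrow> real \<Rightarrow> bool" where
  "bounded_borel b S \<longleftrightarrow> b \<in> borel_measurable borel \<and> (\<forall>x. \<bar>b x\<bar> \<le> S)"

text \<open>There is no division by the integral of the kernel: as r tends to 0 the limit is b times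
  that integral, which is why the constant c recurs below.\<close>

definition av :: "(real^'n::finite \<Rightarrow> real) \<Rightarrow> real \<Rightarrow> (real^'n \<Rightarrow> real) \<Rightarrow> real^'n \<Rightarrow> real" where
  "av \<kappa> r b x = (LINT z|lborel. b (x + r *\<^sub>R z) * \<kappa> z)"

lemma bounded_borelD:
  assumes "bounded_borel b S"
  shows "b \<in> borel_measurable borel" "\<bar>b x\<bar> \<le> S" "0 \<le> S"
  using assms abs_ge_zero[of "b undefined"] by (auto simp: bounded_borel_def intro: order_trans)

lemma diff_measurable:
  assumes [measurable]: "b \<in> borel_measurable borel"
  shows "diff a b \<in> borel_measurable borel"
proof -
  have "(\<lambda>x. b (x + a) - b x) \<in> borel_measurable borel" by measurable
  then show ?thesis by (simp add: diff_def[abs_def])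
qed

lemma norm_ge_of_notin_cball:
  fixes z c :: "'a::real_normed_vector"
  shows "z \<notin> cball (- c) \<rho> \<Longrightarrow> \<rho> \<le> norm (z + c)"
  by (simp add: dist_norm norm_minus_commute[of "- c"] less_imp_le not_le)

lemma bounded_borel_diff: 
  assumes "bounded_borel b S" 
  shows "bounded_borel (diff a b) (2 * S)"
proof -
  have "\<bar>diff a b x\<bar> \<le> 2 * S" for x
    using bounded_borelD(2)[OF assms, of "x + a"] bounded_borelD(2)[OF assms, of x] by (simp add: diff_def)
  then show ?thesis using bounded_borelD[OF assms] diff_measurable by (auto simp: bounded_borel_def)
qed

lemma av_integrable:
  assumes "bounded_borel b S" and "integrable lborel \<kappa>"
  shows "integrable lborel (\<lambda>z. b (x + r *\<^sub>R z) * \<kappa> z)"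
proof -
  have [measurable]: "b \<in> borel_measurable borel" "\<kappa> \<in> borel_measurable borel"
    using assms bounded_borelD by auto
  show ?thesis
  proof (rule Bochner_Integration.integrable_bound[OF integrable_mult_right[OF integrable_norm[OF assms(2)], of S]])
    show "AE z in lborel. norm (b (x + r *\<^sub>R z) * \<kappa> z) \<le> norm (S * norm (\<kappa> z))"
      using bounded_borelD(2,3)[OF assms(1)] by (auto simp: abs_mult intro!: mult_right_mono)
  qed simp
qed

lemma av_bound:
  assumes "bounded_borel b S" and "integrable lborel \<kappa>"
  shows "\<bar>av \<kappa> r b x\<bar> \<le> S * (LINT z|lborel. \<bar>\<kappa> z\<bar>)"
proof -
  have "\<bar>av \<kappa> r b x\<bar> \<le> (LINT z|lborel. \<bar>b (x + r *\<^sub>R z) * \<kappa> z\<bar>)"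
    unfolding av_def by (rule integral_abs_bound)
  also have "\<dots> \<le> (LINT z|lborel. S * \<bar>\<kappa> z\<bar>)"
    using assms by (intro integral_mono integrable_mult_right integrable_abs av_integrable[OF assms(1)])
      (auto simp: abs_mult intro!: mult_right_mono bounded_borelD[OF assms(1)])
  finally show ?thesis by simp
qed

lemma av_diff:
  assumes "bounded_borel b S" and "integrable lborel \<kappa>"
  shows "av \<kappa> r (diff a b) x = diff a (av \<kappa> r b) x"
proof -
  have "av \<kappa> r (diff a b) x = (LINT z|lborel. b (x + a + r *\<^sub>R z) * \<kappa> z - b (x + r *\<^sub>R z) * \<kappa> z)"
    unfolding av_def diff_def by (simp add: left_diff_distrib add_ac)
  also have "\<dots> = diff a (av \<kappa> r b) x"
    unfolding diff_def av_def using assms by (intro Bochner_Integration.integral_diff av_integrable)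
  finally show ?thesis .
qed

lemma diff_integrable:
  fixes \<kappa> :: "real^'n::finite \<Rightarrow> real"
  shows "integrable lborel \<kappa> \<Longrightarrow> integrable lborel (diff a \<kappa>)"
  unfolding diff_def by (intro Bochner_Integration.integrable_diff) (auto simp: lborel_translate)

lemma av_shift:
  assumes b: "bounded_borel b S" and k: "integrable lborel \<kappa>" and "r > 0"
  shows "av \<kappa> r b (x + a) = (LINT z|lborel. b (x + r *\<^sub>R z) * \<kappa> (z + (- inverse r) *\<^sub>R a))"
proof -
  have [measurable]: "b \<in> borel_measurable borel" "\<kappa> \<in> borel_measurable borel"
    using b k bounded_borelD by auto
  have "(LINT z|lborel. b (x + r *\<^sub>R z) * \<kappa> (z + (- inverse r) *\<^sub>R a))
    = (LINT z|lborel. b (x + r *\<^sub>R (z + inverse r *\<^sub>R a)) * \<kappa> ((z + inverse r *\<^sub>R a) + (- inverse r) *\<^sub>R a))"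
    by (rule lborel_translate(1)[symmetric, of "\<lambda>z. b (x + r *\<^sub>R z) * \<kappa> (z + (- inverse r) *\<^sub>R a)"]) measurable
  also have "\<dots> = av \<kappa> r b (x + a)"
    unfolding av_def using \<open>r > 0\<close> by (simp add: scaleR_add_right add_ac)
  finally show ?thesis by simp
qed

text \<open>Translating the integration variable by a / r turns the difference in x into a
  difference of the kernel with step - a / r. The powers of 1 / r in the difference bounds come from
  this.\<close>

lemma av_diff_adjoint:
  assumes b: "bounded_borel b S" and k: "integrable lborel \<kappa>" and "r > 0"
  shows "av \<kappa> r (diff a b) x = av (diff ((- inverse r) *\<^sub>R a) \<kappa>) r b x"
proof -
  have i: "integrable lborel (\<lambda>z. \<kappa> (z + c))" for c using k by (simp add: lborel_translate)
  have "av \<kappa> r (diff a b) x = av \<kappa> r b (x + a) - av \<kappa> r b x"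
    unfolding av_diff[OF b k] diff_def ..
  also have "\<dots> = (LINT z|lborel. b (x + r *\<^sub>R z) * \<kappa> (z + (- inverse r) *\<^sub>R a) - b (x + r *\<^sub>R z) * \<kappa> z)"
    unfolding av_shift[OF assms] unfolding av_def
    by (intro Bochner_Integration.integral_diff[symmetric] av_integrable[OF b] k i)
  finally show ?thesis unfolding av_def[of "diff _ _"] by (simp add: diff_def right_diff_distrib)
qed

lemma measure_cball_eq:
  fixes a :: "'a::euclidean_space"
  shows "measure lborel (cball a \<rho>) = measure lborel (cball (0::'a) \<rho>)"
  by (cases "\<rho> \<ge> 0") (auto simp: content_cball)

text \<open>The difference lives on two balls, each as large as the support of \<kappa>, so the L1
  norm is at most the Lipschitz bound times twice the volume of one ball. Using two balls instead of
  one enlarged ball keeps the estimate linear for arbitrarily large a.\<close>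

lemma test_function_L1_diff:
  fixes \<kappa> :: "real^'n::finite \<Rightarrow> real"
  assumes "test_function \<kappa>"
  shows "\<exists>C\<ge>0. \<forall>a. (LINT z|lborel. \<bar>diff a \<kappa> z\<bar>) \<le> C * norm a"
proof -
  obtain \<rho> where \<rho>: "\<rho> > 0" "\<And>z. norm z \<ge> \<rho> \<Longrightarrow> \<kappa> z = 0" using test_functionD(2)[OF assms] by blast
  obtain L where L: "L \<ge> 0" "\<And>a x. \<bar>diff a \<kappa> x\<bar> \<le> L * norm a" using test_function_Lipschitz[OF assms] by blast
  define m where "m = measure lborel (cball (0::real^'n) \<rho>)"
  have "(LINT z|lborel. \<bar>diff a \<kappa> z\<bar>) \<le> (L * (2 * m)) * norm a" for a
  proof -
    let ?A = "cball 0 \<rho> \<union> cball (- a) \<rho>"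
    have fin: "emeasure lborel ?A < \<infinity>" 
      by (intro emeasure_bounded_finite bounded_Un[THEN iffD2] conjI bounded_cball)
    have "(LINT z|lborel. \<bar>diff a \<kappa> z\<bar>) \<le> (L * norm a) * measure lborel ?A"
    proof (rule integrable_on_finite_measure_set(2))
      fix z assume "z \<notin> ?A"
      then have "norm z \<ge> \<rho>" "norm (z + a) \<ge> \<rho>"
        using norm_ge_of_notin_cball[of z a \<rho>] by auto
      then show "diff a \<kappa> z = 0" using \<rho> by (simp add: diff_def)
    qed (use fin L in \<open>auto intro!: diff_measurable test_function_measurable[OF assms]\<close>)
    also have "\<dots> \<le> (L * norm a) * (2 * m)"
    proof (intro mult_left_mono)
      have "measure lborel ?A \<le> measure lborel (cball (0::real^'n) \<rho>) + measure lborel (cball (-a) \<rho>)"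
        by (rule measure_Un_le) auto
      then show "measure lborel ?A \<le> 2 * m" unfolding m_def measure_cball_eq[of "-a"] by simp
    qed (use L in auto)
    finally show ?thesis by (simp add: mult_ac)
  qed
  moreover have "m \<ge> 0" by (simp add: m_def)
  ultimately show ?thesis using L(1) by (intro exI[of _ "L * (2 * m)"]) auto
qed

lemma test_function_L1_diff2:
  fixes \<kappa> :: "real^'n::finite \<Rightarrow> real"
  assumes "test_function \<kappa>"
  shows "\<exists>C\<ge>0. \<forall>a b. (LINT z|lborel. \<bar>diff a (diff b \<kappa>) z\<bar>) \<le> C * norm a * norm b"
proof -
  obtain \<rho> where \<rho>: "\<rho> > 0" "\<And>z. norm z \<ge> \<rho> \<Longrightarrow> \<kappa> z = 0" using test_functionD(2)[OF assms] by blast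
  obtain L where L: "L \<ge> 0" "\<And>a b x. \<bar>diff a (diff b \<kappa>) x\<bar> \<le> L * norm a * norm b" using test_function_diff2[OF assms] by blast
  define m where "m = measure lborel (cball (0::real^'n) \<rho>)"
  have "(LINT z|lborel. \<bar>diff a (diff b \<kappa>) z\<bar>) \<le> (L * (4 * m)) * norm a * norm b" for a b
  proof -
    \<comment> \<open>The four points at which a second difference evaluates \<kappa> give four
      balls, again with a total volume bounded independently of a and b.\<close>
    let ?A = "(cball 0 \<rho> \<union> cball (- a) \<rho>) \<union> (cball (- b) \<rho> \<union> cball (- (a + b)) \<rho>)"
    have fin: "emeasure lborel ?A < \<infinity>" 
      by (intro emeasure_bounded_finite bounded_Un[THEN iffD2] conjI bounded_cball)
    have "(LINT z|lborel. \<bar>diff a (diff b \<kappa>) z\<bar>) \<le> (L * norm a * norm b) * measure lborel ?A"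
    proof (rule integrable_on_finite_measure_set(2))
      fix z assume "z \<notin> ?A"
      then have "z \<notin> cball 0 \<rho>" "z \<notin> cball (- a) \<rho>" "z \<notin> cball (- b) \<rho>" "z \<notin> cball (- (a + b)) \<rho>" by auto
      then have "norm z \<ge> \<rho>" "norm (z + a) \<ge> \<rho>" "norm (z + b) \<ge> \<rho>" "norm (z + (a + b)) \<ge> \<rho>"
        using norm_ge_of_notin_cball[of z a \<rho>] norm_ge_of_notin_cball[of z b \<rho>] norm_ge_of_notin_cball[of z "a + b" \<rho>] by simp_all
      then show "diff a (diff b \<kappa>) z = 0" using \<rho> by (simp add: diff_def add.assoc)
    qed (use fin L in \<open>auto intro!: diff_measurable test_function_measurable[OF assms]\<close>)
    also have "\<dots> \<le> (L * norm a * norm b) * (4 * m)"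
    proof (intro mult_left_mono)
      have "measure lborel ?A \<le> measure lborel (cball (0::real^'n) \<rho> \<union> cball (- a) \<rho>)
          + measure lborel (cball (-b) \<rho> \<union> cball (-(a + b)) \<rho>)"
        by (rule measure_Un_le) auto
      also have "\<dots> \<le> (measure lborel (cball (0::real^'n) \<rho>) + measure lborel (cball (-a) \<rho>))
          + (measure lborel (cball (-b) \<rho>) + measure lborel (cball (-(a + b)) \<rho>))"
        by (intro add_mono measure_Un_le) auto
      finally show "measure lborel ?A \<le> 4 * m"
        unfolding m_def measure_cball_eq[of "-a"] measure_cball_eq[of "-b"] measure_cball_eq[of "-(a+b)"] by simp
    qed (use L in auto)
    finally show ?thesis by (simp add: mult_ac)
  qed
  moreover have "m \<ge> 0" by (simp add: m_def)
  ultimately show ?thesis using L(1) by (intro exI[of _ "L * (4 * m)"]) auto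
qed

text \<open>C depends on \<kappa> alone: the radius is absorbed in the rescaled step - a /
  r.\<close>

lemma av_diff_bound:
  fixes \<kappa> :: "real^'n::finite \<Rightarrow> real"
  assumes "test_function \<kappa>"
  shows "\<exists>C\<ge>0. \<forall>r>0. \<forall>b S a x. bounded_borel b S \<longrightarrow> \<bar>av \<kappa> r (diff a b) x\<bar> \<le> C * S * norm a / r"
proof -
  obtain C where C: "C \<ge> 0" "\<And>a. (LINT z|lborel. \<bar>diff a \<kappa> z\<bar>) \<le> C * norm a" using test_function_L1_diff[OF assms] by blast
  have "\<bar>av \<kappa> r (diff a b) x\<bar> \<le> C * S * norm a / r" if r: "r > 0" and b: "bounded_borel b S" for r b S a x
  proof -
    have "\<bar>av \<kappa> r (diff a b) x\<bar> \<le> S * (LINT z|lborel. \<bar>diff ((- inverse r) *\<^sub>R a) \<kappa> z\<bar>)"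
      unfolding av_diff_adjoint[OF b test_function_integrable[OF assms] r]
      by (intro av_bound b diff_integrable test_function_integrable assms)
    also have "\<dots> \<le> S * (C * norm ((- inverse r) *\<^sub>R a))"
      by (intro mult_left_mono C bounded_borelD[OF b])
    also have "\<dots> = C * S * norm a / r" using r by (simp add: divide_inverse)
    finally show ?thesis .
  qed
  with C show ?thesis by blast
qed

lemma av_diff2_bound:
  fixes \<kappa> :: "real^'n::finite \<Rightarrow> real"
  assumes "test_function \<kappa>"
  shows "\<exists>C\<ge>0. \<forall>r>0. \<forall>b S a a' x. bounded_borel b S \<longrightarrow> \<bar>av \<kappa> r (diff a (diff a' b)) x\<bar> \<le> C * S * norm a * norm a' / r\<^sup>2"
proof -
  obtain C where C: "C \<ge> 0" "\<And>a b. (LINT z|lborel. \<bar>diff a (diff b \<kappa>) z\<bar>) \<le> C * norm a * norm b" using test_function_L1_diff2[OF assms] by blast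
  have "\<bar>av \<kappa> r (diff a (diff a' b)) x\<bar> \<le> C * S * norm a * norm a' / r\<^sup>2" if r: "r > 0" and b: "bounded_borel b S" for r b S a a' x
  proof -
    note k = test_function_integrable[OF assms]
    have "\<bar>av \<kappa> r (diff a (diff a' b)) x\<bar> \<le> S * (LINT z|lborel. \<bar>diff ((- inverse r) *\<^sub>R a') (diff ((- inverse r) *\<^sub>R a) \<kappa>) z\<bar>)"
      unfolding av_diff_adjoint[OF bounded_borel_diff[OF b] k r] av_diff_adjoint[OF b diff_integrable[OF k] r]
      by (intro av_bound b diff_integrable k)
    also have "\<dots> \<le> S * (C * norm ((- inverse r) *\<^sub>R a') * norm ((- inverse r) *\<^sub>R a))"
      by (intro mult_left_mono C bounded_borelD[OF b])
    also have "\<dots> = C * S * norm a * norm a' / r\<^sup>2" using r by (simp add: divide_inverse power2_eq_square mult_ac)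
    finally show ?thesis .
  qed
  with C show ?thesis by blast
qed

lemma av_rescale:
  fixes b :: "real^'n::finite \<Rightarrow> real"
  assumes [measurable]: "b \<in> borel_measurable borel" "\<kappa> \<in> borel_measurable borel" and r: "r > 0"
  shows "(LINT y|lborel. b y * \<kappa> (inverse r *\<^sub>R (y - x))) = r ^ CARD('n) * av \<kappa> r b x"
  unfolding av_def using r
  by (subst lborel_affine_integral(1)[where c=r and t=x]) auto

lemma av_linear_combination:
  fixes b :: "real^'n::finite \<Rightarrow> real"
  assumes b: "bounded_borel b S" and i: "\<And>i. i \<in> I \<Longrightarrow> integrable lborel (\<kappa> i)"
  shows "av (\<lambda>z. \<Sum>i\<in>I. c i * \<kappa> i z) r b x = (\<Sum>i\<in>I. c i * av (\<kappa> i) r b x)"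
proof -
  have "av (\<lambda>z. \<Sum>i\<in>I. c i * \<kappa> i z) r b x = (LINT z|lborel. (\<Sum>i\<in>I. c i * (b (x + r *\<^sub>R z) * \<kappa> i z)))"
    unfolding av_def by (simp add: sum_distrib_left mult_ac)
  also have "\<dots> = (\<Sum>i\<in>I. c i * av (\<kappa> i) r b x)"
    unfolding av_def by (subst Bochner_Integration.integral_sum) (auto intro!: av_integrable[OF b] i)
  finally show ?thesis .
qed

text \<open>As b is merely bounded, the derivative has to fall on the kernel: the first-order Taylor
  remainder of \<kappa> at step - v / r is integrated against b.\<close>

lemma av_has_derivative:
  fixes \<kappa> :: "real^'n::finite \<Rightarrow> real"
  assumes k: "test_function \<kappa>" and b: "bounded_borel b S" and r: "r > 0"
  shows "(av \<kappa> r b has_derivative (\<lambda>v. \<Sum>i\<in>UNIV. v $ i * (- inverse r * av (partial i \<kappa>) r b x))) (at x)"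
proof -
  obtain \<rho> where \<rho>: "\<rho> > 0" "\<And>z. norm z \<ge> \<rho> \<Longrightarrow> \<kappa> z = 0" "\<And>i z. norm z \<ge> \<rho> \<Longrightarrow> partial i \<kappa> z = 0"
  proof -
    obtain \<rho>0 where \<rho>0: "\<rho>0 > 0" "\<And>z. norm z \<ge> \<rho>0 \<Longrightarrow> \<kappa> z = 0" using test_functionD(2)[OF k] by blast
    have "\<forall>i. \<exists>\<rho>>0. \<forall>z. norm z \<ge> \<rho> \<longrightarrow> partial i \<kappa> z = 0" using test_functionD(2)[OF test_function_partial[OF k]] by blast
    then obtain \<rho>1 where \<rho>1: "\<And>i. \<rho>1 i > 0" "\<And>i z. norm z \<ge> \<rho>1 i \<Longrightarrow> partial i \<kappa> z = 0" by metis
    have le: "\<rho>1 i \<le> (\<Sum>i\<in>UNIV. \<rho>1 i)" for i by (rule member_le_sum) (auto intro: less_imp_le \<rho>1)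
    have s: "(\<Sum>i\<in>UNIV. \<rho>1 i) \<ge> 0" by (intro sum_nonneg less_imp_le \<rho>1)
    show ?thesis
    \<comment> \<open>The sum of the radii is a common bound for the finitely many supports.\<close>
    proof (rule that[of "\<rho>0 + (\<Sum>i\<in>UNIV. \<rho>1 i)"])
      fix i and z :: "real^'n" assume z: "\<rho>0 + (\<Sum>i\<in>UNIV. \<rho>1 i) \<le> norm z"
      show "\<kappa> z = 0" using \<rho>0 s z by (intro \<rho>0(2)) auto
      show "partial i \<kappa> z = 0" using \<rho>0 le[of i] z by (intro \<rho>1(2)) linarith
    qed (use \<rho>0 s in auto)
  qed
  obtain L where L: "L \<ge> 0" "\<And>x v. \<bar>\<kappa> (x + v) - \<kappa> x - (\<Sum>i\<in>UNIV. v $ i * partial i \<kappa> x)\<bar> \<le> L * (norm v)\<^sup>2"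
    using test_function_Taylor[OF k] by blast
  define m where "m = measure lborel (cball (0::real^'n) \<rho>)"
  have ki: "integrable lborel \<kappa>" "\<And>i. integrable lborel (partial i \<kappa>)"
    using k test_function_integrable test_function_partial by blast+
  have kis: "integrable lborel (\<lambda>z. \<Sum>i\<in>UNIV. c i * partial i \<kappa> z)" for c
    using ki(2) by (intro Bochner_Integration.integrable_sum integrable_mult_right)
  have km: "\<kappa> \<in> borel_measurable borel" "\<And>i. partial i \<kappa> \<in> borel_measurable borel"
    using ki by auto
  have kms: "(\<lambda>z. \<Sum>i\<in>UNIV. c i * partial i \<kappa> z) \<in> borel_measurable borel" for c
    using km by (intro borel_measurable_sum borel_measurable_times borel_measurable_const)
  have est: "\<bar>av \<kappa> r b (x + v) - av \<kappa> r b x - (\<Sum>i\<in>UNIV. v $ i * (- inverse r * av (partial i \<kappa>) r b x))\<bar>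
      \<le> (S * (L * 2 * m) / r\<^sup>2) * (norm v)\<^sup>2" for v
  proof -
    define a where "a = (- inverse r) *\<^sub>R v"
    \<comment> \<open>The average of this remainder is the remainder of
      \<open>av \<kappa> r b\<close> itself. It is quadratic in v and supported in two
      balls.\<close>
    define T where "T = (\<lambda>z. \<kappa> (z + a) - \<kappa> z - (\<Sum>i\<in>UNIV. a $ i * partial i \<kappa> z))"
    have ka: "integrable lborel (\<lambda>z. \<kappa> (z + a))" using ki(1) lborel_translate(2) km by blast
    have "av T r b x = av \<kappa> r b (x + v) - av \<kappa> r b x - (\<Sum>i\<in>UNIV. v $ i * (- inverse r * av (partial i \<kappa>) r b x))"
    proof -
      have "av T r b x = (LINT z|lborel. b (x + r *\<^sub>R z) * \<kappa> (z + a) - b (x + r *\<^sub>R z) * \<kappa> z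
          - b (x + r *\<^sub>R z) * (\<Sum>i\<in>UNIV. a $ i * partial i \<kappa> z))"
        unfolding av_def T_def by (simp add: right_diff_distrib)
      also have "\<dots> = (LINT z|lborel. b (x + r *\<^sub>R z) * \<kappa> (z + a)) - av \<kappa> r b x
          - av (\<lambda>z. (\<Sum>i\<in>UNIV. a $ i * partial i \<kappa> z)) r b x"
        unfolding av_def
        by (subst Bochner_Integration.integral_diff;
            (subst Bochner_Integration.integral_diff)?;
            (intro Bochner_Integration.integrable_diff av_integrable[OF b] ka ki kis)?) simp
      also have "(LINT z|lborel. b (x + r *\<^sub>R z) * \<kappa> (z + a)) = av \<kappa> r b (x + v)"
        unfolding a_def av_shift[OF b ki(1) r] ..
      also have "av (\<lambda>z. (\<Sum>i\<in>UNIV. a $ i * partial i \<kappa> z)) r b x = (\<Sum>i\<in>UNIV. a $ i * av (partial i \<kappa>) r b x)"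
        by (rule av_linear_combination[OF b ki(2)])
      finally show ?thesis by (simp add: a_def mult_ac)
    qed
    moreover have "\<bar>av T r b x\<bar> \<le> (S * (L * 2 * m) / r\<^sup>2) * (norm v)\<^sup>2"
    proof -
      let ?A = "cball 0 \<rho> \<union> cball (- a) \<rho>"
      have fin: "emeasure lborel ?A < \<infinity>" 
        by (intro emeasure_bounded_finite bounded_Un[THEN iffD2] conjI bounded_cball)
      have Tm: "T \<in> borel_measurable borel" unfolding T_def using km kms
        by (intro borel_measurable_diff) auto
      have TL: "integrable lborel T" "(LINT z|lborel. \<bar>T z\<bar>) \<le> (L * (norm a)\<^sup>2) * measure lborel ?A"
      proof (atomize(full), intro conjI integrable_on_finite_measure_set[where A="?A"])
        fix z assume z: "z \<notin> ?A"
        then have "norm z \<ge> \<rho>" "norm (z + a) \<ge> \<rho>"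
          using norm_ge_of_notin_cball[of z a \<rho>] by auto
        then show "T z = 0" "T z = 0" using \<rho> by (simp_all add: T_def)
      qed (use fin L Tm in \<open>auto simp: T_def\<close>)
      have "measure lborel ?A \<le> measure lborel (cball (0::real^'n) \<rho>) + measure lborel (cball (-a) \<rho>)"
        by (rule measure_Un_le) auto
      also have "\<dots> = 2 * m" unfolding m_def measure_cball_eq[of "-a"] by simp
      finally have "(LINT z|lborel. \<bar>T z\<bar>) \<le> (L * (norm a)\<^sup>2) * (2 * m)"
        using TL(2) L by (meson mult_left_mono mult_nonneg_nonneg order_trans zero_le_power2)
      then have "S * (LINT z|lborel. \<bar>T z\<bar>) \<le> S * ((L * (norm a)\<^sup>2) * (2 * m))"
        by (intro mult_left_mono bounded_borelD[OF b])
      with av_bound[OF b TL(1), of r x] have "\<bar>av T r b x\<bar> \<le> S * ((L * (norm a)\<^sup>2) * (2 * m))"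
        by linarith
      also have "norm a = norm v / r" using r by (simp add: a_def divide_inverse)
      finally show ?thesis by (simp add: power_divide mult_ac)
    qed
    ultimately show ?thesis by simp
  qed
  define D where "D = (\<lambda>v. \<Sum>i\<in>UNIV. (v::real^'n) $ i * (- inverse r * av (partial i \<kappa>) r b x))"
  define K where "K = S * (L * 2 * m) / r\<^sup>2"
  have bl: "bounded_linear D" unfolding D_def
    by (intro bounded_linear_sum bounded_linear_mult_const bounded_linear_vec_nth)
  have "((\<lambda>h. norm (av \<kappa> r b (x + h) - av \<kappa> r b x - D h) / norm h) \<longlongrightarrow> 0) (at 0)"
  proof (rule Lim_null_comparison)
    show "\<forall>\<^sub>F h in at 0. norm (norm (av \<kappa> r b (x + h) - av \<kappa> r b x - D h) / norm h) \<le> K * norm h"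
    proof (rule eventually_at_topological[THEN iffD2], intro exI[of _ UNIV] conjI ballI impI)
      fix h :: "real^'n" assume "h \<noteq> 0"
      then show "norm (norm (av \<kappa> r b (x + h) - av \<kappa> r b x - D h) / norm h) \<le> K * norm h"
        using est[of h] by (simp add: D_def K_def divide_le_eq power2_eq_square mult.assoc)
    qed auto
    have "((\<lambda>h::real^'n. K * norm h) \<longlongrightarrow> K * norm (0::real^'n)) (at 0)" by (intro tendsto_intros)
    then show "((\<lambda>h::real^'n. K * norm h) \<longlongrightarrow> 0) (at 0)" by simp
  qed
  with bl have "(av \<kappa> r b has_derivative D) (at x)" unfolding has_derivative_at by blast
  then show ?thesis unfolding D_def .
qed

lemma av_continuous:
  assumes "test_function \<kappa>" "bounded_borel b S" "r > 0"
  shows "continuous_on UNIV (av \<kappa> r b)"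
  using has_derivative_continuous[OF av_has_derivative[OF assms]] by (simp add: continuous_on_eq_continuous_at)

lemma av_tendsto:
  assumes k: "integrable lborel \<kappa>" and b: "bounded_borel b S" and c: "isCont b x"
  shows "((\<lambda>r. av \<kappa> r b x) \<longlongrightarrow> b x * (LINT z|lborel. \<kappa> z)) (at_right 0)"
proof -
  have [measurable]: "b \<in> borel_measurable borel" "\<kappa> \<in> borel_measurable borel"
    using b k bounded_borelD by auto
  have "((\<lambda>r. av \<kappa> r b x) \<longlongrightarrow> (LINT z|lborel. b x * \<kappa> z)) (at_right 0)"
    unfolding av_def
  proof (rule tendsto_at_right_sequentially[of 0 1])
    fix r :: "nat \<Rightarrow> real" assume r: "r \<longlonglongrightarrow> 0"
    show "(\<lambda>n. LINT z|lborel. b (x + r n *\<^sub>R z) * \<kappa> z) \<longlonglongrightarrow> (LINT z|lborel. b x * \<kappa> z)"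
    proof (rule integral_dominated_convergence[where w="\<lambda>z. S * \<bar>\<kappa> z\<bar>"])
      show "AE z in lborel. (\<lambda>n. b (x + r n *\<^sub>R z) * \<kappa> z) \<longlonglongrightarrow> b x * \<kappa> z"
      proof (intro AE_I2 tendsto_intros)
        fix z
        have "(\<lambda>n. x + r n *\<^sub>R z) \<longlonglongrightarrow> x + 0 *\<^sub>R z" by (intro tendsto_intros r)
        then show "(\<lambda>n. b (x + r n *\<^sub>R z)) \<longlonglongrightarrow> b x" using isCont_tendsto_compose[OF c] by simp
      qed
    qed (use k bounded_borelD(2)[OF b] in \<open>auto simp: abs_mult intro!: mult_right_mono integrable_mult_right\<close>)
  qed simp
  then show ?thesis by simp
qed

section \<open>Mollification\<close>

text \<open>The mean value theorem bounds each difference quotient by g, so the limit passes under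
  the integral by dominated convergence.\<close>

lemma integral_has_real_derivative:
  fixes K :: "real \<Rightarrow> 'a::euclidean_space \<Rightarrow> real"
  assumes d: "d > 0"
    and der: "\<And>t y. \<bar>t - t0\<bar> < d \<Longrightarrow> ((\<lambda>t. K t y) has_real_derivative K' t y) (at t)"
    and int: "\<And>t. \<bar>t - t0\<bar> < d \<Longrightarrow> integrable lborel (K t)"
    and meas: "K' t0 \<in> borel_measurable lborel"
    and g: "integrable lborel g" "\<And>t y. \<bar>t - t0\<bar> < d \<Longrightarrow> \<bar>K' t y\<bar> \<le> g y"
  shows "((\<lambda>t. LINT y|lborel. K t y) has_real_derivative (LINT y|lborel. K' t0 y)) (at t0)"
proof -
  let ?F = "\<lambda>t. LINT y|lborel. K t y"
  have "((\<lambda>h. (?F (t0 + h) - ?F t0) / h) \<longlongrightarrow> (LINT y|lborel. K' t0 y)) (at 0 within {-d<..<d})"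
    unfolding tendsto_at_iff_sequentially
  proof (intro allI impI)
    fix X :: "nat \<Rightarrow> real" assume X: "\<forall>i. X i \<in> {- d<..<d} - {0}" "X \<longlonglongrightarrow> 0"
    have Xd: "\<bar>t0 + X n - t0\<bar> < d" "X n \<noteq> 0" for n using X(1)[rule_format, of n] by auto
    have lim: "(\<lambda>n. LINT y|lborel. (K (t0 + X n) y - K t0 y) / X n) \<longlonglongrightarrow> (LINT y|lborel. K' t0 y)"
    proof (rule integral_dominated_convergence[where w=g])
      show "(\<lambda>y. (K (t0 + X n) y - K t0 y) / X n) \<in> borel_measurable lborel" for n
        using int[OF Xd(1), of n] int[of t0] d by auto
      show "AE y in lborel. (\<lambda>n. (K (t0 + X n) y - K t0 y) / X n) \<longlonglongrightarrow> K' t0 y"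
      proof (rule AE_I2)
        fix y
        have "((\<lambda>h. (K (t0 + h) y - K t0 y) / h) \<longlongrightarrow> K' t0 y) (at 0)"
          using der[of t0 y] d by (simp add: DERIV_def)
        moreover have "filterlim X (at 0) sequentially"
          using X Xd by (auto simp: filterlim_at)
        ultimately show "(\<lambda>n. (K (t0 + X n) y - K t0 y) / X n) \<longlonglongrightarrow> K' t0 y"
          by (rule filterlim_compose)
      qed
      show "AE y in lborel. norm ((K (t0 + X n) y - K t0 y) / X n) \<le> g y" for n
      proof (rule AE_I2)
        fix y
        have "norm (K (t0 + X n) y - K t0 y) \<le> g y * norm (t0 + X n - t0)"
        proof (rule field_differentiable_bound[where S="{t0-d<..<t0+d}" and f'="\<lambda>t. K' t y"])
          fix z assume "z \<in> {t0-d<..<t0+d}"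
          then have z: "\<bar>z - t0\<bar> < d" by auto
          show "((\<lambda>t. K t y) has_real_derivative K' z y) (at z within {t0-d<..<t0+d})"
            using der[OF z] by (rule has_field_derivative_at_within)
          show "norm (K' z y) \<le> g y" using g(2)[OF z] by simp
        qed (use Xd(1)[of n] d in \<open>auto simp: abs_less_iff\<close>)
        then show "norm ((K (t0 + X n) y - K t0 y) / X n) \<le> g y" using Xd(2)[of n]
          by (simp add: divide_le_eq)
      qed
    qed (use g meas in auto)
    have eq: "(LINT y|lborel. (K (t0 + X n) y - K t0 y) / X n) = (?F (t0 + X n) - ?F t0) / X n" for n
      using int[OF Xd(1), of n] int[of t0] d by simp
    show "((\<lambda>h. (?F (t0 + h) - ?F t0) / h) \<circ> X) \<longlonglongrightarrow> (LINT y|lborel. K' t0 y)"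
      using lim unfolding o_def eq .
  qed
  then show ?thesis using d by (simp add: DERIV_def at_within_open[of _ "{-d<..<d}"])
qed

text \<open>Substituting y = x + r z moves r into the smooth kernel, so b may be any bounded
  function. The new kernel is - div (z \<kappa>(z)): the dimension stems from the volume factor, the
  radial derivative from the inner dilation.\<close>

lemma av_has_derivative_radius:
  fixes \<kappa> :: "real^'n::finite \<Rightarrow> real"
  assumes k: "test_function \<kappa>" and b: "bounded_borel b S" and r: "r > 0"
  shows "((\<lambda>r. av \<kappa> r b x) has_real_derivative
    inverse r * av (\<lambda>z. - (real CARD('n) * \<kappa> z + (\<Sum>i\<in>UNIV. z $ i * partial i \<kappa> z))) r b x) (at r)"
proof -
  define N where "N = CARD('n)"
  define EK where "EK = (\<lambda>z. - (real CARD('n) * \<kappa> z + (\<Sum>i\<in>UNIV. z $ i * partial i \<kappa> z)))"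
  have [measurable]: "b \<in> borel_measurable borel" "\<kappa> \<in> borel_measurable borel"
    using b bounded_borelD test_function_measurable[OF k] by auto
  have "test_function (\<lambda>z. (- real CARD('n)) * \<kappa> z + (\<Sum>i\<in>UNIV. (-1 * z $ i) * partial i \<kappa> z))"
    by (intro test_function_add test_function_sum test_function_mult_left test_function_partial Ck_mult Ck_const Ck_nth k finite)
  then have EK: "test_function EK"
    by (simp add: EK_def sum_negf)
  then have [measurable]: "EK \<in> borel_measurable borel" by (rule test_function_measurable)
  obtain \<rho> where \<rho>: "\<rho> > 0" "\<And>z. norm z \<ge> \<rho> \<Longrightarrow> EK z = 0" using test_functionD(2)[OF EK] by blast
  obtain B where B: "\<And>x. \<bar>EK x\<bar> \<le> B" using test_function_bounded[OF EK] by blast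
  have B0: "B \<ge> 0" using B[of 0] by linarith
  define K where "K = (\<lambda>r y. inverse r ^ N * (b y * \<kappa> (inverse r *\<^sub>R (y - x))))"
  define K' where "K' = (\<lambda>r y. inverse r ^ (N + 1) * (b y * EK (inverse r *\<^sub>R (y - x))))"
  have bi: "integrable lborel (\<lambda>y. b y * f (inverse t *\<^sub>R (y - x)))" if "t > 0" "test_function f" for t and f :: "real^'n \<Rightarrow> real"
  proof -
    have [measurable]: "f \<in> borel_measurable borel" using that test_function_measurable by auto
    have "integrable lborel (\<lambda>z. b (x + t *\<^sub>R z) * f (inverse t *\<^sub>R ((x + t *\<^sub>R z) - x)))"
      using av_integrable[OF b test_function_integrable[OF that(2)], of x t] that(1) by simp
    then show ?thesis
      using lborel_affine_integral(2)[of "\<lambda>y. b y * f (inverse t *\<^sub>R (y - x))" t x] that(1) by simp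
  qed
  have eq: "(LINT y|lborel. K t y) = av \<kappa> t b x" if "t > 0" for t
    using av_rescale[of b \<kappa> t x] that by (simp add: K_def N_def power_inverse)
  have eq': "(LINT y|lborel. K' t y) = inverse t * av EK t b x" if "t > 0" for t
    using av_rescale[of b EK t x] that by (simp add: K'_def N_def power_inverse)
  have "((\<lambda>t. LINT y|lborel. K t y) has_real_derivative (LINT y|lborel. K' r y)) (at r)"
  \<comment> \<open>On this interval t stays between r / 2 and 2 r, which bounds 1 / t and confines
    all supports to one ball of radius \<open>2 * r * \<rho>\<close>.\<close>
  proof (rule integral_has_real_derivative[where d="r / 2" and
        g="\<lambda>y. (inverse (r/2)) ^ (N + 1) * (S * B * indicator (cball x (2 * r * \<rho>)) y)"])
    fix t y assume "\<bar>t - r\<bar> < r / 2"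
    then have t: "t > r / 2" "t < 2 * r" "t > 0" by linarith+
    define v where "v = y - x"
    have g: "((\<lambda>t. inverse t *\<^sub>R v) has_derivative (\<lambda>h. (- (inverse t)\<^sup>2 * h) *\<^sub>R v)) (at t)"
      using t by (auto intro!: derivative_eq_intros simp: power2_eq_square)
    have "((\<lambda>t. \<kappa> (inverse t *\<^sub>R v)) has_derivative (\<lambda>h. \<Sum>i\<in>UNIV. ((- (inverse t)\<^sup>2 * h) *\<^sub>R v) $ i * partial i \<kappa> (inverse t *\<^sub>R v))) (at t)"
      by (rule has_derivative_compose[OF g has_derivative_partials[OF test_function_differentiable[OF k]]])
    then have d1: "((\<lambda>t. \<kappa> (inverse t *\<^sub>R v)) has_real_derivative (- (inverse t)\<^sup>2 * (\<Sum>i\<in>UNIV. v $ i * partial i \<kappa> (inverse t *\<^sub>R v)))) (at t)"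
      unfolding has_field_derivative_def
      by (rule has_derivative_eq_rhs) (rule ext, simp add: sum_distrib_left sum_distrib_right sum_negf mult_ac)
    have d2: "((\<lambda>t. inverse t ^ N) has_real_derivative (- real N * inverse t ^ (N + 1))) (at t)"
    proof -
      have "((\<lambda>t. inverse t ^ N) has_real_derivative (real N * inverse t ^ (N - 1) * (- (inverse t)\<^sup>2))) (at t)"
        using t by (auto intro!: derivative_eq_intros simp: power2_eq_square)
      moreover have "inverse t ^ (N - 1) * (inverse t)\<^sup>2 = inverse t ^ (N + 1)"
        unfolding power_add[symmetric] by (simp add: N_def Suc_leI)
      ultimately show ?thesis by (simp add: mult.assoc)
    qed
    have "((\<lambda>t. K t y) has_real_derivative b y * (inverse t ^ N * (- (inverse t)\<^sup>2 * (\<Sum>i\<in>UNIV. v $ i * partial i \<kappa> (inverse t *\<^sub>R v)))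
         + (- real N * inverse t ^ (N + 1)) * \<kappa> (inverse t *\<^sub>R v))) (at t)"
      unfolding K_def v_def[symmetric] using DERIV_cmult[OF DERIV_mult[OF d2 d1], of "b y"]
      by (simp add: mult_ac add.commute)
    moreover have "b y * (inverse t ^ N * (- (inverse t)\<^sup>2 * (\<Sum>i\<in>UNIV. v $ i * partial i \<kappa> (inverse t *\<^sub>R v)))
         + (- real N * inverse t ^ (N + 1)) * \<kappa> (inverse t *\<^sub>R v)) = K' t y"
      unfolding K'_def EK_def v_def[symmetric] N_def
      by (simp add: sum_distrib_left algebra_simps power2_eq_square sum_negf)
    ultimately show "((\<lambda>t. K t y) has_real_derivative K' t y) (at t)" by simp
    have "\<bar>K' t y\<bar> = inverse t ^ (N + 1) * (\<bar>b y\<bar> * \<bar>EK (inverse t *\<^sub>R v)\<bar>)"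
      using t by (simp add: K'_def v_def abs_mult)
    also have "\<dots> \<le> (inverse (r/2)) ^ (N + 1) * (S * (B * indicator (cball x (2 * r * \<rho>)) y))"
    proof (intro mult_mono power_mono)
      show "\<bar>EK (inverse t *\<^sub>R v)\<bar> \<le> B * indicator (cball x (2 * r * \<rho>)) y"
      proof (cases "y \<in> cball x (2 * r * \<rho>)")
        case False
        then have "norm v > 2 * r * \<rho>" by (simp add: v_def dist_norm norm_minus_commute)
        moreover have "t * \<rho> \<le> 2 * r * \<rho>" using t \<rho>(1) by simp
        ultimately have "\<rho> \<le> norm (inverse t *\<^sub>R v)" using t by (simp add: field_simps)
        then show ?thesis using \<rho> B0 by simp
      qed (use B in simp)
      show "inverse t \<le> inverse (r / 2)" using t r by (intro le_imp_inverse_le) auto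
    qed (use t r bounded_borelD[OF b] B0 in auto)
    finally show "\<bar>K' t y\<bar> \<le> (inverse (r/2)) ^ (N + 1) * (S * B * indicator (cball x (2 * r * \<rho>)) y)"
      by (simp add: mult_ac)
  next
    fix t assume "\<bar>t - r\<bar> < r / 2"
    then have t: "t > 0" by linarith
    show "integrable lborel (K t)" unfolding K_def by (intro integrable_mult_right bi t k)
  next
    show "K' r \<in> borel_measurable lborel" unfolding K'_def by measurable
  next
    show "integrable lborel (\<lambda>y. (inverse (r/2)) ^ (N + 1) * (S * B * indicator (cball x (2 * r * \<rho>)) y))"
      by (intro integrable_mult_right integrable_real_indicator emeasure_bounded_finite bounded_cball) auto
  qed (use r in auto)
  then have "((\<lambda>t. LINT y|lborel. K t y) has_real_derivative inverse r * av EK r b x) (at r)"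
    by (simp only: eq'[OF r])
  then show ?thesis unfolding EK_def[symmetric]
    by (rule has_field_derivative_transform_within_open[where S="{0<..}"]) (use r eq in auto)
qed

text \<open>\<open>ker\<close> is the kernel \<open>w\<close> of the introduction, and \<open>bump 0\<close> is \<open>Q\<close>.\<close>

definition ker :: "real^'n::finite \<Rightarrow> real" where
  "ker z = 2 * bump 2 z"

definition laplace :: "(real^'n::finite \<Rightarrow> real) \<Rightarrow> real^'n \<Rightarrow> real" where
  "laplace f x = (\<Sum>i\<in>UNIV. partial i (partial i f) x)"

lemma test_function_ker: "test_function ker"
  using test_function_mult_left[OF Ck_const test_function_bump, of 2 2] by (simp add: ker_def[abs_def])

lemma test_function_laplace: "test_function f \<Longrightarrow> test_function (laplace f)"
  unfolding laplace_def[abs_def] by (intro test_function_sum test_function_partial) auto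

text \<open>At index 0 the factor \<open>real j\<close> removes the term with \<open>bump 1\<close>;
  the 2 from differentiating \<open>z \<bullet> z\<close> is put into \<open>ker\<close>.\<close>

lemma partial_bump_0: "partial i (bump 0) = (\<lambda>z. - (z $ i) * ker z)"
  by (rule ext) (simp add: partial_bump ker_def numeral_2_eq_2)

text \<open>Differentiating - z w(z) once more yields the very kernel found for the radius
  derivative of \<open>av ker\<close>. A Laplacian tested against Q can thus be read as a derivative
  in r.\<close>

lemma laplace_bump_0:
  fixes z :: "real^'n::finite"
  shows "laplace (bump 0) z = - (real CARD('n) * ker z + (\<Sum>i\<in>UNIV. z $ i * partial i ker z))"
proof -
  have d: "((\<lambda>z::real^'n. - (z $ i)) has_derivative (\<lambda>v. - (v $ i))) (at z)" for i
    by (intro derivative_intros bounded_linear_imp_has_derivative bounded_linear_vec_nth)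
  have "partial i (partial i (bump 0)) z = - (ker z) - z $ i * partial i ker z" for i
  proof -
    have "partial i (partial i (bump 0)) z = - (z $ i) * partial i ker z + partial i (\<lambda>z. - (z $ i)) z * ker z"
      unfolding partial_bump_0
      by (rule partial_mult) (use d test_function_differentiable[OF test_function_ker] in \<open>auto simp: differentiable_def\<close>)
    then show ?thesis unfolding partial_eqI[OF d] by (simp add: axis_def)
  qed
  then show ?thesis by (simp add: laplace_def sum_subtractf sum_negf)
qed

lemma ker_integral_pos: "(LINT z|lborel. ker (z::real^'n::finite)) > 0"
proof -
  have i: "integrable lborel (ker :: real^'n \<Rightarrow> real)" by (intro test_function_integrable test_function_ker)
  have nn: "ker z \<ge> 0" for z :: "real^'n" by (simp add: ker_def bump_nonneg)
  have "(LINT z|lborel. ker (z::real^'n)) \<noteq> 0"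
  proof
    assume "(LINT z|lborel. ker (z::real^'n)) = 0"
    then have "AE z in lborel. ker (z::real^'n) = 0"
      using integral_nonneg_eq_0_iff_AE[OF i] nn by auto
    then have "AE z in lborel. z \<notin> ball (0::real^'n) 1"
    proof eventually_elim
      case (elim z)
      then show ?case using bump_pos[of z 2] by (auto simp: ker_def)
    qed
    then have "emeasure lborel (ball (0::real^'n) 1) = 0"
      by (subst (asm) AE_iff_measurable[where N="ball 0 1"]) auto
    then have "emeasure lebesgue (ball (0::real^'n) 1) = 0" by simp
    then have "negligible (ball (0::real^'n) 1)" using negligible_iff_emeasure0[of "ball (0::real^'n) 1"] by auto
    then show False using open_not_negligible[of "ball (0::real^'n) 1"] by simp
  qed
  moreover have "(LINT z|lborel. ker (z::real^'n)) \<ge> 0" using nn by simp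
  ultimately show ?thesis by simp
qed

section \<open>Shears of the product measure and limits of mollifications\<close>

lemma lborel_shear:
  fixes L :: "'a::euclidean_space \<Rightarrow> 'b::euclidean_space"
  assumes [measurable]: "L \<in> borel_measurable borel"
  shows "distr (lborel \<Otimes>\<^sub>M lborel) (lborel \<Otimes>\<^sub>M lborel) (\<lambda>(z, y). (z, y + L z)) = (lborel \<Otimes>\<^sub>M lborel :: ('a \<times> 'b) measure)"
proof (rule measure_eqI)
  fix A assume "A \<in> sets (distr (lborel \<Otimes>\<^sub>M lborel) (lborel \<Otimes>\<^sub>M lborel) (\<lambda>(z, y). (z, y + L z)) :: ('a \<times> 'b) measure)"
  then have [measurable]: "A \<in> sets (borel \<Otimes>\<^sub>M borel)" "A \<in> sets (lborel \<Otimes>\<^sub>M lborel)"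
    by (simp_all add: sets_pair_measure_cong[OF sets_lborel sets_lborel])
  have t: "(\<integral>\<^sup>+ y. f (y + c) \<partial>lborel) = (\<integral>\<^sup>+ y. f y \<partial>lborel)" if [measurable]: "f \<in> borel_measurable borel" for f :: "'b \<Rightarrow> ennreal" and c
  proof -
    have "(\<integral>\<^sup>+ y. f y \<partial>distr lborel borel ((+) c)) = (\<integral>\<^sup>+ y. f (c + y) \<partial>lborel)"
      by (subst nn_integral_distr) auto
    then show ?thesis by (simp add: lborel_distr_plus add.commute)
  qed
  have "emeasure (distr (lborel \<Otimes>\<^sub>M lborel) (lborel \<Otimes>\<^sub>M lborel) (\<lambda>(z, y). (z, y + L z))) A
      = (\<integral>\<^sup>+ p. indicator A p \<partial>distr (lborel \<Otimes>\<^sub>M lborel) (lborel \<Otimes>\<^sub>M lborel) (\<lambda>(z, y). (z, y + L z)))"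
    by (rule nn_integral_indicator[symmetric]) simp
  also have "\<dots> = (\<integral>\<^sup>+ p. indicator A ((\<lambda>(z, y). (z, y + L z)) p) \<partial>(lborel \<Otimes>\<^sub>M lborel))"
    by (rule nn_integral_distr) measurable
  also have "\<dots> = (\<integral>\<^sup>+ z. \<integral>\<^sup>+ y. indicator A (z, y + L z) \<partial>lborel \<partial>lborel)"
    by (subst lborel.nn_integral_fst[symmetric]) auto
  \<comment> \<open>For fixed z the shear is a translation by L z, under which the inner integral is
    invariant.\<close>
  also have "\<dots> = (\<integral>\<^sup>+ z. \<integral>\<^sup>+ y. indicator A (z, y) \<partial>lborel \<partial>lborel)"
    by (intro nn_integral_cong t) measurable
  also have "\<dots> = (\<integral>\<^sup>+ p. indicator A p \<partial>(lborel \<Otimes>\<^sub>M lborel))"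
    by (rule lborel.nn_integral_fst) measurable
  also have "\<dots> = emeasure (lborel \<Otimes>\<^sub>M lborel) A" by (rule nn_integral_indicator) simp
  finally show "emeasure (distr (lborel \<Otimes>\<^sub>M lborel) (lborel \<Otimes>\<^sub>M lborel) (\<lambda>(z, y). (z, y + L z))) A = emeasure (lborel \<Otimes>\<^sub>M lborel) A" .
qed simp

lemma lborel_shear_integral:
  fixes L :: "'a::euclidean_space \<Rightarrow> 'b::euclidean_space" and f :: "'a \<times> 'b \<Rightarrow> real"
  assumes [measurable]: "L \<in> borel_measurable borel" "f \<in> borel_measurable (lborel \<Otimes>\<^sub>M lborel)"
  shows "(LINT p|(lborel \<Otimes>\<^sub>M lborel). f (fst p, snd p + L (fst p))) = (LINT p|(lborel \<Otimes>\<^sub>M lborel). f p)"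
    and "integrable (lborel \<Otimes>\<^sub>M lborel) (\<lambda>p. f (fst p, snd p + L (fst p))) \<longleftrightarrow> integrable (lborel \<Otimes>\<^sub>M lborel) f"
proof -
  have m: "(\<lambda>(z, y). (z, y + L z)) \<in> measurable (lborel \<Otimes>\<^sub>M lborel) (lborel \<Otimes>\<^sub>M lborel)" by measurable
  show "(LINT p|(lborel \<Otimes>\<^sub>M lborel). f (fst p, snd p + L (fst p))) = (LINT p|(lborel \<Otimes>\<^sub>M lborel). f p)"
    using integral_distr[OF m assms(2)] by (simp add: lborel_shear case_prod_beta)
  show "integrable (lborel \<Otimes>\<^sub>M lborel) (\<lambda>p. f (fst p, snd p + L (fst p))) \<longleftrightarrow> integrable (lborel \<Otimes>\<^sub>M lborel) f"
    using integrable_distr_eq[OF m assms(2)] by (simp add: lborel_shear case_prod_beta)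
qed

lemma integrable_product_function:
  fixes f :: "'a::euclidean_space \<Rightarrow> real" and g :: "'b::euclidean_space \<Rightarrow> real"
  assumes f: "integrable lborel f" and g: "integrable lborel g"
  shows "integrable (lborel \<Otimes>\<^sub>M lborel) (\<lambda>p. f (fst p) * g (snd p))"
proof (rule lborel_pair.Fubini_integrable)
  have [measurable]: "f \<in> borel_measurable borel" "g \<in> borel_measurable borel" using f g by auto
  show "(\<lambda>p. f (fst p) * g (snd p)) \<in> borel_measurable (lborel \<Otimes>\<^sub>M lborel)" by measurable
  show "integrable lborel (\<lambda>x. LINT y|lborel. norm (f (fst (x, y)) * g (snd (x, y))))"
    using f by (simp add: abs_mult)
  show "AE x in lborel. integrable lborel (\<lambda>y. f (fst (x, y)) * g (snd (x, y)))"
    using g by simp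
qed

text \<open>Lebesgue differentiation: at almost every point f is the limit of its means over
  shrinking cubes, and these means are all 0.\<close>

lemma AE_eq_0_of_box_integrals:
  fixes f :: "'a::euclidean_space \<Rightarrow> real"
  assumes [measurable]: "f \<in> borel_measurable borel"
    and i: "\<And>a b. set_integrable lborel (cbox a b) f"
    and z: "\<And>a b. (LINT x:cbox a b|lborel. f x) = 0"
  shows "AE x in lborel. f x = 0"
proof -
  have e: "f integrable_on cbox a b" "integral (cbox a b) f = 0" for a b
    using set_borel_integral_eq_integral[OF i[of a b]] z[of a b] by simp_all
  obtain N where N: "negligible N" "\<And>x e. \<lbrakk>x \<notin> N; 0 < e\<rbrakk> \<Longrightarrow>
               \<exists>d>0. \<forall>h. 0 < h \<and> h < d \<longrightarrow>
                         norm(integral (cbox x (x + h *\<^sub>R One)) f /\<^sub>R h ^ DIM('a) - f x) < e"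
    using integrable_ccontinuous_explicit[OF e(1)] by blast
  have "f x = 0" if x: "x \<notin> N" for x
  proof (rule ccontr)
    assume "f x \<noteq> 0"
    then obtain d where d: "d > 0" "\<forall>h. 0 < h \<and> h < d \<longrightarrow>
        norm(integral (cbox x (x + h *\<^sub>R One)) f /\<^sub>R h ^ DIM('a) - f x) < \<bar>f x\<bar>"
      using N(2)[OF x, of "\<bar>f x\<bar>"] by auto
    from d(2)[rule_format, of "d / 2"] d(1) show False by (simp add: e)
  qed
  then have "{x. f x \<noteq> 0} \<subseteq> N" by blast
  then have "negligible {x. f x \<noteq> 0}" using N(1) negligible_subset by blast
  then have "emeasure lborel {x. f x \<noteq> 0} = 0"
    by (simp add: negligible_iff_emeasure0)
  then show ?thesis by (subst AE_iff_measurable[where N="{x. f x \<noteq> 0}"]) auto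
qed

text \<open>Both sides are compared through their integrals over boxes, which only needs dominated convergence.\<close>

lemma mollification_limit_AE:
  fixes F H \<kappa> :: "real^'n::finite \<Rightarrow> real"
  assumes k: "test_function \<kappa>"
    and F[measurable]: "F \<in> borel_measurable borel" and Fi: "\<And>R. set_integrable lborel (cball 0 R) F"
    and H[measurable]: "H \<in> borel_measurable borel"
    and bound: "\<And>m x. \<bar>av \<kappa> (inverse (real (Suc m))) F x\<bar> \<le> C"
    and lim: "\<And>x. (\<lambda>m. av \<kappa> (inverse (real (Suc m))) F x) \<longlonglongrightarrow> H x"
  shows "AE x in lborel. H x = (LINT z|lborel. \<kappa> z) * F x"
proof -
  define c where "c = (LINT z|lborel. \<kappa> z)"
  define r where "r = (\<lambda>m. inverse (real (Suc m)))"
  have r: "r m > 0" "r m \<le> 1" for m by (auto simp: r_def field_simps)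
  have r0: "r \<longlonglongrightarrow> 0" unfolding r_def by (rule LIMSEQ_inverse_real_of_nat)
  have [measurable]: "\<kappa> \<in> borel_measurable borel" by (rule test_function_measurable[OF k])
  obtain \<rho> where \<rho>: "\<rho> > 0" "\<And>z. norm z \<ge> \<rho> \<Longrightarrow> \<kappa> z = 0" using test_functionD(2)[OF k] by blast
  have Hb: "\<bar>H x\<bar> \<le> C" for x
    using LIMSEQ_le_const2[OF tendsto_rabs[OF lim[of x]], of C] bound by blast
  have boxF: "set_integrable lborel (cbox a b) F" for a b :: "real^'n"
  proof -
    obtain R where "cbox a b \<subseteq> cball 0 R" using bounded_subset_ballD[OF bounded_cbox[of a b], of 0] ball_subset_cball by blast
    then show ?thesis using set_integrable_subset[OF Fi[of R]] by auto
  qed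
  have boxH: "set_integrable lborel (cbox a b) H" for a b :: "real^'n"
    unfolding set_integrable_def
    by (rule integrable_on_finite_measure_set(1)[of _ "cbox a b" C])
      (use Hb order_trans[OF abs_ge_zero Hb] in \<open>auto simp: indicator_def emeasure_lborel_cbox_eq\<close>)
  have eq: "(LINT x:cbox a b|lborel. H x) = c * (LINT x:cbox a b|lborel. F x)" for a b :: "real^'n"
  proof -
    let ?S = "cbox a b"
    obtain R where R: "?S \<subseteq> cball 0 R" using bounded_subset_ballD[OF bounded_cbox[of a b], of 0] ball_subset_cball by blast
    \<comment> \<open>The substitution y = x + t z is already built in: F is evaluated at the
      integration variable and t enters only through the indicator, so the limit t \<rightarrow> 0
      needs no continuity of F.\<close>
    define \<Phi> where "\<Phi> = (\<lambda>t (p :: (real^'n) \<times> (real^'n)). \<kappa> (fst p) * F (snd p) * indicator ?S (snd p - t *\<^sub>R fst p))"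
    have \<Phi>m[measurable]: "\<Phi> t \<in> borel_measurable (lborel \<Otimes>\<^sub>M lborel)" for t
      unfolding \<Phi>_def by measurable
    have dom: "integrable (lborel \<Otimes>\<^sub>M lborel) (\<lambda>p. \<bar>\<kappa> (fst p)\<bar> * \<bar>indicator (cball 0 (R + \<rho>)) (snd p) *\<^sub>R F (snd p)\<bar>)"
      using Fi[of "R + \<rho>"] unfolding set_integrable_def
      by (intro integrable_product_function integrable_abs test_function_integrable[OF k])
    \<comment> \<open>For t at most 1 the second variable stays within R + \<rho>, which gives one
      majorant for all radii.\<close>
    have le: "norm (\<Phi> t p) \<le> \<bar>\<kappa> (fst p)\<bar> * \<bar>indicator (cball 0 (R + \<rho>)) (snd p) *\<^sub>R F (snd p)\<bar>" if "0 \<le> t" "t \<le> 1" for t p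
    proof (cases "norm (fst p) \<ge> \<rho> \<or> snd p - t *\<^sub>R fst p \<notin> ?S")
      case False
      then have "norm (snd p - t *\<^sub>R fst p) \<le> R" "norm (t *\<^sub>R fst p) \<le> \<rho>" using R that mult_left_le_one_le[of "norm (fst p)" t] by auto
      then have "norm (snd p) \<le> R + \<rho>" using norm_triangle_sub[of "snd p" "t *\<^sub>R fst p"] by linarith
      then show ?thesis by (simp add: \<Phi>_def abs_mult indicator_def)
    qed (auto simp: \<Phi>_def \<rho>(2))
    have \<Phi>i: "integrable (lborel \<Otimes>\<^sub>M lborel) (\<Phi> t)" if "0 \<le> t" "t \<le> 1" for t
      by (rule Bochner_Integration.integrable_bound[OF dom \<Phi>m]) (use le[OF that] in auto)
    have avm: "integrable lborel (\<lambda>x. indicator ?S x * av \<kappa> (r m) F x)"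
      and ave: "(LINT x|lborel. indicator ?S x * av \<kappa> (r m) F x) = (LINT p|(lborel \<Otimes>\<^sub>M lborel). \<Phi> (r m) p)" for m
    proof -
      have L[measurable]: "(\<lambda>z::real^'n. r m *\<^sub>R z) \<in> borel_measurable borel" by measurable
      have e: "\<Phi> (r m) (fst p, snd p + r m *\<^sub>R fst p) = indicator ?S (snd p) * (F (snd p + r m *\<^sub>R fst p) * \<kappa> (fst p))" for p
        by (simp add: \<Phi>_def)
      have i: "integrable (lborel \<Otimes>\<^sub>M lborel) (\<lambda>p. indicator ?S (snd p) * (F (snd p + r m *\<^sub>R fst p) * \<kappa> (fst p)))"
        using lborel_shear_integral(2)[OF L \<Phi>m[of "r m"]] \<Phi>i[of "r m"] r[of m] by (simp add: e)
      have I: "(LINT p|(lborel \<Otimes>\<^sub>M lborel). \<Phi> (r m) p) = (LINT p|(lborel \<Otimes>\<^sub>M lborel). indicator ?S (snd p) * (F (snd p + r m *\<^sub>R fst p) * \<kappa> (fst p)))"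
        using lborel_shear_integral(1)[OF L \<Phi>m[of "r m"]] by (simp add: e)
      have i': "integrable (lborel \<Otimes>\<^sub>M lborel) (\<lambda>(z, x). indicator ?S x * (F (x + r m *\<^sub>R z) * \<kappa> z))"
        using i by (simp add: case_prod_beta')
      from lborel_pair.integrable_snd[OF i']
      show "integrable lborel (\<lambda>x. indicator ?S x * av \<kappa> (r m) F x)" by (simp add: av_def)
      from lborel_pair.integral_snd[OF i']
      show "(LINT x|lborel. indicator ?S x * av \<kappa> (r m) F x) = (LINT p|(lborel \<Otimes>\<^sub>M lborel). \<Phi> (r m) p)"
        unfolding I by (simp add: av_def case_prod_beta')
    qed
    have "(\<lambda>m. LINT p|(lborel \<Otimes>\<^sub>M lborel). \<Phi> (r m) p) \<longlonglongrightarrow> (LINT p|(lborel \<Otimes>\<^sub>M lborel). \<Phi> 0 p)"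
    proof (rule integral_dominated_convergence[OF \<Phi>m \<Phi>m dom])
      \<comment> \<open>The boundary of a box is a null set, and off it the indicator is locally
        constant.\<close>
      have "emeasure lborel (frontier ?S) = 0"
        using negligible_convex_frontier[of ?S] by (simp add: negligible_iff_emeasure0)
      then have "AE y in lborel. y \<notin> frontier ?S"
        by (subst AE_iff_measurable[where N="frontier ?S"]) auto
      have [measurable]: "frontier ?S \<in> sets borel" by (simp add: borel_closed)
      from \<open>AE y in lborel. y \<notin> frontier ?S\<close>
      have "AE z in lborel. AE y in lborel. (\<lambda>(z, y). y \<notin> frontier ?S) (z::real^'n, y)" by simp
      then have "AE p in (lborel \<Otimes>\<^sub>M lborel). (\<lambda>(z::real^'n, y). y \<notin> frontier ?S) p"
        by (intro lborel_pair.AE_pair_measure) measurable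
      then show "AE p in (lborel \<Otimes>\<^sub>M lborel). (\<lambda>m. \<Phi> (r m) p) \<longlonglongrightarrow> \<Phi> 0 p"
      proof eventually_elim
        case (elim p)
        have l: "(\<lambda>m. snd p - r m *\<^sub>R fst p) \<longlonglongrightarrow> snd p - 0 *\<^sub>R fst p" by (intro tendsto_intros r0)
        have "(\<lambda>m. indicator ?S (snd p - r m *\<^sub>R fst p)) \<longlonglongrightarrow> (indicator ?S (snd p) :: real)"
        proof (cases "snd p \<in> ?S")
          case True
          then have "snd p \<in> interior ?S" using elim by (auto simp: frontier_def case_prod_beta)
          then have "\<forall>\<^sub>F m in sequentially. snd p - r m *\<^sub>R fst p \<in> interior ?S"
            using l by (intro topological_tendstoD) auto
          then have "\<forall>\<^sub>F m in sequentially. indicator ?S (snd p - r m *\<^sub>R fst p) = (1::real)"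
            by eventually_elim (use box_subset_cbox[of a b] in \<open>auto simp: indicator_def\<close>)
          then show ?thesis using True by (simp add: tendsto_eventually)
        next
          case False
          then have "\<forall>\<^sub>F m in sequentially. snd p - r m *\<^sub>R fst p \<in> - ?S"
            using l by (intro topological_tendstoD) (auto simp: closed_cbox)
          then have "\<forall>\<^sub>F m in sequentially. indicator ?S (snd p - r m *\<^sub>R fst p) = (0::real)"
            by eventually_elim auto
          then show ?thesis using False by (simp add: tendsto_eventually)
        qed
        then show ?case unfolding \<Phi>_def by (intro tendsto_mult tendsto_const) simp
      qed
    next
      fix m show "AE p in (lborel \<Otimes>\<^sub>M lborel). norm (\<Phi> (r m) p) \<le> \<bar>\<kappa> (fst p)\<bar> * \<bar>indicator (cball 0 (R + \<rho>)) (snd p) *\<^sub>R F (snd p)\<bar>"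
        using le[of "r m"] r[of m] by (intro AE_I2) auto
    qed
    also have "(LINT p|(lborel \<Otimes>\<^sub>M lborel). \<Phi> 0 p) = c * (LINT x:?S|lborel. F x)"
    proof -
      have "integrable (lborel \<Otimes>\<^sub>M lborel) (\<lambda>(z, y). \<Phi> 0 (z, y))" using \<Phi>i[of 0] by simp
      from lborel_pair.integral_fst[OF this]
      have "(LINT p|(lborel \<Otimes>\<^sub>M lborel). \<Phi> 0 p) = (LINT z|lborel. LINT y|lborel. \<Phi> 0 (z, y))"
        by simp
      also have "\<dots> = (LINT z|lborel. \<kappa> z * (LINT x:?S|lborel. F x))"
      proof (intro Bochner_Integration.integral_cong refl)
        fix z
        have "(LINT y|lborel. \<Phi> 0 (z, y)) = (LINT y|lborel. \<kappa> z * (indicator ?S y *\<^sub>R F y))"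
          by (simp add: \<Phi>_def mult_ac)
        also have "\<dots> = \<kappa> z * (LINT x:?S|lborel. F x)" by (simp add: set_lebesgue_integral_def)
        finally show "(LINT y|lborel. \<Phi> 0 (z, y)) = \<kappa> z * (LINT x:?S|lborel. F x)" .
      qed
      finally show ?thesis by (simp add: c_def)
    qed
    finally have 1: "(\<lambda>m. LINT x|lborel. indicator ?S x * av \<kappa> (r m) F x) \<longlonglongrightarrow> c * (LINT x:?S|lborel. F x)"
      by (simp add: ave)
    \<comment> \<open>The same integrals converge a second time, by the assumed pointwise limit;
      comparing both limits identifies H with c F on boxes.\<close>
    have 2: "(\<lambda>m. LINT x|lborel. indicator ?S x * av \<kappa> (r m) F x) \<longlonglongrightarrow> (LINT x|lborel. indicator ?S x * H x)"
    proof (rule integral_dominated_convergence[where w="\<lambda>x. C * indicator ?S x"])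
      show "integrable lborel (\<lambda>x. C * indicator ?S x)"
        by (intro integrable_mult_right integrable_real_indicator) (auto simp: emeasure_lborel_cbox_eq)
      show "AE x in lborel. norm (indicator ?S x * av \<kappa> (r m) F x) \<le> C * indicator ?S x" for m
        using bound[of m] by (intro AE_I2) (simp add: r_def indicator_def)
      show "AE x in lborel. (\<lambda>m. indicator ?S x * av \<kappa> (r m) F x) \<longlonglongrightarrow> indicator ?S x * H x"
        using lim by (intro AE_I2 tendsto_mult tendsto_const) (simp add: r_def)
    qed (use avm in auto)
    from LIMSEQ_unique[OF 2 1] show ?thesis by (simp add: set_lebesgue_integral_def)
  qed
  have "AE x in lborel. H x - c * F x = 0"
  proof (rule AE_eq_0_of_box_integrals)
    show "set_integrable lborel (cbox a b) (\<lambda>x. H x - c * F x)" for a b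
      by (intro set_integral_diff boxH set_integrable_mult_right boxF)
    show "(LINT x:cbox a b|lborel. H x - c * F x) = 0" for a b
      using eq[of a b] boxH[of a b] boxF[of a b] by (simp add: set_integral_diff)
  qed measurable
  then show ?thesis unfolding c_def by eventually_elim simp
qed

section \<open>Weak gradients\<close>

text \<open>A Borel counterpart of \<open>locally_integrable\<close>, because shears and Fubini are
  applied on \<open>lborel \<Otimes>\<^sub>M lborel\<close>.\<close>

definition locally_integrable_borel :: "(real^'n::finite \<Rightarrow> real) \<Rightarrow> bool" where
  "locally_integrable_borel f \<longleftrightarrow> f \<in> borel_measurable borel \<and> (\<forall>R. set_integrable lborel (cball 0 R) f)"

lemma locally_integrable_borelD:
  assumes "locally_integrable_borel f"
  shows "f \<in> borel_measurable borel" "set_integrable lborel (cball 0 R) f"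
  using assms by (auto simp: locally_integrable_borel_def)

lemma bounded_borel_imp_locally_integrable:
  assumes "bounded_borel b S"
  shows "locally_integrable_borel b"
  unfolding locally_integrable_borel_def set_integrable_def
proof (intro conjI allI)
  fix R
  show "integrable lborel (\<lambda>x. indicator (cball 0 R) x *\<^sub>R b x)"
    by (rule integrable_on_finite_measure_set(1)[of _ "cball 0 R" S])
      (use bounded_borelD[OF assms] emeasure_bounded_finite[OF bounded_cball, of 0 R] in \<open>auto simp: indicator_def\<close>)
qed (rule bounded_borelD[OF assms])

text \<open>Only restrictions to compact sets are known to be integrable, hence measurable; f is the
  pointwise limit of its restrictions to growing balls.\<close>

lemma locally_integrable_imp_measurable:
  fixes f :: "real^'n::finite \<Rightarrow> real"
  assumes "locally_integrable f"
  shows "f \<in> borel_measurable lebesgue"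
proof (rule borel_measurable_LIMSEQ_metric)
  fix i :: nat
  have "integrable lebesgue (\<lambda>x. indicator (cball 0 (real i)) x *\<^sub>R f x)"
    using assms compact_cball unfolding locally_integrable_def set_integrable_def by blast
  then show "(\<lambda>x. indicator (cball 0 (real i)) x *\<^sub>R f x) \<in> borel_measurable lebesgue"
    by (rule borel_measurable_integrable)
next
  fix x :: "real^'n"
  have "\<forall>\<^sub>F i in sequentially. norm x \<le> real i" 
    using eventually_ge_at_top[of "nat \<lceil>norm x\<rceil>"] by eventually_elim linarith
  then show "(\<lambda>i. indicator (cball 0 (real i)) x *\<^sub>R f x) \<longlonglongrightarrow> f x"
    by (intro tendsto_eventually) (auto elim!: eventually_mono simp: indicator_def)
qed

lemma borel_representative:
  fixes f :: "real^'n::finite \<Rightarrow> real"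
  assumes "locally_integrable f"
  obtains f' where "locally_integrable_borel f'" "AE x in lebesgue. f x = f' x"
proof -
  have fm: "f \<in> borel_measurable lebesgue" by (rule locally_integrable_imp_measurable[OF assms])
  then obtain f' where f'[measurable]: "f' \<in> borel_measurable lborel" and ae: "AE x in lborel. f x = f' x"
    using completion_ex_borel_measurable_real by blast
  have ae': "AE x in lebesgue. f x = f' x" by (rule AE_completion[OF ae])
  have "set_integrable lborel (cball 0 R) f'" for R
  proof -
    have m: "(\<lambda>x. indicator (cball 0 R) x *\<^sub>R f' x) \<in> borel_measurable lborel"
      using f' by (auto intro!: borel_measurable_times borel_measurable_indicator)
    have "integrable lebesgue (\<lambda>x. indicator (cball 0 R) x *\<^sub>R f x)"
      using assms unfolding locally_integrable_def set_integrable_def by auto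
    then have "integrable lebesgue (\<lambda>x. indicator (cball 0 R) x *\<^sub>R f' x)"
    proof (rule integrable_cong_AE_imp)
      show "(\<lambda>x. indicator (cball 0 R) x *\<^sub>R f' x) \<in> borel_measurable lebesgue"
        by (rule measurable_completion[OF m])
      show "AE x in lebesgue. indicator (cball 0 R) x *\<^sub>R f x = indicator (cball 0 R) x *\<^sub>R f' x"
        using ae' by eventually_elim simp
    qed
    then show ?thesis unfolding set_integrable_def using integrable_completion[OF m] by blast
  qed
  then have "locally_integrable_borel f'" using f' by (simp add: locally_integrable_borel_def)
  then show ?thesis using ae' that by blast
qed

lemma integral_representative:
  fixes f :: "real^'n::finite \<Rightarrow> real"
  assumes [measurable]: "f \<in> borel_measurable lebesgue" "f' \<in> borel_measurable borel" "\<phi> \<in> borel_measurable borel"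
    and "AE x in lebesgue. f x = f' x"
  shows "(LINT x|lebesgue. f x * \<phi> x) = (LINT x|lborel. f' x * \<phi> x)"
proof -
  have [measurable]: "f' \<in> borel_measurable lebesgue" "\<phi> \<in> borel_measurable lebesgue"
    by (intro measurable_completion; simp)+
  have "(LINT x|lebesgue. f x * \<phi> x) = (LINT x|lebesgue. f' x * \<phi> x)"
    by (rule integral_cong_AE) (use assms(4) in auto)
  also have "\<dots> = (LINT x|lborel. f' x * \<phi> x)" by (rule integral_completion) measurable
  finally show ?thesis .
qed

lemma locally_integrable_times_test:
  assumes f: "locally_integrable_borel f" and "test_function \<phi>"
  shows "integrable lborel (\<lambda>x. f x * \<phi> x)"
proof -
  obtain \<rho> where \<rho>: "\<rho> > 0" "\<And>z. norm z \<ge> \<rho> \<Longrightarrow> \<phi> z = 0" using test_functionD(2)[OF assms(2)] by blast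
  obtain B where B: "\<And>x. \<bar>\<phi> x\<bar> \<le> B" using test_function_bounded[OF assms(2)] by blast
  have B0: "B \<ge> 0" using B[of 0] by linarith
  note [measurable] = locally_integrable_borelD(1)[OF f] test_function_measurable[OF assms(2)]
  have "integrable lborel (\<lambda>x. B * (indicator (cball 0 \<rho>) x *\<^sub>R f x))"
    using locally_integrable_borelD(2)[OF f, of \<rho>] unfolding set_integrable_def by (rule integrable_mult_right)
  then show ?thesis
  proof (rule Bochner_Integration.integrable_bound)
    show "AE x in lborel. norm (f x * \<phi> x) \<le> norm (B * (indicator (cball 0 \<rho>) x *\<^sub>R f x))"
    proof (rule AE_I2)
      fix x
      have "\<bar>f x\<bar> * \<bar>\<phi> x\<bar> \<le> \<bar>f x\<bar> * B" by (intro mult_left_mono B) auto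
      then show "norm (f x * \<phi> x) \<le> norm (B * (indicator (cball 0 \<rho>) x *\<^sub>R f x))"
        using \<rho>(2)[of x] B0 by (cases "norm x \<le> \<rho>") (auto simp: abs_mult mult.commute)
    qed
  qed measurable
qed

definition borel_weak_gradient :: "(real^'n::finite \<Rightarrow> real) \<Rightarrow> ('n \<Rightarrow> real^'n \<Rightarrow> real) \<Rightarrow> bool" where
  "borel_weak_gradient u g \<longleftrightarrow> (\<forall>i. locally_integrable_borel (g i)) \<and>
     (\<forall>\<phi> i. test_function \<phi> \<longrightarrow> (LINT x|lborel. u x * partial i \<phi> x) = - (LINT x|lborel. g i x * \<phi> x))"

lemma locally_integrable_nth:
  fixes G :: "real^'n::finite \<Rightarrow> real^'n"
  assumes "locally_integrable G"
  shows "locally_integrable (\<lambda>x. G x $ i)"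
  unfolding locally_integrable_def set_integrable_def
proof (intro allI impI)
  fix K :: "(real^'n) set" assume "compact K"
  then have "integrable lebesgue (\<lambda>x. indicator K x *\<^sub>R G x)"
    using assms unfolding locally_integrable_def set_integrable_def by blast
  from integrable_bounded_linear[OF bounded_linear_vec_nth this, of i]
  show "integrable lebesgue (\<lambda>x. indicator K x *\<^sub>R G x $ i)" by simp
qed

lemma borel_weak_gradient_representative:
  fixes u u0 :: "real^'n::finite \<Rightarrow> real"
  assumes w: "has_weak_gradient u G" and u0: "u0 \<in> borel_measurable borel" and ae: "AE x in lebesgue. u x = u0 x"
  obtains g where "borel_weak_gradient u0 g" "\<And>i. AE x in lebesgue. G x $ i = g i x"
proof -
  have lu: "locally_integrable u" and lG: "locally_integrable G"
    and ibp: "\<And>\<phi> i. test_function \<phi> \<Longrightarrow> (LINT x|lebesgue. u x * partial i \<phi> x) = - (LINT x|lebesgue. (G x $ i) * \<phi> x)"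
    using w unfolding has_weak_gradient_def by blast+
  have "\<forall>i. \<exists>g. locally_integrable_borel g \<and> (AE x in lebesgue. G x $ i = g x)"
    using borel_representative[OF locally_integrable_nth[OF lG]] by metis
  then obtain g where g: "\<And>i. locally_integrable_borel (g i)" "\<And>i. AE x in lebesgue. G x $ i = g i x" by metis
  have "(LINT x|lborel. u0 x * partial i \<phi> x) = - (LINT x|lborel. g i x * \<phi> x)" if "test_function \<phi>" for \<phi> i
  proof -
    have "(LINT x|lebesgue. u x * partial i \<phi> x) = (LINT x|lborel. u0 x * partial i \<phi> x)"
      by (intro integral_representative locally_integrable_imp_measurable lu u0 ae test_function_measurable test_function_partial that)
    moreover have "(LINT x|lebesgue. G x $ i * \<phi> x) = (LINT x|lborel. g i x * \<phi> x)"
      by (intro integral_representative locally_integrable_imp_measurable locally_integrable_nth lG g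
          locally_integrable_borelD(1) test_function_measurable that)
    ultimately show ?thesis using ibp[OF that] by simp
  qed
  with g that show ?thesis by (auto simp: borel_weak_gradient_def)
qed

text \<open>The definition is tested with the function taking y to \<kappa>((y - x) / r), whose
  partials carry 1 / r. By the formula for derivatives of averages the left side is a partial
  derivative of the mollified u, so mollification commutes with the weak gradient.\<close>

lemma av_weak_gradient:
  fixes u :: "real^'n::finite \<Rightarrow> real"
  assumes w: "borel_weak_gradient u g" and u: "u \<in> borel_measurable borel"
    and k: "test_function \<kappa>" and r: "r > 0"
  shows "- inverse r * av (partial i \<kappa>) r u x = av \<kappa> r (g i) x"
proof -
  let ?\<phi> = "\<lambda>y. \<kappa> (inverse r *\<^sub>R (y - x))"
  have t: "test_function ?\<phi>" by (rule test_function_affine[OF k]) (use r in simp)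
  have p: "partial i ?\<phi> y = inverse r * partial i \<kappa> (inverse r *\<^sub>R (y - x))" for y
    by (rule partial_affine(2)[OF test_function_differentiable[OF k]])
  have gm: "g i \<in> borel_measurable borel"
    using w unfolding borel_weak_gradient_def by (auto intro: locally_integrable_borelD(1))
  have "(LINT y|lborel. u y * partial i ?\<phi> y) = inverse r * (LINT y|lborel. u y * partial i \<kappa> (inverse r *\<^sub>R (y - x)))"
    unfolding p by (simp add: mult.left_commute)
  also have "\<dots> = inverse r * (r ^ CARD('n) * av (partial i \<kappa>) r u x)"
    by (subst av_rescale[OF u test_function_measurable[OF test_function_partial[OF k]] r]) simp
  finally have "inverse r * (r ^ CARD('n) * av (partial i \<kappa>) r u x) = - (LINT y|lborel. g i y * ?\<phi> y)"
    using w t unfolding borel_weak_gradient_def by simp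
  also have "(LINT y|lborel. g i y * ?\<phi> y) = r ^ CARD('n) * av \<kappa> r (g i) x"
    by (rule av_rescale[OF gm test_function_measurable[OF k] r])
  finally have "r ^ CARD('n) * (- inverse r * av (partial i \<kappa>) r u x) = r ^ CARD('n) * av \<kappa> r (g i) x"
    by (simp add: mult.left_commute)
  then show ?thesis using r by (metis mult_left_cancel power_not_zero less_irrefl)
qed

text \<open>Reduces an almost everywhere identity to one between averages, for which classical
  calculus and Fubini are available.\<close>

lemma mollifications_eq_0_imp_AE:
  fixes F :: "real^'n::finite \<Rightarrow> real"
  assumes F: "locally_integrable_borel F" and z: "\<And>r x. r > 0 \<Longrightarrow> av ker r F x = 0"
  shows "AE x in lborel. F x = 0"
proof -
  have "AE x in lborel. (\<lambda>x. 0) x = (LINT z|lborel. ker (z::real^'n)) * F x"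
    by (rule mollification_limit_AE[where C=0, OF test_function_ker])
      (use locally_integrable_borelD[OF F] z in auto)
  moreover have "(LINT z|lborel. ker (z::real^'n)) \<noteq> 0" using ker_integral_pos by (metis less_irrefl)
  ultimately show ?thesis by (auto elim!: eventually_mono)
qed

lemma locally_integrable_borel_linear:
  assumes "finite A" "\<And>i. i \<in> A \<Longrightarrow> locally_integrable_borel (f i)"
  shows "locally_integrable_borel (\<lambda>x. \<Sum>i\<in>A. c i * f i x)"
proof -
  have "set_integrable lborel (cball 0 R) (\<lambda>x. \<Sum>i\<in>A. c i * f i x)" for R
  proof -
    have "integrable lborel (\<lambda>x. \<Sum>i\<in>A. c i * (indicator (cball 0 R) x *\<^sub>R f i x))"
      using locally_integrable_borelD(2)[OF assms(2)] unfolding set_integrable_def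
      by (intro Bochner_Integration.integrable_sum integrable_mult_right) auto
    then show ?thesis unfolding set_integrable_def by (simp add: sum_distrib_left mult_ac)
  qed
  moreover have "(\<lambda>x. \<Sum>i\<in>A. c i * f i x) \<in> borel_measurable borel"
    using locally_integrable_borelD(1)[OF assms(2)] by (intro borel_measurable_sum borel_measurable_times) auto
  ultimately show ?thesis by (simp add: locally_integrable_borel_def)
qed

lemma locally_integrable_borel_diff:
  assumes f: "locally_integrable_borel f" and g: "locally_integrable_borel g"
  shows "locally_integrable_borel (\<lambda>x. f x - g x)"
proof -
  note [measurable] = locally_integrable_borelD(1)[OF f] locally_integrable_borelD(1)[OF g]
  show ?thesis
    unfolding locally_integrable_borel_def
    using set_integral_diff(1)[OF locally_integrable_borelD(2)[OF f] locally_integrable_borelD(2)[OF g]] by auto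
qed

lemma test_function_affine_inverse:
  "test_function f \<Longrightarrow> r > 0 \<Longrightarrow> test_function (\<lambda>y. f (inverse r *\<^sub>R (y - a)))"
  by (rule test_function_affine) auto

lemma av_integrable_local:
  fixes f :: "real^'n::finite \<Rightarrow> real"
  assumes f: "locally_integrable_borel f" and k: "test_function \<kappa>" and r: "r > 0"
  shows "integrable lborel (\<lambda>z. f (x + r *\<^sub>R z) * \<kappa> z)"
proof -
  note [measurable] = locally_integrable_borelD(1)[OF f] test_function_measurable[OF k]
  have "integrable lborel (\<lambda>y. f y * \<kappa> (inverse r *\<^sub>R (y - x)))"
    by (rule locally_integrable_times_test[OF f test_function_affine_inverse[OF k r]])
  then have "integrable lborel (\<lambda>z. f (x + r *\<^sub>R z) * \<kappa> (inverse r *\<^sub>R ((x + r *\<^sub>R z) - x)))"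
    using r by (subst lborel_affine_integral(2)[of "\<lambda>y. f y * \<kappa> (inverse r *\<^sub>R (y - x))"]) auto
  then show ?thesis using r by simp
qed

text \<open>\<open>weak_gradient\<close> is an arbitrary choice; uniqueness lets the choice for a
  test function be replaced by its classical gradient. Two weak gradients of u have the same
  mollifications, since u determines these.\<close>

lemma weak_gradient_unique:
  fixes u :: "real^'n::finite \<Rightarrow> real"
  assumes G: "has_weak_gradient u G" and G': "has_weak_gradient u G'"
  shows "AE x in lebesgue. G x = G' x"
proof -
  have "locally_integrable u" using G by (simp add: has_weak_gradient_def)
  then obtain u0 where u0: "locally_integrable_borel u0" "AE x in lebesgue. u x = u0 x"
    by (rule borel_representative)
  note um = locally_integrable_borelD(1)[OF u0(1)]
  obtain g where g: "borel_weak_gradient u0 g" "\<And>i. AE x in lebesgue. G x $ i = g i x"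
    using borel_weak_gradient_representative[OF G um u0(2)] by blast
  obtain g' where g': "borel_weak_gradient u0 g'" "\<And>i. AE x in lebesgue. G' x $ i = g' i x"
    using borel_weak_gradient_representative[OF G' um u0(2)] by blast
  have l: "locally_integrable_borel (g i)" "locally_integrable_borel (g' i)" for i
    using g g' by (auto simp: borel_weak_gradient_def)
  have "AE x in lebesgue. G x $ i = G' x $ i" for i
  proof -
    have "AE x in lborel. g i x - g' i x = 0"
    proof (rule mollifications_eq_0_imp_AE[OF locally_integrable_borel_diff[OF l]])
      fix r :: real and x :: "real^'n" assume r: "r > 0"
      have "av ker r (\<lambda>x. g i x - g' i x) x = av ker r (g i) x - av ker r (g' i) x"
        unfolding av_def left_diff_distrib
        by (intro Bochner_Integration.integral_diff av_integrable_local[OF _ test_function_ker r] l)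
      also have "\<dots> = 0"
        using av_weak_gradient[OF g(1) um test_function_ker r, of i x] av_weak_gradient[OF g'(1) um test_function_ker r, of i x]
        by simp
      finally show "av ker r (\<lambda>x. g i x - g' i x) x = 0" .
    qed
    then have "AE x in lebesgue. g i x - g' i x = 0" by (rule AE_completion)
    with g(2)[of i] g'(2)[of i] show ?thesis by eventually_elim simp
  qed
  then have "AE x in lebesgue. \<forall>i\<in>UNIV. G x $ i = G' x $ i"
    by (intro AE_finite_allI) auto
  then show ?thesis by eventually_elim (simp add: vec_eq_iff)
qed

text \<open>The average of the constant 1 against f does not depend on the point, so its partial
  derivative is 0; by the formula for derivatives of averages that derivative is also minus the
  integral of \<open>partial i f\<close>.\<close>

lemma test_function_integral_partial:
  fixes f :: "real^'n::finite \<Rightarrow> real"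
  assumes f: "test_function f"
  shows "(LINT x|lborel. partial i f x) = 0"
proof -
  have b: "bounded_borel (\<lambda>x::real^'n. 1) 1" by (simp add: bounded_borel_def)
  have "av f 1 (\<lambda>x. 1) = (\<lambda>x. LINT z|lborel. f z)" by (simp add: av_def fun_eq_iff)
  then have "((\<lambda>x. LINT z|lborel. f z) has_derivative (\<lambda>v. \<Sum>i\<in>UNIV. v $ i * (- inverse 1 * av (partial i f) 1 (\<lambda>x. 1) 0))) (at 0)"
    using av_has_derivative[OF f b zero_less_one, of 0] by simp
  from partial_eqI[OF this, of i] partial_eqI[OF has_derivative_const, of i "LINT z|lborel. f z" 0]
  show ?thesis by (simp add: av_def axis_def sum_negf if_distrib[where f="\<lambda>z. z * _"] cong: if_cong)
qed

section \<open>Test functions as members of \<open>H1\<close>\<close>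

lemma test_function_locally_integrable_lebesgue:
  fixes f :: "real^'n::finite \<Rightarrow> real"
  assumes f: "test_function f"
  shows "locally_integrable f" "integrable lebesgue f"
proof -
  show i: "integrable lebesgue f"
    using test_function_integrable[OF f] test_function_measurable[OF f] by (subst integrable_completion) auto
  show "locally_integrable f" unfolding locally_integrable_def set_integrable_def
    using i by (auto intro!: integrable_real_mult_indicator simp: mult.commute[of "indicator _ _"] lmeasurable_compact fmeasurableD)
qed

text \<open>Integrate the product rule for f \<phi>; the left side vanishes because partial
  derivatives of test functions have integral 0.\<close>

lemma test_function_weak_gradient:
  fixes f :: "real^'n::finite \<Rightarrow> real"
  assumes f: "test_function f"
  shows "has_weak_gradient f (gradient f)"
proof -
  have "locally_integrable (gradient f)"
    unfolding locally_integrable_def set_integrable_def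
  proof (intro allI impI)
    fix K :: "(real^'n) set" assume K: "compact K"
    have "integrable lebesgue (\<lambda>x. \<Sum>i\<in>UNIV. (indicator K x *\<^sub>R partial i f x) *\<^sub>R axis i (1::real))"
      using test_function_locally_integrable_lebesgue(1)[OF test_function_partial[OF f]] K
      unfolding locally_integrable_def set_integrable_def
      by (intro Bochner_Integration.integrable_sum integrable_scaleR_left) auto
    moreover have "(\<Sum>i\<in>UNIV. (indicator K x *\<^sub>R partial i f x) *\<^sub>R axis i (1::real)) = indicator K x *\<^sub>R gradient f x" for x
      using basis_expansion[of "indicator K x *\<^sub>R gradient f x"] by (simp add: gradient_def scalar_mult_eq_scaleR)
    ultimately show "integrable lebesgue (\<lambda>x. indicator K x *\<^sub>R gradient f x)" by simp
  qed
  moreover have "(LINT x|lebesgue. f x * partial i \<phi> x) = - (LINT x|lebesgue. gradient f x $ i * \<phi> x)" if "test_function \<phi>" for \<phi> i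
  proof -
    have t: "test_function (\<lambda>x. f x * \<phi> x)" using f that test_functionD(1) test_function_mult_left by blast
    have t1: "test_function (\<lambda>x. f x * partial i \<phi> x)"
      using f that test_functionD(1) test_function_mult_left test_function_partial by blast
    have t2: "test_function (\<lambda>x. partial i f x * \<phi> x)"
      using f that test_functionD(1) test_function_mult_left test_function_partial by blast
    have p: "partial i (\<lambda>x. f x * \<phi> x) x = f x * partial i \<phi> x + partial i f x * \<phi> x" for x
      by (intro partial_mult test_function_differentiable f that)
    have "(LINT x|lborel. f x * partial i \<phi> x) + (LINT x|lborel. partial i f x * \<phi> x) = 0"
      using test_function_integral_partial[OF t, of i] t1 t2 by (simp add: p test_function_integrable)
    moreover have "(LINT x|lebesgue. f x * partial i \<phi> x) = (LINT x|lborel. f x * partial i \<phi> x)"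
      using test_function_measurable[OF t1] by (intro integral_completion) simp
    moreover have "(LINT x|lebesgue. partial i f x * \<phi> x) = (LINT x|lborel. partial i f x * \<phi> x)"
      using test_function_measurable[OF t2] by (intro integral_completion) simp
    ultimately show ?thesis by (simp add: gradient_def)
  qed
  ultimately show ?thesis
    using test_function_locally_integrable_lebesgue(1)[OF f] unfolding has_weak_gradient_def by blast
qed

lemma test_function_H1:
  fixes f :: "real^'n::finite \<Rightarrow> real"
  assumes f: "test_function f"
  shows "f \<in> H1"
proof -
  have sq: "integrable lebesgue (\<lambda>x. (g x)\<^sup>2)" if "test_function g" for g :: "real^'n \<Rightarrow> real"
    using test_function_locally_integrable_lebesgue(2)[OF test_function_mult_left[OF test_functionD(1)[OF that] that]]
    by (simp add: power2_eq_square)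
  have "f \<in> borel_measurable lebesgue" by (rule measurable_completion) (simp add: test_function_measurable f)
  moreover have "gradient f \<in> borel_measurable lebesgue"
  proof (rule measurable_completion)
    have "(\<lambda>x. \<Sum>i\<in>UNIV. partial i f x *\<^sub>R axis i (1::real)) \<in> borel_measurable borel"
      using test_function_measurable[OF test_function_partial[OF f]]
      by (intro borel_measurable_sum borel_measurable_scaleR) auto
    moreover have "(\<Sum>i\<in>UNIV. partial i f x *\<^sub>R axis i (1::real)) = gradient f x" for x
      using basis_expansion[of "gradient f x"] by (simp add: gradient_def scalar_mult_eq_scaleR)
    ultimately show "gradient f \<in> borel_measurable lborel" by simp
  qed
  moreover have "integrable lebesgue (\<lambda>x. (norm (gradient f x))\<^sup>2)"
  proof -
    have "(norm (gradient f x))\<^sup>2 = (\<Sum>i\<in>UNIV. (partial i f x)\<^sup>2)" for x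
      by (simp add: norm_eq_sqrt_inner inner_vec_def gradient_def sum_nonneg power2_eq_square)
    then show ?thesis using sq[OF test_function_partial[OF f]] by simp
  qed
  ultimately show ?thesis
    using sq[OF f] test_function_weak_gradient[OF f] by (auto simp: H1_def square_integrable_def)
qed

text \<open>Tonelli with a majorant W for the L1 norms of the slices, the form in which the
  estimates for a fixed step h are obtained.\<close>

lemma pair_integrableI:
  fixes F :: "'a::euclidean_space \<times> 'b::euclidean_space \<Rightarrow> real"
  assumes F[measurable]: "F \<in> borel_measurable (lborel \<Otimes>\<^sub>M lborel)"
    and i: "\<And>h. integrable lborel (\<lambda>x. F (h, x))"
    and le: "\<And>h. (LINT x|lborel. \<bar>F (h, x)\<bar>) \<le> W h" and W: "integrable lborel W"
  shows "integrable (lborel \<Otimes>\<^sub>M lborel) F"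
proof (rule lborel_pair.Fubini_integrable)
  show "integrable lborel (\<lambda>h. LINT x|lborel. norm (F (h, x)))"
  proof (rule Bochner_Integration.integrable_bound[OF W])
    show "(\<lambda>h. LINT x|lborel. norm (F (h, x))) \<in> borel_measurable lborel"
      by (rule lborel.borel_measurable_lebesgue_integral) measurable
    show "AE h in lborel. norm (LINT x|lborel. norm (F (h, x))) \<le> norm (W h)"
    proof (rule AE_I2)
      fix h show "norm (LINT x|lborel. norm (F (h, x))) \<le> norm (W h)"
        using le[of h] abs_ge_self[of "W h"] by simp
    qed
  qed
qed (use i in auto)

section \<open>Translation estimates from the weak gradient\<close>

lemma shifted_integrable:
  fixes \<gamma> \<psi> :: "real^'n::finite \<Rightarrow> real"
  assumes g: "locally_integrable_borel \<gamma>" and [measurable]: "\<psi> \<in> borel_measurable borel"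
    and B: "\<And>x. \<bar>\<psi> x\<bar> \<le> B" and \<rho>: "\<And>x. norm x > \<rho> \<Longrightarrow> \<psi> x = 0"
  shows "integrable (lborel \<Otimes>\<^sub>M lborel)
    (\<lambda>p. indicator {0..1::real} (fst p) * (\<gamma> (snd p + fst p *\<^sub>R h) * \<psi> (snd p)))"
proof -
  note [measurable] = locally_integrable_borelD(1)[OF g]
  have B0: "B \<ge> 0" using B[of 0] by linarith
  \<comment> \<open>This is the integrand before the shear by t h. Here \<gamma> is evaluated at the
    integration variable, so its integrability on a ball enlarged by \<open>norm h\<close>
    suffices.\<close>
  define f where "f = (\<lambda>p. indicator {0..1::real} (fst p) * (\<gamma> (snd p) * \<psi> (snd p - fst p *\<^sub>R h)))"
  have fm: "f \<in> borel_measurable (lborel \<Otimes>\<^sub>M lborel)" unfolding f_def by measurable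
  have "integrable (lborel \<Otimes>\<^sub>M lborel)
      (\<lambda>p. indicator {0..1::real} (fst p) * (B * \<bar>indicator (cball 0 (\<rho> + norm h)) (snd p) *\<^sub>R \<gamma> (snd p)\<bar>))"
    using locally_integrable_borelD(2)[OF g, of "\<rho> + norm h"] unfolding set_integrable_def
    by (intro integrable_product_function[where g="\<lambda>y. B * \<bar>indicator (cball 0 (\<rho> + norm h)) y *\<^sub>R \<gamma> y\<bar>"]
        integrable_mult_right integrable_abs integrable_real_indicator) auto
  then have "integrable (lborel \<Otimes>\<^sub>M lborel) f"
  proof (rule Bochner_Integration.integrable_bound[OF _ fm])
    show "AE p in (lborel \<Otimes>\<^sub>M lborel). norm (f p)
        \<le> norm (indicator {0..1::real} (fst p) * (B * \<bar>indicator (cball 0 (\<rho> + norm h)) (snd p) *\<^sub>R \<gamma> (snd p)\<bar>))"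
    proof (rule AE_I2)
      fix p :: "real \<times> (real^'n)"
      show "norm (f p) \<le> norm (indicator {0..1::real} (fst p) * (B * \<bar>indicator (cball 0 (\<rho> + norm h)) (snd p) *\<^sub>R \<gamma> (snd p)\<bar>))"
      proof (cases "fst p \<in> {0..1} \<and> norm (snd p - fst p *\<^sub>R h) \<le> \<rho>")
        case True
        then have "norm (fst p *\<^sub>R h) \<le> norm h" by (auto intro: mult_left_le_one_le)
        then have "norm (snd p) \<le> \<rho> + norm h" using True norm_triangle_sub[of "snd p" "fst p *\<^sub>R h"] by linarith
        moreover have "\<bar>\<gamma> (snd p)\<bar> * \<bar>\<psi> (snd p - fst p *\<^sub>R h)\<bar> \<le> \<bar>\<gamma> (snd p)\<bar> * B"
          by (intro mult_left_mono B) auto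
        ultimately show ?thesis using True B0 by (simp add: f_def abs_mult mult.commute)
      next
        case False
        then have "f p = 0" using \<rho> by (auto simp: f_def not_le)
        then show ?thesis by simp
      qed
    qed
  qed
  then show ?thesis
    using lborel_shear_integral(2)[OF _ fm, where L="\<lambda>t. t *\<^sub>R h"] by (simp add: f_def)
qed

text \<open>When \<gamma> is the weak derivative of u along h, this is the integral in the
  fundamental theorem of calculus on the segment from x to x + h.\<close>

definition seg :: "real^'n::finite \<Rightarrow> (real^'n \<Rightarrow> real) \<Rightarrow> real^'n \<Rightarrow> real" where
  "seg h \<gamma> x = (LINT t|lborel. indicator {0..1::real} t * \<gamma> (x + t *\<^sub>R h))"

lemma seg_integral:
  fixes \<gamma> \<psi> :: "real^'n::finite \<Rightarrow> real"
  assumes g: "locally_integrable_borel \<gamma>" and m: "\<psi> \<in> borel_measurable borel"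
    and B: "\<And>x. \<bar>\<psi> x\<bar> \<le> B" and \<rho>: "\<And>x. norm x > \<rho> \<Longrightarrow> \<psi> x = 0"
  shows "integrable lborel (\<lambda>x. seg h \<gamma> x * \<psi> x)"
    and "(LINT x|lborel. seg h \<gamma> x * \<psi> x) = (LINT t|lborel. indicator {0..1} t * (LINT x|lborel. \<gamma> (x + t *\<^sub>R h) * \<psi> x))"
    and "integrable lborel (\<lambda>t. indicator {0..1} t * (LINT x|lborel. \<gamma> (x + t *\<^sub>R h) * \<psi> x))"
proof -
  have i: "integrable (lborel \<Otimes>\<^sub>M lborel) (\<lambda>(t, x). indicator {0..1::real} t * (\<gamma> (x + t *\<^sub>R h) * \<psi> x))"
    using shifted_integrable[OF assms, where h=h] by (simp add: case_prod_beta')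
  have s: "seg h \<gamma> x * \<psi> x = (LINT t|lborel. indicator {0..1::real} t * (\<gamma> (x + t *\<^sub>R h) * \<psi> x))" for x
    unfolding seg_def mult.assoc[symmetric] by simp
  show "integrable lborel (\<lambda>x. seg h \<gamma> x * \<psi> x)"
    unfolding s using lborel_pair.integrable_snd[OF i] .
  have "(LINT x|lborel. seg h \<gamma> x * \<psi> x) = (LINT t|lborel. LINT x|lborel. indicator {0..1::real} t * (\<gamma> (x + t *\<^sub>R h) * \<psi> x))"
    unfolding s using lborel_pair.integral_snd[OF i] lborel_pair.integral_fst[OF i] by simp
  then show "(LINT x|lborel. seg h \<gamma> x * \<psi> x) = (LINT t|lborel. indicator {0..1} t * (LINT x|lborel. \<gamma> (x + t *\<^sub>R h) * \<psi> x))"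
    by simp
  show "integrable lborel (\<lambda>t. indicator {0..1} t * (LINT x|lborel. \<gamma> (x + t *\<^sub>R h) * \<psi> x))"
    using lborel_pair.integrable_fst[OF i] by simp
qed

lemma seg_measurable:
  assumes [measurable]: "\<gamma> \<in> borel_measurable borel"
  shows "seg h \<gamma> \<in> borel_measurable borel"
proof -
  have "(\<lambda>x. LINT t|lborel. indicator {0..1::real} t * \<gamma> (x + t *\<^sub>R h)) \<in> borel_measurable borel"
    by (rule lborel.borel_measurable_lebesgue_integral) measurable
  then show ?thesis by (simp add: seg_def[abs_def])
qed

lemma seg_locally_integrable:
  assumes g: "locally_integrable_borel \<gamma>"
  shows "locally_integrable_borel (seg h \<gamma>)"
  unfolding locally_integrable_borel_def set_integrable_def
proof (intro conjI allI)
  fix R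
  have "(indicator (cball 0 R) :: real^'a \<Rightarrow> real) \<in> borel_measurable borel"
    by (rule borel_measurable_indicator) simp
  from seg_integral(1)[OF g this, of 1 R h]
  show "integrable lborel (\<lambda>x. indicator (cball 0 R) x *\<^sub>R seg h \<gamma> x)"
    by (simp add: mult.commute)
qed (rule seg_measurable[OF locally_integrable_borelD(1)[OF g]])

lemma locally_integrable_abs:
  assumes g: "locally_integrable_borel \<gamma>"
  shows "locally_integrable_borel (\<lambda>x. \<bar>\<gamma> x\<bar>)"
proof -
  note [measurable] = locally_integrable_borelD(1)[OF g]
  have "set_integrable lborel (cball 0 R) (\<lambda>x. \<bar>\<gamma> x\<bar>)" for R
    using set_integrable_abs[OF locally_integrable_borelD(2)[OF g, of R]] .
  then show ?thesis by (simp add: locally_integrable_borel_def)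
qed

text \<open>For t in [0, 1] a translation by t h moves the ball of radius R by at most 1, whence the
  larger ball on the right.\<close>

lemma seg_L1_bound:
  fixes \<gamma> :: "real^'n::finite \<Rightarrow> real"
  assumes g: "locally_integrable_borel \<gamma>" and h: "norm h \<le> 1"
  shows "(LINT x|lborel. indicator (cball 0 R) x * \<bar>seg h \<gamma> x\<bar>) \<le> (LINT x|lborel. indicator (cball 0 (R + 1)) x * \<bar>\<gamma> x\<bar>)"
proof -
  let ?\<psi> = "indicator (cball 0 R) :: real^'n \<Rightarrow> real"
  let ?J = "LINT x|lborel. indicator (cball 0 (R + 1)) x * \<bar>\<gamma> x\<bar>"
  note g' = locally_integrable_abs[OF g]
  note [measurable] = locally_integrable_borelD(1)[OF g]
  have \<psi>: "?\<psi> \<in> borel_measurable borel" "\<And>x. \<bar>?\<psi> x\<bar> \<le> 1" "\<And>x. norm x > R \<Longrightarrow> ?\<psi> x = 0"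
    by (auto intro!: borel_measurable_indicator simp: indicator_le_1)
  have le: "\<bar>seg h \<gamma> x\<bar> \<le> seg h (\<lambda>x. \<bar>\<gamma> x\<bar>) x" for x
    using integral_abs_bound[of lborel "\<lambda>t. indicator {0..1::real} t * \<gamma> (x + t *\<^sub>R h)"]
    by (simp add: seg_def abs_mult)
  have "(LINT x|lborel. ?\<psi> x * \<bar>seg h \<gamma> x\<bar>) \<le> (LINT x|lborel. seg h (\<lambda>x. \<bar>\<gamma> x\<bar>) x * ?\<psi> x)"
  proof (rule integral_mono)
    show "integrable lborel (\<lambda>x. ?\<psi> x * \<bar>seg h \<gamma> x\<bar>)"
      using integrable_abs[OF seg_integral(1)[OF g \<psi>, where h=h]] by (simp add: abs_mult mult.commute)
    show "integrable lborel (\<lambda>x. seg h (\<lambda>x. \<bar>\<gamma> x\<bar>) x * ?\<psi> x)" by (rule seg_integral(1)[OF g' \<psi>])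
    show "?\<psi> x * \<bar>seg h \<gamma> x\<bar> \<le> seg h (\<lambda>x. \<bar>\<gamma> x\<bar>) x * ?\<psi> x" for x
      using le[of x] by (simp add: indicator_def)
  qed
  also have "\<dots> = (LINT t|lborel. indicator {0..1} t * (LINT x|lborel. \<bar>\<gamma> (x + t *\<^sub>R h)\<bar> * ?\<psi> x))"
    by (rule seg_integral(2)[OF g' \<psi>])
  also have "\<dots> \<le> (LINT t|lborel. indicator {0..1::real} t * ?J)"
  proof (rule integral_mono[OF seg_integral(3)[OF g' \<psi>]])
    show "integrable lborel (\<lambda>t. indicator {0..1::real} t * ?J)"
      by (intro integrable_mult_left integrable_real_indicator) auto
    fix t :: real
    have "(LINT x|lborel. \<bar>\<gamma> (x + t *\<^sub>R h)\<bar> * ?\<psi> x) \<le> ?J" if t: "t \<in> {0..1}"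
    proof -
      have i: "integrable lborel (\<lambda>x. indicator (cball 0 (R + 1)) x * \<bar>\<gamma> x\<bar>)"
        using locally_integrable_borelD(2)[OF g', of "R + 1"] by (simp add: set_integrable_def)
      have m: "(\<lambda>x. indicator (cball 0 (R + 1)) x * \<bar>\<gamma> x\<bar>) \<in> borel_measurable borel" using i by auto
      have i2: "integrable lborel (\<lambda>x. indicator (cball 0 (R + 1)) (x + t *\<^sub>R h) * \<bar>\<gamma> (x + t *\<^sub>R h)\<bar>)"
        using lborel_translate(2)[OF m] i by blast
      have le: "\<bar>\<gamma> (x + t *\<^sub>R h)\<bar> * ?\<psi> x \<le> indicator (cball 0 (R + 1)) (x + t *\<^sub>R h) * \<bar>\<gamma> (x + t *\<^sub>R h)\<bar>" for x
      proof (cases "norm x \<le> R")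
        case True
        have "norm (t *\<^sub>R h) \<le> 1" using t h by (auto intro: mult_le_one)
        then have "norm (x + t *\<^sub>R h) \<le> R + 1" using True norm_triangle_ineq[of x "t *\<^sub>R h"] by linarith
        then show ?thesis by (simp add: indicator_def)
      qed (simp add: indicator_def)
      have "(LINT x|lborel. \<bar>\<gamma> (x + t *\<^sub>R h)\<bar> * ?\<psi> x)
          \<le> (LINT x|lborel. indicator (cball 0 (R + 1)) (x + t *\<^sub>R h) * \<bar>\<gamma> (x + t *\<^sub>R h)\<bar>)"
      proof (rule integral_mono_AE'[OF i2])
        show "AE x in lborel. \<bar>\<gamma> (x + t *\<^sub>R h)\<bar> * ?\<psi> x \<le> indicator (cball 0 (R + 1)) (x + t *\<^sub>R h) * \<bar>\<gamma> (x + t *\<^sub>R h)\<bar>"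
          using le by (intro AE_I2)
        show "AE x in lborel. 0 \<le> indicator (cball 0 (R + 1)) (x + t *\<^sub>R h) * \<bar>\<gamma> (x + t *\<^sub>R h)\<bar>"
          by (intro AE_I2) simp
      qed
      also have "\<dots> = ?J" by (rule lborel_translate(1)[OF m])
      finally show ?thesis .
    qed
    then show "indicator {0..1} t * (LINT x|lborel. \<bar>\<gamma> (x + t *\<^sub>R h)\<bar> * ?\<psi> x) \<le> indicator {0..1} t * ?J"
      by (auto simp: indicator_def)
  qed
  also have "\<dots> = ?J" by simp
  finally show ?thesis .
qed

text \<open>The fundamental theorem of calculus holds for the smooth function
  \<open>av ker r u\<close>. Averaging commutes with the difference and with the segment integral,
  so both sides have equal averages at every radius and agree almost everywhere.\<close>

lemma weak_gradient_segment:
  fixes u :: "real^'n::finite \<Rightarrow> real"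
  assumes w: "borel_weak_gradient u g" and b: "bounded_borel u M"
  shows "AE x in lborel. diff h u x = seg h (\<lambda>y. \<Sum>i\<in>UNIV. h $ i * g i y) x"
proof -
  define \<gamma> where "\<gamma> = (\<lambda>y. \<Sum>i\<in>UNIV. h $ i * g i y)"
  have gi: "locally_integrable_borel (g i)" for i using w by (auto simp: borel_weak_gradient_def)
  have \<gamma>: "locally_integrable_borel \<gamma>"
    unfolding \<gamma>_def by (rule locally_integrable_borel_linear) (use gi in auto)
  note um = bounded_borelD(1)[OF b]
  have \<gamma>av: "av ker r \<gamma> x = (\<Sum>i\<in>UNIV. h $ i * av ker r (g i) x)" if r: "r > 0" for r x
  proof -
    have "av ker r \<gamma> x = (LINT z|lborel. (\<Sum>i\<in>UNIV. h $ i * (g i (x + r *\<^sub>R z) * ker z)))"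
      by (simp add: av_def \<gamma>_def sum_distrib_right mult.assoc)
    also have "\<dots> = (\<Sum>i\<in>UNIV. h $ i * av ker r (g i) x)"
      unfolding av_def using av_integrable_local[OF gi test_function_ker r]
      by (subst Bochner_Integration.integral_sum) auto
    finally show ?thesis .
  qed
  have "AE x in lborel. diff h u x - seg h \<gamma> x = 0"
  proof (rule mollifications_eq_0_imp_AE)
    have d: "bounded_borel (diff h u) (2 * M)" by (rule bounded_borel_diff[OF b])
    show "locally_integrable_borel (\<lambda>x. diff h u x - seg h \<gamma> x)"
      by (intro locally_integrable_borel_diff seg_locally_integrable \<gamma> bounded_borel_imp_locally_integrable[OF d])
    fix r :: real and x :: "real^'n" assume r: "r > 0"
    let ?\<psi> = "\<lambda>y::real^'n. ker (inverse r *\<^sub>R (y - x))"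
    have t\<psi>: "test_function ?\<psi>" by (rule test_function_affine_inverse[OF test_function_ker r])
    note \<psi>m = test_function_measurable[OF t\<psi>]
    obtain B where B: "\<And>y. \<bar>?\<psi> y\<bar> \<le> B" using test_function_bounded[OF t\<psi>] by blast
    obtain \<rho> where \<rho>: "\<And>y. norm y \<ge> \<rho> \<Longrightarrow> ?\<psi> y = 0" using test_functionD(2)[OF t\<psi>] by blast
    then have \<rho>': "\<And>y. norm y > \<rho> \<Longrightarrow> ?\<psi> y = 0" by (meson less_imp_le)
    note km = test_function_measurable[OF test_function_ker]
    have der: "((\<lambda>t. av ker r u (x + t *\<^sub>R h)) has_real_derivative av ker r \<gamma> (x + t *\<^sub>R h)) (at t)" for t
    proof -
      have "((\<lambda>t. x + t *\<^sub>R h) has_derivative (\<lambda>\<tau>. \<tau> *\<^sub>R h)) (at t)"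
        by (auto intro!: derivative_eq_intros)
      from has_derivative_compose[OF this av_has_derivative[OF test_function_ker b r]]
      have "((\<lambda>t. av ker r u (x + t *\<^sub>R h)) has_derivative (\<lambda>\<tau>. \<Sum>i\<in>UNIV. (\<tau> *\<^sub>R h) $ i * av ker r (g i) (x + t *\<^sub>R h))) (at t)"
        unfolding av_weak_gradient[OF w um test_function_ker r] .
      then show ?thesis unfolding has_field_derivative_def
        by (rule has_derivative_eq_rhs) (rule ext, simp add: \<gamma>av[OF r] sum_distrib_left sum_distrib_right mult_ac)
    qed
    have hi: "((\<lambda>t. av ker r \<gamma> (x + t *\<^sub>R h)) has_integral av ker r u (x + 1 *\<^sub>R h) - av ker r u (x + 0 *\<^sub>R h)) {0..1}"
      by (intro fundamental_theorem_of_calculus) (use der in \<open>auto simp: has_real_derivative_iff_has_vector_derivative intro: has_vector_derivative_at_within\<close>)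
    have resc: "(LINT y|lborel. \<gamma> (y + t *\<^sub>R h) * ?\<psi> y) = r ^ CARD('n) * av ker r \<gamma> (x + t *\<^sub>R h)" for t
    proof -
      have m: "(\<lambda>y. \<gamma> (y + t *\<^sub>R h)) \<in> borel_measurable borel" using locally_integrable_borelD(1)[OF \<gamma>] by simp
      show ?thesis using av_rescale[OF m km r, of x] by (simp add: av_def add_ac)
    qed
    have si: "set_integrable lborel {0..1} (\<lambda>t. av ker r \<gamma> (x + t *\<^sub>R h))"
    proof -
      have "integrable lborel (\<lambda>t. inverse (r ^ CARD('n)) * (indicator {0..1} t * (LINT y|lborel. \<gamma> (y + t *\<^sub>R h) * ?\<psi> y)))"
        by (intro integrable_mult_right seg_integral(3)[OF \<gamma> \<psi>m B \<rho>'])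
      then show ?thesis unfolding resc set_integrable_def using r by (simp add: mult.left_commute)
    qed
    have "r ^ CARD('n) * av ker r (seg h \<gamma>) x = (LINT y|lborel. seg h \<gamma> y * ?\<psi> y)"
      using av_rescale[OF locally_integrable_borelD(1)[OF seg_locally_integrable[OF \<gamma>]] km r] by simp
    also have "\<dots> = (LINT t|lborel. indicator {0..1} t * (LINT y|lborel. \<gamma> (y + t *\<^sub>R h) * ?\<psi> y))"
      by (rule seg_integral(2)[OF \<gamma> \<psi>m B \<rho>'])
    also have "\<dots> = r ^ CARD('n) * (LINT t:{0..1}|lborel. av ker r \<gamma> (x + t *\<^sub>R h))"
      unfolding resc set_lebesgue_integral_def by (simp add: mult.left_commute)
    also have "(LINT t:{0..1}|lborel. av ker r \<gamma> (x + t *\<^sub>R h)) = integral {0..1} (\<lambda>t. av ker r \<gamma> (x + t *\<^sub>R h))"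
      by (rule set_borel_integral_eq_integral(2)[OF si])
    also have "\<dots> = diff h (av ker r u) x"
      using integral_unique[OF hi] by (simp add: diff_def)
    finally have 1: "av ker r (seg h \<gamma>) x = diff h (av ker r u) x" using r by simp
    have "av ker r (\<lambda>x. diff h u x - seg h \<gamma> x) x = av ker r (diff h u) x - av ker r (seg h \<gamma>) x"
      unfolding av_def left_diff_distrib
      by (intro Bochner_Integration.integral_diff av_integrable_local[OF _ test_function_ker r]
          bounded_borel_imp_locally_integrable[OF d] seg_locally_integrable \<gamma>)
    also have "\<dots> = 0" unfolding 1 av_diff[OF b test_function_integrable[OF test_function_ker]] by simp
    finally show "av ker r (\<lambda>x. diff h u x - seg h \<gamma> x) x = 0" .
  qed
  then show ?thesis unfolding \<gamma>_def by eventually_elim simp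
qed

text \<open>The gradient supplies one power of \<open>norm h\<close>, in local L1; a Lipschitz test
  function will supply a second. Together they compensate the singularity of the nonlocal
  kernel.\<close>

lemma weak_gradient_translation_bound:
  fixes u :: "real^'n::finite \<Rightarrow> real"
  assumes w: "borel_weak_gradient u g" and b: "bounded_borel u M"
  shows "\<exists>J\<ge>0. \<forall>h. norm h \<le> 1 \<longrightarrow> (LINT x|lborel. indicator (cball 0 R) x * \<bar>diff h u x\<bar>) \<le> J * norm h"
proof -
  have gi: "locally_integrable_borel (g i)" for i using w by (auto simp: borel_weak_gradient_def)
  define J where "J = (\<Sum>i\<in>UNIV. LINT x|lborel. indicator (cball 0 (R + 1)) x * \<bar>g i x\<bar>)"
  have "(LINT x|lborel. indicator (cball 0 R) x * \<bar>diff h u x\<bar>) \<le> J * norm h" if h: "norm h \<le> 1" for h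
  proof -
    define \<gamma> where "\<gamma> = (\<lambda>y. \<Sum>i\<in>UNIV. h $ i * g i y)"
    have \<gamma>: "locally_integrable_borel \<gamma>"
      unfolding \<gamma>_def by (rule locally_integrable_borel_linear) (use gi in auto)
    note [measurable] = locally_integrable_borelD(1)[OF seg_locally_integrable[OF \<gamma>]] 
      diff_measurable[OF bounded_borelD(1)[OF b]] locally_integrable_borelD(1)[OF \<gamma>]
    have "(LINT x|lborel. indicator (cball 0 R) x * \<bar>diff h u x\<bar>) = (LINT x|lborel. indicator (cball 0 R) x * \<bar>seg h \<gamma> x\<bar>)"
    proof (rule integral_cong_AE)
      show "AE x in lborel. indicator (cball 0 R) x * \<bar>diff h u x\<bar> = indicator (cball 0 R) x * \<bar>seg h \<gamma> x\<bar>"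
        using weak_gradient_segment[OF w b, of h] unfolding \<gamma>_def by eventually_elim simp
    qed (auto intro!: borel_measurable_times borel_measurable_indicator borel_measurable_abs)
    also have "\<dots> \<le> (LINT x|lborel. indicator (cball 0 (R + 1)) x * \<bar>\<gamma> x\<bar>)"
      by (rule seg_L1_bound[OF \<gamma> h])
    also have "\<dots> \<le> (LINT x|lborel. (\<Sum>i\<in>UNIV. norm h * (indicator (cball 0 (R + 1)) x * \<bar>g i x\<bar>)))"
    proof (rule integral_mono)
      show "integrable lborel (\<lambda>x. indicator (cball 0 (R + 1)) x * \<bar>\<gamma> x\<bar>)"
        using locally_integrable_borelD(2)[OF locally_integrable_abs[OF \<gamma>], of "R + 1"] by (simp add: set_integrable_def)
      show "integrable lborel (\<lambda>x. \<Sum>i\<in>UNIV. norm h * (indicator (cball 0 (R + 1)) x * \<bar>g i x\<bar>))"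
        using locally_integrable_borelD(2)[OF locally_integrable_abs[OF gi], of "R + 1"]
        by (intro Bochner_Integration.integrable_sum integrable_mult_right) (simp add: set_integrable_def)
      fix x
      have "\<bar>\<gamma> x\<bar> \<le> (\<Sum>i\<in>UNIV. norm h * \<bar>g i x\<bar>)"
        unfolding \<gamma>_def
        by (rule order_trans[OF sum_abs]) (auto simp: abs_mult intro!: sum_mono mult_right_mono component_le_norm_cart)
      then show "indicator (cball 0 (R + 1)) x * \<bar>\<gamma> x\<bar> \<le> (\<Sum>i\<in>UNIV. norm h * (indicator (cball 0 (R + 1)) x * \<bar>g i x\<bar>))"
        by (simp add: indicator_def)
    qed
    also have "\<dots> = J * norm h"
      using locally_integrable_borelD(2)[OF locally_integrable_abs[OF gi], of "R + 1"]
      by (subst Bochner_Integration.integral_sum) (auto simp: set_integrable_def J_def sum_distrib_left mult.commute)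
    finally show ?thesis .
  qed
  moreover have "J \<ge> 0" unfolding J_def by (intro sum_nonneg integral_nonneg_AE AE_I2) simp
  ultimately show ?thesis by blast
qed

section \<open>The nonlocal form\<close>

definition nker :: "real \<Rightarrow> real^'n::finite \<Rightarrow> real" where
  "nker s h = 1 / norm h powr (real CARD('n) + 2 * s)"

lemma nker_measurable[measurable]: "nker s \<in> borel_measurable borel"
  unfolding nker_def[abs_def] by measurable

lemma nker_nonneg: "nker s h \<ge> 0"
  by (simp add: nker_def)

text \<open>The exponent \<open>1 - 2 * s\<close> is integrable at 0 because s < 1, and
  \<open>- 2 * s - 1\<close> at infinity because s > 0.\<close>

lemma nn_integral_powr_bounds:
  fixes s :: real
  assumes "0 < s" "s < 1"
  shows "(\<integral>\<^sup>+ t. ennreal (indicator {0<..} t * (min 1 (t\<^sup>2) * t powr (- 2 * s - 1))) \<partial>lborel) < \<infinity>"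
proof -
  have 1: "(\<integral>\<^sup>+ t. ennreal (indicator {0..1} t * t powr (1 - 2 * s)) \<partial>lborel) = ennreal (1 powr (1 - 2 * s + 1) / (1 - 2 * s + 1))"
  proof (rule nn_integral_has_integral_lborel)
    have "((\<lambda>t. t powr (1 - 2 * s)) has_integral (1 powr (1 - 2 * s + 1) / (1 - 2 * s + 1))) {0..1}"
      using assms by (intro has_integral_powr_from_0) auto
    then have "((\<lambda>t. if t \<in> {0..1} then t powr (1 - 2 * s) else 0) has_integral (1 powr (1 - 2 * s + 1) / (1 - 2 * s + 1))) UNIV"
      by (simp only: has_integral_restrict_UNIV)
    then show "((\<lambda>t. indicator {0..1} t * t powr (1 - 2 * s)) has_integral (1 powr (1 - 2 * s + 1) / (1 - 2 * s + 1))) UNIV"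
      by (rule has_integral_eq[rotated]) (simp add: indicator_def)
  qed (auto simp: indicator_def)
  have 2: "(\<integral>\<^sup>+ t. ennreal (indicator {1..} t * t powr (- 2 * s - 1)) \<partial>lborel) = ennreal (- (1 powr (- 2 * s - 1 + 1)) / (- 2 * s - 1 + 1))"
  proof (rule nn_integral_has_integral_lborel)
    have "((\<lambda>t. t powr (- 2 * s - 1)) has_integral (- (1 powr (- 2 * s - 1 + 1)) / (- 2 * s - 1 + 1))) {1..}"
      using assms by (intro has_integral_powr_to_inf) auto
    then have "((\<lambda>t. if t \<in> {1..} then t powr (- 2 * s - 1) else 0) has_integral (- (1 powr (- 2 * s - 1 + 1)) / (- 2 * s - 1 + 1))) UNIV"
      by (simp only: has_integral_restrict_UNIV)
    then show "((\<lambda>t. indicator {1..} t * t powr (- 2 * s - 1)) has_integral (- (1 powr (- 2 * s - 1 + 1)) / (- 2 * s - 1 + 1))) UNIV"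
      by (rule has_integral_eq[rotated]) (simp add: indicator_def)
  qed (auto simp: indicator_def)
  have "(\<integral>\<^sup>+ t. ennreal (indicator {0<..} t * (min 1 (t\<^sup>2) * t powr (- 2 * s - 1))) \<partial>lborel)
      \<le> (\<integral>\<^sup>+ t. ennreal (indicator {0..1} t * t powr (1 - 2 * s)) + ennreal (indicator {1..} t * t powr (- 2 * s - 1)) \<partial>lborel)"
  proof (intro nn_integral_mono)
    fix t :: real
    have "indicator {0<..} t * (min 1 (t\<^sup>2) * t powr (- 2 * s - 1)) \<le> indicator {0..1} t * t powr (1 - 2 * s) + indicator {1..} t * t powr (- 2 * s - 1)"
    proof (cases "0 < t")
      case t: True
      show ?thesis
      proof (cases "t \<le> 1")
        case True
        have "min 1 (t\<^sup>2) * t powr (- 2 * s - 1) \<le> t\<^sup>2 * t powr (- 2 * s - 1)" by (intro mult_right_mono) auto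
        also have "\<dots> = t powr (1 - 2 * s)"
        proof -
          have "t\<^sup>2 = t powr 2" using t by (simp add: powr_numeral)
          then show ?thesis by (simp add: powr_add[symmetric])
        qed
        finally show ?thesis using t True by (auto simp: indicator_def intro: add_increasing2)
      next
        case False
        have "min 1 (t\<^sup>2) * t powr (- 2 * s - 1) \<le> 1 * t powr (- 2 * s - 1)" by (intro mult_right_mono) auto
        then show ?thesis using t False by (auto simp: indicator_def)
      qed
    qed (simp add: indicator_def)
    then show "ennreal (indicator {0<..} t * (min 1 (t\<^sup>2) * t powr (- 2 * s - 1))) \<le> ennreal (indicator {0..1} t * t powr (1 - 2 * s)) + ennreal (indicator {1..} t * t powr (- 2 * s - 1))"
      by (subst ennreal_plus[symmetric]) (auto simp: indicator_def intro: ennreal_leI)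
  qed
  also have "\<dots> = (\<integral>\<^sup>+ t. ennreal (indicator {0..1} t * t powr (1 - 2 * s)) \<partial>lborel) + (\<integral>\<^sup>+ t. ennreal (indicator {1..} t * t powr (- 2 * s - 1)) \<partial>lborel)"
    by (rule nn_integral_add) measurable
  also have "\<dots> < \<infinity>" unfolding 1 2 by simp
  finally show ?thesis .
qed

text \<open>The integrand is at most a constant times the integral of its radial profile over \<open>t > norm h\<close>; exchanging the
  two integrals leaves a one-dimensional integral.\<close>

lemma nker_truncated_integrable:
  assumes s: "0 < s" "s < 1"
  shows "integrable lborel (\<lambda>h::real^'n::finite. min 1 ((norm h)\<^sup>2) * nker s h)"
proof -
  define N where "N = real CARD('n)"
  define V where "V = unit_ball_vol N"
  define m where "m = (\<lambda>t::real. min 1 (t\<^sup>2) * t powr (- N - 2 * s - 1))"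
  \<comment> \<open>The profile will be compared with its size at radius 2 \<rho>; this constant
    undoes the resulting powers of 2.\<close>
  define c where "c = 2 powr (N + 2 * s + 1)"
  have m0: "m t \<ge> 0" for t by (simp add: m_def)
  have [measurable]: "m \<in> borel_measurable borel" unfolding m_def by measurable
  have N0: "N \<ge> 0" by (simp add: N_def)
  have pt: "ennreal (min 1 ((norm h)\<^sup>2) * nker s h) \<le> ennreal c * (\<integral>\<^sup>+ t. ennreal (m t) * indicator {p. norm (snd p) < fst p} (t, h) \<partial>lborel)" for h :: "real^'n"
  proof (cases "h = 0")
    case True then show ?thesis by simp
  next
    case False
    define \<rho> where "\<rho> = norm h"
    have \<rho>: "\<rho> > 0" using False by (simp add: \<rho>_def)
    \<comment> \<open>Between \<rho> and 2 \<rho>, an interval of length \<rho>, the profile is at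
      least this constant, and the integral of the constant is the kernel divided by c.\<close>
    have le: "min 1 (\<rho>\<^sup>2) * (2 * \<rho>) powr (- N - 2 * s - 1) \<le> m t" if "\<rho> < t" "t \<le> 2 * \<rho>" for t
      unfolding m_def
    proof (intro mult_mono)
      show "min 1 (\<rho>\<^sup>2) \<le> min 1 (t\<^sup>2)" using that \<rho> by (intro min.mono power_mono) auto
      show "(2 * \<rho>) powr (- N - 2 * s - 1) \<le> t powr (- N - 2 * s - 1)"
        using that \<rho> N0 s by (intro powr_mono2') auto
    qed auto
    have "min 1 (\<rho>\<^sup>2) * nker s h = c * (min 1 (\<rho>\<^sup>2) * (2 * \<rho>) powr (- N - 2 * s - 1) * \<rho>)"
    proof -
      have "(2 * \<rho>) powr (- N - 2 * s - 1) * \<rho> = (2 powr (- N - 2 * s - 1) * \<rho> powr (- N - 2 * s - 1)) * \<rho> powr 1"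
        using \<rho> by (simp add: powr_mult)
      also have "\<dots> = 2 powr (- N - 2 * s - 1) * \<rho> powr (- N - 2 * s)"
        unfolding mult.assoc powr_add[symmetric] by simp
      finally have "c * ((2 * \<rho>) powr (- N - 2 * s - 1) * \<rho>) = (c * 2 powr (- N - 2 * s - 1)) * \<rho> powr (- N - 2 * s)"
        by (simp add: mult.assoc)
      also have "c * 2 powr (- N - 2 * s - 1) = 1" by (simp add: c_def powr_add[symmetric])
      also have "\<rho> powr (- N - 2 * s) = nker s h"
      proof -
        have "\<rho> powr (- N - 2 * s) = \<rho> powr (- (N + 2 * s))" by simp
        also have "\<dots> = nker s h" unfolding powr_minus by (simp add: nker_def \<rho>_def N_def divide_inverse)
        finally show ?thesis .
      qed
      finally have "c * ((2 * \<rho>) powr (- N - 2 * s - 1) * \<rho>) = nker s h" by simp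
      then show ?thesis by (metis mult.assoc mult.left_commute)
    qed
    also have "ennreal \<dots> = ennreal c * (\<integral>\<^sup>+ t. ennreal (min 1 (\<rho>\<^sup>2) * (2 * \<rho>) powr (- N - 2 * s - 1)) * indicator {\<rho><..2 * \<rho>} t \<partial>lborel)"
      using \<rho> by (subst nn_integral_cmult_indicator) (auto simp: ennreal_mult[symmetric] c_def mult.assoc)
    also have "\<dots> \<le> ennreal c * (\<integral>\<^sup>+ t. ennreal (m t) * indicator {p. norm (snd p) < fst p} (t, h) \<partial>lborel)"
      by (intro mult_left_mono nn_integral_mono) (auto simp: indicator_def \<rho>_def[symmetric] intro!: ennreal_leI le)
    finally show ?thesis by (simp add: \<rho>_def)
  qed
  have "(\<integral>\<^sup>+ h. ennreal (min 1 ((norm (h::real^'n))\<^sup>2) * nker s h) \<partial>lborel)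
     \<le> (\<integral>\<^sup>+ h. ennreal c * (\<integral>\<^sup>+ t. ennreal (m t) * indicator {p. norm (snd p) < fst p} (t, h::real^'n) \<partial>lborel) \<partial>lborel)"
    by (intro nn_integral_mono pt)
  also have "\<dots> = ennreal c * (\<integral>\<^sup>+ h. (\<integral>\<^sup>+ t. ennreal (m t) * indicator {p. norm (snd p) < fst p} (t, h::real^'n) \<partial>lborel) \<partial>lborel)"
    by (rule nn_integral_cmult) measurable
  also have "(\<integral>\<^sup>+ h. (\<integral>\<^sup>+ t. ennreal (m t) * indicator {p. norm (snd p) < fst p} (t, h::real^'n) \<partial>lborel) \<partial>lborel)
      = (\<integral>\<^sup>+ t. (\<integral>\<^sup>+ h. ennreal (m t) * indicator {p. norm (snd p) < fst p} (t, h::real^'n) \<partial>lborel) \<partial>lborel)"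
    by (rule lborel_pair.Fubini') measurable
  also have "\<dots> = (\<integral>\<^sup>+ t. ennreal V * ennreal (indicator {0<..} t * (min 1 (t\<^sup>2) * t powr (- 2 * s - 1))) \<partial>lborel)"
  proof (intro nn_integral_cong)
    fix t :: real
    have "(\<integral>\<^sup>+ h. ennreal (m t) * indicator {p. norm (snd p) < fst p} (t, h::real^'n) \<partial>lborel)
        = (\<integral>\<^sup>+ h. ennreal (m t) * indicator (ball (0::real^'n) t) h \<partial>lborel)"
      by (intro nn_integral_cong) (simp add: indicator_def)
    also have "\<dots> = ennreal (m t) * emeasure lborel (ball (0::real^'n) t)"
      by (intro nn_integral_cmult_indicator) auto
    also have "\<dots> = ennreal V * ennreal (indicator {0<..} t * (min 1 (t\<^sup>2) * t powr (- 2 * s - 1)))"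
    proof (cases "t > 0")
      case True
      have "emeasure lborel (ball (0::real^'n) t) = ennreal (V * t ^ CARD('n))"
        using True by (subst emeasure_ball) (auto simp: V_def N_def)
      moreover have "t ^ CARD('n) = t powr N" using True by (simp add: N_def powr_realpow)
      moreover have "m t * (V * t powr N) = V * (min 1 (t\<^sup>2) * t powr (- 2 * s - 1))"
        by (simp add: m_def powr_add[symmetric] mult_ac)
      moreover have "V \<ge> 0" using N0 by (simp add: V_def unit_ball_vol_nonneg)
      ultimately show ?thesis using True m0 by (simp add: ennreal_mult[symmetric])
    next
      case False
      then have e: "ball (0::real^'n) t = {}" by simp
      show ?thesis unfolding e using False by simp
    qed
    finally show "(\<integral>\<^sup>+ h. ennreal (m t) * indicator {p. norm (snd p) < fst p} (t, h::real^'n) \<partial>lborel)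
      = ennreal V * ennreal (indicator {0<..} t * (min 1 (t\<^sup>2) * t powr (- 2 * s - 1)))" .
  qed
  also have "\<dots> = ennreal V * (\<integral>\<^sup>+ t. ennreal (indicator {0<..} t * (min 1 (t\<^sup>2) * t powr (- 2 * s - 1))) \<partial>lborel)"
    by (rule nn_integral_cmult) measurable
  also have "ennreal c * (ennreal V * (\<integral>\<^sup>+ t. ennreal (indicator {0<..} t * (min 1 (t\<^sup>2) * t powr (- 2 * s - 1))) \<partial>lborel)) < \<infinity>"
    using nn_integral_powr_bounds[OF s] by (simp only: infinity_ennreal_def ennreal_mult_less_top ennreal_less_top simp_thms)
  finally have "(\<integral>\<^sup>+ h. ennreal (min 1 ((norm (h::real^'n))\<^sup>2) * nker s h) \<partial>lborel) < \<infinity>" .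
  then show ?thesis
    by (intro integrableI_nonneg AE_I2 mult_nonneg_nonneg nker_nonneg) auto
qed

lemma integral_abs_diff_bound:
  fixes f :: "real^'n::finite \<Rightarrow> real"
  assumes f: "integrable lborel f"
  shows "(LINT z|lborel. \<bar>diff a f z\<bar>) \<le> 2 * (LINT z|lborel. \<bar>f z\<bar>)"
proof -
  have m: "f \<in> borel_measurable borel" using f by auto
  have i: "integrable lborel (\<lambda>z. f (z + a))" using lborel_translate(2)[OF m] f by blast
  have "(LINT z|lborel. \<bar>diff a f z\<bar>) \<le> (LINT z|lborel. \<bar>f (z + a)\<bar> + \<bar>f z\<bar>)"
    using f i diff_integrable[OF f, of a] by (intro integral_mono) (auto simp: diff_def)
  also have "\<dots> = (LINT z|lborel. \<bar>f (z + a)\<bar>) + (LINT z|lborel. \<bar>f z\<bar>)" using f i by simp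
  also have "(LINT z|lborel. \<bar>f (z + a)\<bar>) = (LINT z|lborel. \<bar>f z\<bar>)"
    using m by (intro lborel_translate(1)[of "\<lambda>z. \<bar>f z\<bar>"]) measurable
  finally show ?thesis by simp
qed

text \<open>The second difference is 2 \<phi>(x) - \<phi>(x + h) - \<phi>(x - h), so its integral
  over h against the kernel is a multiple of the fractional Laplacian of \<phi>. Its L1 norm is
  quadratic in \<open>norm h\<close> by smoothness and at most 4 times that of \<phi>, which matches
  the truncated kernel.\<close>

lemma diff_diff_kernel_integrable:
  fixes \<phi> :: "real^'n::finite \<Rightarrow> real"
  assumes s: "0 < s" "s < 1" and t: "test_function \<phi>"
  shows "integrable (lborel \<Otimes>\<^sub>M lborel) (\<lambda>p. diff (fst p) (diff (- fst p) \<phi>) (snd p) * nker s (fst p))"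
proof -
  have [measurable]: "\<phi> \<in> borel_measurable borel" by (rule test_function_measurable[OF t])
  note i = test_function_integrable[OF t]
  obtain C where C: "C \<ge> 0" "\<And>a b. (LINT z|lborel. \<bar>diff a (diff b \<phi>) z\<bar>) \<le> C * norm a * norm b"
    using test_function_L1_diff2[OF t] by blast
  define D where "D = (LINT z|lborel. \<bar>\<phi> z\<bar>)"
  have D0: "D \<ge> 0" by (simp add: D_def)
  show ?thesis
  proof (rule pair_integrableI[where W="\<lambda>h. (C + 4 * D) * (min 1 ((norm h)\<^sup>2) * nker s h)"])
    show "(\<lambda>p. diff (fst p) (diff (- fst p) \<phi>) (snd p) * nker s (fst p)) \<in> borel_measurable (lborel \<Otimes>\<^sub>M lborel)"
      unfolding diff_def by measurable
    fix h :: "real^'n"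
    show "integrable lborel (\<lambda>x. diff (fst (h, x)) (diff (- fst (h, x)) \<phi>) (snd (h, x)) * nker s (fst (h, x)))"
      using diff_integrable[OF diff_integrable[OF i]] by simp
    have "(LINT z|lborel. \<bar>diff h (diff (- h) \<phi>) z\<bar>) \<le> 2 * (2 * D)"
      unfolding D_def using integral_abs_diff_bound[OF diff_integrable[OF i], of h "-h"] integral_abs_diff_bound[OF i, of "-h"] by linarith
    moreover have "(LINT z|lborel. \<bar>diff h (diff (- h) \<phi>) z\<bar>) \<le> C * (norm h)\<^sup>2"
      using C(2)[of h "-h"] by (simp add: power2_eq_square mult.assoc)
    ultimately have "(LINT z|lborel. \<bar>diff h (diff (- h) \<phi>) z\<bar>) \<le> (C + 4 * D) * min 1 ((norm h)\<^sup>2)"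
      using C(1) D0 by (auto simp: min_def algebra_simps intro: add_increasing add_increasing2)
    then have "(LINT z|lborel. \<bar>diff h (diff (- h) \<phi>) z\<bar>) * nker s h \<le> (C + 4 * D) * min 1 ((norm h)\<^sup>2) * nker s h"
      by (intro mult_right_mono nker_nonneg)
    then show "(LINT x|lborel. \<bar>diff (fst (h, x)) (diff (- fst (h, x)) \<phi>) (snd (h, x)) * nker s (fst (h, x))\<bar>) \<le> (C + 4 * D) * (min 1 ((norm h)\<^sup>2) * nker s h)"
      by (simp add: abs_mult nker_nonneg mult.assoc)
  qed (intro integrable_mult_right nker_truncated_integrable s)
qed

text \<open>For \<open>norm h \<le> 1\<close> the weak gradient gives one power of
  \<open>norm h\<close> and \<phi> the other; for larger steps the bound on u is enough. Boundedness
  of u alone would leave a single power near the diagonal.\<close>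

lemma diff_product_kernel_integrable:
  fixes \<phi> u :: "real^'n::finite \<Rightarrow> real"
  assumes s: "0 < s" "s < 1" and t: "test_function \<phi>"
    and w: "borel_weak_gradient u g" and b: "bounded_borel u M"
  shows "integrable (lborel \<Otimes>\<^sub>M lborel) (\<lambda>p. diff (fst p) u (snd p) * diff (fst p) \<phi> (snd p) * nker s (fst p))"
proof -
  have [measurable]: "\<phi> \<in> borel_measurable borel" "u \<in> borel_measurable borel"
    using test_function_measurable[OF t] bounded_borelD(1)[OF b] by auto
  note i = test_function_integrable[OF t]
  obtain \<rho> where \<rho>: "\<rho> > 0" "\<And>z. norm z \<ge> \<rho> \<Longrightarrow> \<phi> z = 0" using test_functionD(2)[OF t] by blast
  obtain L where L: "L \<ge> 0" "\<And>a x. \<bar>diff a \<phi> x\<bar> \<le> L * norm a" using test_function_Lipschitz[OF t] by blast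
  \<comment> \<open>The radius \<open>\<rho> + 1\<close> covers the support of
    \<open>diff h \<phi>\<close> for every step with \<open>norm h \<le> 1\<close>.\<close>
  obtain J where J: "J \<ge> 0" "\<And>h. norm h \<le> 1 \<Longrightarrow> (LINT x|lborel. indicator (cball 0 (\<rho> + 1)) x * \<bar>diff h u x\<bar>) \<le> J * norm h"
    using weak_gradient_translation_bound[OF w b] by blast
  define D where "D = (LINT z|lborel. \<bar>\<phi> z\<bar>)"
  have D0: "D \<ge> 0" by (simp add: D_def)
  have M0: "M \<ge> 0" by (rule bounded_borelD(3)[OF b])
  have sec: "integrable lborel (\<lambda>x. diff h u x * diff h \<phi> x)" for h
    using av_integrable[OF bounded_borel_diff[OF b] diff_integrable[OF i], of h 0 1 h] by simp
  show ?thesis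
  proof (rule pair_integrableI[where W="\<lambda>h. (L * J + 4 * M * D) * (min 1 ((norm h)\<^sup>2) * nker s h)"])
    show "(\<lambda>p. diff (fst p) u (snd p) * diff (fst p) \<phi> (snd p) * nker s (fst p)) \<in> borel_measurable (lborel \<Otimes>\<^sub>M lborel)"
      unfolding diff_def by measurable
    fix h :: "real^'n"
    show "integrable lborel (\<lambda>x. diff (fst (h, x)) u (snd (h, x)) * diff (fst (h, x)) \<phi> (snd (h, x)) * nker s (fst (h, x)))"
      using sec by simp
    have "(LINT x|lborel. \<bar>diff h u x * diff h \<phi> x\<bar>) \<le> (L * J + 4 * M * D) * min 1 ((norm h)\<^sup>2)"
    proof (cases "norm h \<le> 1")
      case True
      have d: "bounded_borel (diff h u) (2 * M)" by (rule bounded_borel_diff[OF b])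
      have di: "integrable lborel (\<lambda>x. indicator (cball 0 (\<rho> + 1)) x * \<bar>diff h u x\<bar>)"
        using locally_integrable_borelD(2)[OF locally_integrable_abs[OF bounded_borel_imp_locally_integrable[OF d]], of "\<rho> + 1"]
        by (simp add: set_integrable_def)
      have "(LINT x|lborel. \<bar>diff h u x * diff h \<phi> x\<bar>) \<le> (LINT x|lborel. L * norm h * (indicator (cball 0 (\<rho> + 1)) x * \<bar>diff h u x\<bar>))"
      proof (rule integral_mono[OF integrable_abs[OF sec] integrable_mult_right[OF di]])
        fix x
        show "\<bar>diff h u x * diff h \<phi> x\<bar> \<le> L * norm h * (indicator (cball 0 (\<rho> + 1)) x * \<bar>diff h u x\<bar>)"
        proof (cases "norm x \<le> \<rho> + 1")
          case True
          have "\<bar>diff h u x\<bar> * \<bar>diff h \<phi> x\<bar> \<le> \<bar>diff h u x\<bar> * (L * norm h)" by (intro mult_left_mono L) auto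
          then show ?thesis using True by (simp add: abs_mult mult_ac)
        next
          case False
          then have "norm (x + h) \<ge> \<rho>" "norm x \<ge> \<rho>" using \<open>norm h \<le> 1\<close> norm_triangle_ineq4[of "x + h" h] by auto
          then have "diff h \<phi> x = 0" using \<rho>(2) by (simp add: diff_def)
          then show ?thesis using L(1) by simp
        qed
      qed
      also have "\<dots> = L * norm h * (LINT x|lborel. indicator (cball 0 (\<rho> + 1)) x * \<bar>diff h u x\<bar>)" by simp
      also have "\<dots> \<le> L * norm h * (J * norm h)" using L(1) J(2)[OF True] by (intro mult_left_mono) auto
      also have "\<dots> = (L * J) * (norm h)\<^sup>2" by (simp add: power2_eq_square)
      also have "\<dots> \<le> (L * J + 4 * M * D) * min 1 ((norm h)\<^sup>2)"
      proof -
        have "min 1 ((norm h)\<^sup>2) = (norm h)\<^sup>2" using power_le_one[of "norm h" 2] True by (simp add: min_absorb2)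
        then show ?thesis using M0 D0 by (simp add: mult_right_mono)
      qed
      finally show ?thesis .
    next
      case False
      have "(LINT x|lborel. \<bar>diff h u x * diff h \<phi> x\<bar>) \<le> (LINT x|lborel. (2 * M) * \<bar>diff h \<phi> x\<bar>)"
      proof (rule integral_mono[OF integrable_abs[OF sec]])
        show "integrable lborel (\<lambda>x. (2 * M) * \<bar>diff h \<phi> x\<bar>)" by (intro integrable_mult_right integrable_abs diff_integrable i)
        show "\<bar>diff h u x * diff h \<phi> x\<bar> \<le> (2 * M) * \<bar>diff h \<phi> x\<bar>" for x
          unfolding abs_mult by (intro mult_right_mono bounded_borelD(2)[OF bounded_borel_diff[OF b]]) auto
      qed
      also have "\<dots> = (2 * M) * (LINT x|lborel. \<bar>diff h \<phi> x\<bar>)" by simp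
      also have "\<dots> \<le> (2 * M) * (2 * D)" unfolding D_def using M0 by (intro mult_left_mono integral_abs_diff_bound i) auto
      also have "\<dots> \<le> (L * J + 4 * M * D) * min 1 ((norm h)\<^sup>2)"
      proof -
        have "min 1 ((norm h)\<^sup>2) = 1" using False by (simp add: min_def)
        then show ?thesis using L(1) J(1) by simp
      qed
      finally show ?thesis .
    qed
    then have "(LINT x|lborel. \<bar>diff h u x * diff h \<phi> x\<bar>) * nker s h \<le> (L * J + 4 * M * D) * min 1 ((norm h)\<^sup>2) * nker s h"
      by (intro mult_right_mono nker_nonneg)
    then show "(LINT x|lborel. \<bar>diff (fst (h, x)) u (snd (h, x)) * diff (fst (h, x)) \<phi> (snd (h, x)) * nker s (fst (h, x))\<bar>)
        \<le> (L * J + 4 * M * D) * (min 1 ((norm h)\<^sup>2) * nker s h)"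
      by (simp only: fst_conv snd_conv abs_mult[of _ "nker s h"] abs_of_nonneg[OF nker_nonneg]
          integral_mult_left_zero mult.assoc[symmetric])
  qed (intro integrable_mult_right nker_truncated_integrable s)
qed

text \<open>The kernel is cut off near the origin, because the two halves of the product are not separately integrable
  against it.\<close>

lemma nonlocal_integration_by_parts:
  fixes \<phi> u :: "real^'n::finite \<Rightarrow> real"
  assumes s: "0 < s" "s < 1" and t: "test_function \<phi>"
    and w: "borel_weak_gradient u g" and b: "bounded_borel u M"
  shows "(LINT p|(lborel \<Otimes>\<^sub>M lborel). diff (fst p) u (snd p) * diff (fst p) \<phi> (snd p) * nker s (fst p))
    = (LINT p|(lborel \<Otimes>\<^sub>M lborel). u (snd p) * (diff (fst p) (diff (- fst p) \<phi>) (snd p) * nker s (fst p)))"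
proof -
  have [measurable]: "\<phi> \<in> borel_measurable borel" "u \<in> borel_measurable borel"
    using test_function_measurable[OF t] bounded_borelD(1)[OF b] by auto
  note i = test_function_integrable[OF t]
  define D where "D = (LINT z|lborel. \<bar>\<phi> z\<bar>)"
  define k where "k = (\<lambda>(n::nat) (h::real^'n). if norm h > inverse (real (Suc n)) then nker s h else 0)"
  have k0: "k n h \<ge> 0" and kle: "k n h \<le> nker s h" for n h by (auto simp: k_def nker_nonneg)
  have [measurable]: "k n \<in> borel_measurable borel" for n unfolding k_def by measurable
  \<comment> \<open>Outside the ball of radius 1 / (n + 1) the factor
    \<open>min 1 ((norm h)\<^sup>2)\<close> is bounded below, so a multiple of the truncated kernel
    dominates.\<close>
  have kint: "integrable lborel (k n)" for n
  proof (rule Bochner_Integration.integrable_bound[OF integrable_mult_right[OF nker_truncated_integrable[OF s], of "(real (Suc n))\<^sup>2"]])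
    show "AE h in lborel. norm (k n h) \<le> norm ((real (Suc n))\<^sup>2 * (min 1 ((norm h)\<^sup>2) * nker s h))"
    proof (rule AE_I2)
      fix h :: "real^'n"
      show "norm (k n h) \<le> norm ((real (Suc n))\<^sup>2 * (min 1 ((norm h)\<^sup>2) * nker s h))"
      proof (cases "norm h > inverse (real (Suc n))")
        case True
        have "1 \<le> (real (Suc n))\<^sup>2 * min 1 ((norm h)\<^sup>2)"
        proof (cases "(norm h)\<^sup>2 \<ge> 1")
          case True
          then show ?thesis by (simp add: min_def one_le_power)
        next
          case False
          have "1 \<le> real (Suc n) * norm h" using True by (simp add: field_simps)
          then have "1 \<le> (real (Suc n) * norm h)\<^sup>2" by (rule one_le_power)
          then show ?thesis using False by (simp only: power_mult_distrib min_def) simp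
        qed
        then have "1 * nker s h \<le> (real (Suc n))\<^sup>2 * min 1 ((norm h)\<^sup>2) * nker s h"
          by (intro mult_right_mono nker_nonneg)
        then show ?thesis using True nker_nonneg[of s h] by (simp add: k_def abs_mult mult.assoc del: of_nat_Suc)
      qed (simp add: k_def)
    qed
  qed measurable
  have klim: "(\<lambda>n. k n h) \<longlonglongrightarrow> nker s h" for h
  proof (cases "h = 0")
    case False
    then have "\<forall>\<^sub>F n in sequentially. inverse (real (Suc n)) < norm h"
      using LIMSEQ_inverse_real_of_nat by (intro order_tendstoD) auto
    then have "\<forall>\<^sub>F n in sequentially. k n h = nker s h" by eventually_elim (simp add: k_def)
    then show ?thesis by (rule tendsto_eventually)
  qed (simp add: k_def nker_def)
  have M0: "M \<ge> 0" by (rule bounded_borelD(3)[OF b])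
  have Ai: "integrable (lborel \<Otimes>\<^sub>M lborel) (\<lambda>p. k n (fst p) * (v (snd p) * diff (\<sigma> (fst p)) \<phi> (snd p)))"
    if v: "bounded_borel v M'" and [measurable]: "\<sigma> \<in> borel_measurable borel" for n v M' and \<sigma> :: "real^'n \<Rightarrow> real^'n"
  proof (rule pair_integrableI[where W="\<lambda>h. k n h * (M' * (2 * D))"])
    have [measurable]: "v \<in> borel_measurable borel" by (rule bounded_borelD(1)[OF v])
    show "(\<lambda>p. k n (fst p) * (v (snd p) * diff (\<sigma> (fst p)) \<phi> (snd p))) \<in> borel_measurable (lborel \<Otimes>\<^sub>M lborel)"
      unfolding diff_def by measurable
    fix h :: "real^'n"
    have sec: "integrable lborel (\<lambda>x. v x * diff a \<phi> x)" for a
      using av_integrable[OF v diff_integrable[OF i], of 0 1 a] by simp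
    show "integrable lborel (\<lambda>x. k n (fst (h, x)) * (v (snd (h, x)) * diff (\<sigma> (fst (h, x))) \<phi> (snd (h, x))))"
      using sec by simp
    have "(LINT x|lborel. \<bar>v x * diff (\<sigma> h) \<phi> x\<bar>) \<le> (LINT x|lborel. M' * \<bar>diff (\<sigma> h) \<phi> x\<bar>)"
      by (intro integral_mono integrable_abs sec integrable_mult_right diff_integrable i)
        (auto simp: abs_mult intro!: mult_right_mono bounded_borelD(2)[OF v])
    also have "\<dots> \<le> M' * (2 * D)" unfolding D_def using integral_abs_diff_bound[OF i] bounded_borelD(3)[OF v]
      by (auto intro: mult_left_mono)
    finally show "(LINT x|lborel. \<bar>k n (fst (h, x)) * (v (snd (h, x)) * diff (\<sigma> (fst (h, x))) \<phi> (snd (h, x)))\<bar>) \<le> k n h * (M' * (2 * D))"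
      using k0[of n h] by (simp add: abs_mult mult_left_mono)
  qed (intro integrable_mult_left kint)
  have eq: "(LINT p|(lborel \<Otimes>\<^sub>M lborel). diff (fst p) u (snd p) * diff (fst p) \<phi> (snd p) * k n (fst p))
    = (LINT p|(lborel \<Otimes>\<^sub>M lborel). u (snd p) * (diff (fst p) (diff (- fst p) \<phi>) (snd p) * k n (fst p)))" for n
  proof -
    define A where "A = (\<lambda>p. k n (fst p) * (u (snd p) * diff (fst p) \<phi> (snd p)))"
    define B where "B = (\<lambda>p. k n (fst p) * (u (snd p) * diff (- fst p) \<phi> (snd p)))"
    have A: "integrable (lborel \<Otimes>\<^sub>M lborel) A" unfolding A_def using Ai[OF b, of "\<lambda>h. h"] by simp
    have B: "integrable (lborel \<Otimes>\<^sub>M lborel) B" unfolding B_def using Ai[OF b, of "\<lambda>h. - h"] by simp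
    have Bm: "B \<in> borel_measurable (lborel \<Otimes>\<^sub>M lborel)" using B by auto
    \<comment> \<open>Translating x by h turns the part with u(x + h) into a difference of \<phi>
      with step - h; the two parts then add up to the second difference.\<close>
    have sh: "B (fst p, snd p + fst p) = - (k n (fst p) * (u (snd p + fst p) * diff (fst p) \<phi> (snd p)))" for p
      by (simp add: B_def diff_def algebra_simps)
    have B': "integrable (lborel \<Otimes>\<^sub>M lborel) (\<lambda>p. B (fst p, snd p + fst p))"
      and BB: "(LINT p|(lborel \<Otimes>\<^sub>M lborel). B (fst p, snd p + fst p)) = (LINT p|(lborel \<Otimes>\<^sub>M lborel). B p)"
      using lborel_shear_integral[where L="\<lambda>h. h", OF _ Bm] B by auto
    have "(LINT p|(lborel \<Otimes>\<^sub>M lborel). diff (fst p) u (snd p) * diff (fst p) \<phi> (snd p) * k n (fst p))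
        = (LINT p|(lborel \<Otimes>\<^sub>M lborel). - B (fst p, snd p + fst p) - A p)"
    proof (intro Bochner_Integration.integral_cong refl)
      fix p
      show "diff (fst p) u (snd p) * diff (fst p) \<phi> (snd p) * k n (fst p) = - B (fst p, snd p + fst p) - A p"
        unfolding sh A_def diff_def by (simp add: algebra_simps)
    qed
    also have "\<dots> = - (LINT p|(lborel \<Otimes>\<^sub>M lborel). B p) - (LINT p|(lborel \<Otimes>\<^sub>M lborel). A p)"
      using A B' BB by simp
    also have "\<dots> = (LINT p|(lborel \<Otimes>\<^sub>M lborel). - B p - A p)" using A B by simp
    also have "\<dots> = (LINT p|(lborel \<Otimes>\<^sub>M lborel). u (snd p) * (diff (fst p) (diff (- fst p) \<phi>) (snd p) * k n (fst p)))"
      by (intro Bochner_Integration.integral_cong refl) (simp add: A_def B_def diff_def algebra_simps)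
    finally show ?thesis .
  qed
  \<comment> \<open>The cutoff is now removed. Each side has its own integrable majorant, although
    the two parts into which it was split do not.\<close>
  have "(\<lambda>n. LINT p|(lborel \<Otimes>\<^sub>M lborel). diff (fst p) u (snd p) * diff (fst p) \<phi> (snd p) * k n (fst p)) \<longlonglongrightarrow>
    (LINT p|(lborel \<Otimes>\<^sub>M lborel). diff (fst p) u (snd p) * diff (fst p) \<phi> (snd p) * nker s (fst p))"
  proof (rule integral_dominated_convergence[OF _ _ integrable_abs[OF diff_product_kernel_integrable[OF assms]]])
    show "AE p in (lborel \<Otimes>\<^sub>M lborel). (\<lambda>n. diff (fst p) u (snd p) * diff (fst p) \<phi> (snd p) * k n (fst p))
        \<longlonglongrightarrow> diff (fst p) u (snd p) * diff (fst p) \<phi> (snd p) * nker s (fst p)"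
      by (intro AE_I2 tendsto_intros klim)
    show "AE p in (lborel \<Otimes>\<^sub>M lborel). norm (diff (fst p) u (snd p) * diff (fst p) \<phi> (snd p) * k n (fst p))
        \<le> \<bar>diff (fst p) u (snd p) * diff (fst p) \<phi> (snd p) * nker s (fst p)\<bar>" for n
      by (intro AE_I2) (auto simp: abs_mult k0 kle nker_nonneg intro!: mult_left_mono)
  qed (unfold diff_def, measurable)
  moreover have "(\<lambda>n. LINT p|(lborel \<Otimes>\<^sub>M lborel). u (snd p) * (diff (fst p) (diff (- fst p) \<phi>) (snd p) * k n (fst p))) \<longlonglongrightarrow>
    (LINT p|(lborel \<Otimes>\<^sub>M lborel). u (snd p) * (diff (fst p) (diff (- fst p) \<phi>) (snd p) * nker s (fst p)))"
  proof (rule integral_dominated_convergence[OF _ _ integrable_mult_right[OF integrable_abs[OF diff_diff_kernel_integrable[OF s t]], of M]])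
    show "AE p in (lborel \<Otimes>\<^sub>M lborel). (\<lambda>n. u (snd p) * (diff (fst p) (diff (- fst p) \<phi>) (snd p) * k n (fst p)))
        \<longlonglongrightarrow> u (snd p) * (diff (fst p) (diff (- fst p) \<phi>) (snd p) * nker s (fst p))"
      by (intro AE_I2 tendsto_intros klim)
    show "AE p in (lborel \<Otimes>\<^sub>M lborel). norm (u (snd p) * (diff (fst p) (diff (- fst p) \<phi>) (snd p) * k n (fst p)))
        \<le> M * \<bar>diff (fst p) (diff (- fst p) \<phi>) (snd p) * nker s (fst p)\<bar>" for n
      using M0 by (intro AE_I2) (auto simp: abs_mult k0 kle nker_nonneg intro!: mult_mono bounded_borelD(2)[OF b] mult_nonneg_nonneg)
  qed (unfold diff_def, measurable)
  ultimately show ?thesis unfolding eq using LIMSEQ_unique by blast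
qed

section \<open>The equation for averages\<close>

text \<open>Lebesgue measure is complete, so a function agreeing almost everywhere with a Borel
  function is measurable. This settles the measurability of the double integrand built from
  u.\<close>

lemma lebesgue_integral_AE_eq:
  fixes f f' :: "'a::euclidean_space \<Rightarrow> real"
  assumes f': "f' \<in> borel_measurable borel" and ae: "AE x in lebesgue. f x = f' x"
  shows "(LINT x|lebesgue. f x) = (LINT x|lborel. f' x)"
proof -
  have m': "f' \<in> borel_measurable lebesgue" by (rule measurable_completion) (use f' in simp)
  have m: "f \<in> borel_measurable lebesgue"
  proof (rule measurableI)
    fix A :: "real set" assume A: "A \<in> sets borel"
    show "f -` A \<inter> space lebesgue \<in> sets lebesgue"
    proof (rule completion.in_sets_AE)
      show "AE x in lebesgue. (x \<in> f' -` A \<inter> space lebesgue) = (x \<in> f -` A \<inter> space lebesgue)"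
        using ae by eventually_elim simp
      show "f' -` A \<inter> space lebesgue \<in> sets lebesgue" by (rule measurable_sets[OF m' A])
    qed simp
  qed simp
  have "(LINT x|lebesgue. f x) = (LINT x|lebesgue. f' x)" by (rule integral_cong_AE[OF m m' ae])
  also have "\<dots> = (LINT x|lborel. f' x)" by (rule integral_completion) (use f' in simp)
  finally show ?thesis .
qed

text \<open>\<open>N\<^sub>r\<close> of the introduction. On the diagonal \<open>nker s 0 = 1 / 0 = 0\<close>.\<close>

definition nlav :: "real \<Rightarrow> real \<Rightarrow> (real^'n::finite \<Rightarrow> real) \<Rightarrow> real^'n \<Rightarrow> real" where
  "nlav s r g x = (LINT p|(lborel \<Otimes>\<^sub>M lborel).
     g (x + r *\<^sub>R snd p) * (diff (fst p) (diff (- fst p) (bump 0)) (snd p) * nker s (fst p)))"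

text \<open>The identity for \<open>d/dr A\<^sub>r g\<close> of the introduction, with \<open>q\<close> in the role of \<open>f\<close>.\<close>

definition sol :: "real \<Rightarrow> (real^'n::finite \<Rightarrow> real) \<Rightarrow> (real^'n \<Rightarrow> real) \<Rightarrow> bool" where
  "sol s g q \<longleftrightarrow> (\<exists>S. bounded_borel g S) \<and> (\<exists>S. bounded_borel q S) \<and>
     (\<forall>x r. r > 0 \<longrightarrow> ((\<lambda>r. av ker r g x) has_real_derivative
        (r powr (1 - 2 * s) * nlav s r g x + r * av (bump 0) r g x - r * av (bump 0) r q x)) (at r))"

lemma nker_scale:
  fixes h :: "real^'n::finite"
  assumes "r > 0"
  shows "nker s (r *\<^sub>R h) = nker s h / r powr (real CARD('n) + 2 * s)"
  using assms by (simp add: nker_def powr_mult)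

text \<open>Dilating both variables by r gives the volume factor \<open>r ^ (2 * CARD('n))\<close>,
  and the homogeneous kernel contributes the exponent - n - 2 s.\<close>

lemma nlav_rescale:
  fixes b :: "real^'n::finite \<Rightarrow> real"
  assumes [measurable]: "b \<in> borel_measurable borel" and r: "r > 0"
  shows "(LINT p|(lborel \<Otimes>\<^sub>M lborel). b (snd p) * (diff (fst p) (diff (- fst p) (\<lambda>y. bump 0 (inverse r *\<^sub>R (y - x)))) (snd p) * nker s (fst p)))
    = r powr (real CARD('n) - 2 * s) * nlav s r b x"
proof -
  let ?\<phi> = "\<lambda>y. bump 0 (inverse r *\<^sub>R (y - x))"
  have [measurable]: "(bump 0 :: real^'n \<Rightarrow> real) \<in> borel_measurable borel"
    by (rule test_function_measurable[OF test_function_bump])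
  define F where "F = (\<lambda>p. b (snd p) * (diff (fst p) (diff (- fst p) ?\<phi>) (snd p) * nker s (fst p)))"
  have Fm: "F \<in> borel_measurable borel"
  proof -
    have "F \<in> borel_measurable (lborel \<Otimes>\<^sub>M lborel)" unfolding F_def diff_def by measurable
    then show ?thesis unfolding lborel_prod by simp
  qed
  \<comment> \<open>Only the second variable is recentred at x; the step is merely dilated.\<close>
  have e: "F ((0, x) + r *\<^sub>R p) = inverse (r powr (real CARD('n) + 2 * s)) *
      (b (x + r *\<^sub>R snd p) * (diff (fst p) (diff (- fst p) (bump 0)) (snd p) * nker s (fst p)))" for p
  proof -
    have "inverse r *\<^sub>R (x + r *\<^sub>R snd p + r *\<^sub>R h - x) = snd p + h" for h
      using r by (simp add: scaleR_add_right)
    then have "?\<phi> (x + r *\<^sub>R snd p + r *\<^sub>R h) = bump 0 (snd p + h)" for h by simp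
    from this[of "fst p"] this[of 0] this[of "- fst p"] this[of "fst p - fst p"]
    have "diff (r *\<^sub>R fst p) (diff (- (r *\<^sub>R fst p)) ?\<phi>) (x + r *\<^sub>R snd p) = diff (fst p) (diff (- fst p) (bump 0)) (snd p)"
      by (simp add: diff_def)
    then show ?thesis using r by (simp add: F_def nker_scale divide_inverse mult_ac)
  qed
  have "(LINT p|(lborel \<Otimes>\<^sub>M lborel). F p) = (LINT p|lborel. F p)" by (simp add: lborel_prod)
  also have "\<dots> = \<bar>r\<bar> ^ DIM((real^'n) \<times> (real^'n)) * (LINT p|lborel. F ((0, x) + r *\<^sub>R p))"
    using r by (intro lborel_affine_integral(1)[OF Fm]) simp
  also have "\<dots> = (r ^ (2 * CARD('n)) * inverse (r powr (real CARD('n) + 2 * s))) * nlav s r b x"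
  proof -
    have D: "DIM((real^'n) \<times> (real^'n)) = 2 * CARD('n)" by simp
    show ?thesis unfolding D e nlav_def lborel_prod using r by simp
  qed
  also have "r ^ (2 * CARD('n)) * inverse (r powr (real CARD('n) + 2 * s)) = r powr (real CARD('n) - 2 * s)"
  proof -
    have "r ^ (2 * CARD('n)) = r powr (2 * real CARD('n))" using r by (simp add: powr_realpow[symmetric])
    then show ?thesis by (simp add: powr_minus[symmetric] powr_add[symmetric])
  qed
  finally show ?thesis unfolding F_def .
qed

text \<open>Passes from (x, y) to the step h = y - x. The shear leaves h in the second slot and a
  swap brings it to the first, the layout shared by all nonlocal integrals.\<close>

lemma double_integral_representative:
  fixes u u0 \<phi> :: "real^'n::finite \<Rightarrow> real"
  assumes u0: "u0 \<in> borel_measurable borel" and ae: "AE x in lebesgue. u x = u0 x" and \<phi>: "\<phi> \<in> borel_measurable borel"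
  shows "(LINT (x, y)|lebesgue. (u x - u y) * (\<phi> x - \<phi> y) / norm (x - y) powr (real CARD('n) + 2 * s))
    = (LINT p|(lborel \<Otimes>\<^sub>M lborel). diff (fst p) u0 (snd p) * diff (fst p) \<phi> (snd p) * nker s (fst p))"
proof -
  note [measurable] = u0 \<phi>
  define F where "F = (\<lambda>p. (u0 (fst p) - u0 (snd p)) * (\<phi> (fst p) - \<phi> (snd p)) * nker s (fst p - snd p))"
  have Fm: "F \<in> borel_measurable (lborel \<Otimes>\<^sub>M lborel)" unfolding F_def by measurable
  have "AE x in lborel. u x = u0 x" using ae by (simp add: AE_completion_iff)
  then obtain N where N: "\<And>x. x \<in> space lborel - N \<Longrightarrow> u x = u0 x" "N \<in> null_sets lborel" by (rule AE_E3) blast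
  have [measurable]: "N \<in> sets borel" using N(2) by auto
  have n: "AE x in lborel. x \<notin> N" by (rule AE_not_in[OF N(2)])
  \<comment> \<open>The functions agree off a null set N of single points, so both coordinates have
    to avoid N; almost all pairs do.\<close>
  have "AE p in (lborel \<Otimes>\<^sub>M lborel). fst p \<notin> N \<and> snd p \<notin> N"
  proof (rule lborel_pair.AE_pair_measure)
    show "{p \<in> space (lborel \<Otimes>\<^sub>M lborel). fst p \<notin> N \<and> snd p \<notin> N} \<in> sets (lborel \<Otimes>\<^sub>M lborel)" by measurable
    show "AE x in lborel. AE y in lborel. fst (x, y) \<notin> N \<and> snd (x, y) \<notin> N"
      using n
    proof eventually_elim
      case (elim x)
      show ?case using n by eventually_elim (use elim in simp)
    qed
  qed
  then have "AE p in lborel. fst p \<notin> N \<and> snd p \<notin> N" unfolding lborel_prod .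
  then have ae2: "AE p in lebesgue. fst p \<notin> N \<and> snd p \<notin> N" by (rule AE_completion)
  have "(LINT (x, y)|lebesgue. (u x - u y) * (\<phi> x - \<phi> y) / norm (x - y) powr (real CARD('n) + 2 * s)) = (LINT p|lborel. F p)"
  proof (rule lebesgue_integral_AE_eq)
    show "F \<in> borel_measurable borel" using Fm unfolding lborel_prod by simp
    show "AE p in lebesgue. (case p of (x, y) \<Rightarrow> (u x - u y) * (\<phi> x - \<phi> y) / norm (x - y) powr (real CARD('n) + 2 * s)) = F p"
      using ae2 by eventually_elim (use N(1) in \<open>auto simp: F_def nker_def case_prod_beta\<close>)
  qed
  also have "\<dots> = (LINT p|(lborel \<Otimes>\<^sub>M lborel). F p)" unfolding lborel_prod ..
  also have "\<dots> = (LINT p|(lborel \<Otimes>\<^sub>M lborel). F (fst p, snd p + fst p))"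
    by (rule lborel_shear_integral(1)[where L="\<lambda>x. x", OF _ Fm, symmetric]) simp
  also have "\<dots> = (LINT p|(lborel \<Otimes>\<^sub>M lborel). diff (snd p) u0 (fst p) * diff (snd p) \<phi> (fst p) * nker s (snd p))"
  proof (intro Bochner_Integration.integral_cong refl)
    fix p :: "(real^'n) \<times> (real^'n)"
    have n: "nker s (fst p - (snd p + fst p)) = nker s (snd p)" by (simp add: nker_def)
    show "F (fst p, snd p + fst p) = diff (snd p) u0 (fst p) * diff (snd p) \<phi> (fst p) * nker s (snd p)"
      unfolding F_def diff_def fst_conv snd_conv n by (simp add: algebra_simps)
  qed
  also have "\<dots> = (LINT p|(lborel \<Otimes>\<^sub>M lborel). diff (fst p) u0 (snd p) * diff (fst p) \<phi> (snd p) * nker s (fst p))"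
  proof -
    let ?H = "\<lambda>p. diff (fst p) u0 (snd p) * diff (fst p) \<phi> (snd p) * nker s (fst p)"
    have "?H \<in> borel_measurable (lborel \<Otimes>\<^sub>M lborel)" unfolding diff_def by measurable
    from lborel_pair.integral_product_swap[OF this] show ?thesis by (simp add: case_prod_beta')
  qed
  finally show ?thesis .
qed

text \<open>The test function is Q((y - x) / r). Every term then carries
  \<open>r ^ CARD('n)\<close>, and after cancellation the Laplacian term is 1 / r times the radius
  derivative. The lemma serves two representatives u0 of u: a Borel one, and then the continuous one
  obtained from it.\<close>

lemma weak_solution_imp_sol:
  fixes u u0 :: "real^'n::finite \<Rightarrow> real"
  assumes s: "0 < s" "s < 1" and p: "p > 1" and ws: "weak_solution s p u"
    and b: "bounded_borel u0 M" and ae: "AE x in lebesgue. u x = u0 x"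
  shows "sol s u0 (\<lambda>x. \<bar>u0 x\<bar> powr (p - 1) * u0 x)"
proof -
  define f where "f = (\<lambda>x. \<bar>u0 x\<bar> powr (p - 1) * u0 x)"
  note um[measurable] = bounded_borelD(1)[OF b]
  have M0: "M \<ge> 0" by (rule bounded_borelD(3)[OF b])
  have fm[measurable]: "f \<in> borel_measurable borel" unfolding f_def by measurable
  have fb: "bounded_borel f (M powr (p - 1) * M)"
    unfolding bounded_borel_def
  proof (intro conjI fm allI)
    fix x
    show "\<bar>f x\<bar> \<le> M powr (p - 1) * M" unfolding f_def abs_mult
      using p M0 bounded_borelD(2)[OF b, of x] by (intro mult_mono) (auto intro: powr_mono2)
  qed
  have uH: "u \<in> H1" using ws by (simp add: weak_solution_def)
  then have "\<exists>G. has_weak_gradient u G" by (auto simp: H1_def)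
  then have wg: "has_weak_gradient u (weak_gradient u)" unfolding weak_gradient_def by (rule someI_ex)
  obtain g where g: "borel_weak_gradient u0 g" "\<And>i. AE x in lebesgue. weak_gradient u x $ i = g i x"
    using borel_weak_gradient_representative[OF wg um ae] by blast
  have gi: "locally_integrable_borel (g i)" for i using g(1) by (auto simp: borel_weak_gradient_def)
  note [measurable] = locally_integrable_borelD(1)[OF gi]
  let ?Q = "bump 0 :: real^'n \<Rightarrow> real"
  have "((\<lambda>r. av ker r u0 x) has_real_derivative
        (r powr (1 - 2 * s) * nlav s r u0 x + r * av ?Q r u0 x - r * av ?Q r f x)) (at r)" if r: "r > 0" for x r
  proof -
    define \<phi> where "\<phi> = (\<lambda>y. ?Q (inverse r *\<^sub>R (y - x)))"
    have t: "test_function \<phi>" unfolding \<phi>_def by (rule test_function_affine_inverse[OF test_function_bump r])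
    note tm[measurable] = test_function_measurable[OF t]
    have tpm[measurable]: "partial i \<phi> \<in> borel_measurable borel" for i by (rule test_function_measurable[OF test_function_partial[OF t]])
    have wg\<phi>: "has_weak_gradient \<phi> (gradient \<phi>)" by (rule test_function_weak_gradient[OF t])
    then have "has_weak_gradient \<phi> (weak_gradient \<phi>)" unfolding weak_gradient_def by (rule someI[of "has_weak_gradient \<phi>"])
    then have ae\<phi>: "AE x in lebesgue. weak_gradient \<phi> x = gradient \<phi> x" by (rule weak_gradient_unique[OF _ wg\<phi>])
    have E: "(LINT x|lebesgue. u x * \<phi> x + weak_gradient u x \<bullet> weak_gradient \<phi> x)
        + (LINT (x, y)|lebesgue. (u x - u y) * (\<phi> x - \<phi> y) / norm (x - y) powr (real CARD('n) + 2 * s))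
        = (LINT x|lebesgue. \<bar>u x\<bar> powr (p - 1) * u x * \<phi> x)"
      using ws test_function_H1[OF t] unfolding weak_solution_def by blast
    have aeg: "AE x in lebesgue. \<forall>i\<in>UNIV. weak_gradient u x $ i = g i x"
      by (intro AE_finite_allI g(2)) simp
    have 1: "(LINT x|lebesgue. u x * \<phi> x + weak_gradient u x \<bullet> weak_gradient \<phi> x) = (LINT x|lborel. u0 x * \<phi> x + (\<Sum>i\<in>UNIV. g i x * partial i \<phi> x))"
    proof (rule lebesgue_integral_AE_eq)
      show "(\<lambda>x. u0 x * \<phi> x + (\<Sum>i\<in>UNIV. g i x * partial i \<phi> x)) \<in> borel_measurable borel" by measurable
      show "AE x in lebesgue. u x * \<phi> x + weak_gradient u x \<bullet> weak_gradient \<phi> x = u0 x * \<phi> x + (\<Sum>i\<in>UNIV. g i x * partial i \<phi> x)"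
        using ae ae\<phi> aeg by eventually_elim (simp add: inner_vec_def gradient_def)
    qed
    have pp: "partial i (partial i \<phi>) y = (inverse r)\<^sup>2 * partial i (partial i ?Q) (inverse r *\<^sub>R (y - x))" for i y
    proof -
      have e: "partial i \<phi> = (\<lambda>y. inverse r * partial i ?Q (inverse r *\<^sub>R (y - x)))"
        unfolding \<phi>_def by (rule ext) (rule partial_affine(2)[OF test_function_differentiable[OF test_function_bump]])
      have tQ: "test_function (partial i ?Q)" by (intro test_function_partial test_function_bump)
      have "partial i (\<lambda>y. inverse r * partial i ?Q (inverse r *\<^sub>R (y - x))) y
        = inverse r * partial i (\<lambda>y. partial i ?Q (inverse r *\<^sub>R (y - x))) y + partial i (\<lambda>y. inverse r) y * partial i ?Q (inverse r *\<^sub>R (y - x))"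
        by (rule partial_mult) (auto intro: test_function_differentiable[OF test_function_affine_inverse[OF tQ r]])
      moreover have "partial i (\<lambda>y::real^'n. inverse r) y = 0" using partial_eqI[OF has_derivative_const, of i "inverse r" y] by simp
      ultimately show ?thesis unfolding e
        using partial_affine(2)[OF test_function_differentiable[OF tQ], where i=i and c="inverse r" and y=y and a=x] by (simp add: power2_eq_square)
    qed
    have iu: "integrable lborel (\<lambda>y. u0 y * \<psi> y)" if "test_function \<psi>" for \<psi>
      by (rule locally_integrable_times_test[OF bounded_borel_imp_locally_integrable[OF b] that])
    have "(LINT x|lborel. u0 x * \<phi> x + (\<Sum>i\<in>UNIV. g i x * partial i \<phi> x))
      = (LINT x|lborel. u0 x * \<phi> x) + (\<Sum>i\<in>UNIV. LINT x|lborel. g i x * partial i \<phi> x)"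
      using iu[OF t] locally_integrable_times_test[OF gi test_function_partial[OF t]] by simp
    \<comment> \<open>The weak gradient is tested with \<open>partial i \<phi>\<close>, itself a
      test function, so that both derivatives end up on \<phi>.\<close>
    also have "(\<Sum>i\<in>UNIV. LINT x|lborel. g i x * partial i \<phi> x) = - (\<Sum>i\<in>UNIV. LINT x|lborel. u0 x * partial i (partial i \<phi>) x)"
      using g(1) test_function_partial[OF t] unfolding borel_weak_gradient_def by (simp add: sum_negf)
    also have "(\<Sum>i\<in>UNIV. LINT x|lborel. u0 x * partial i (partial i \<phi>) x) = (LINT y|lborel. (\<Sum>i\<in>UNIV. u0 y * partial i (partial i \<phi>) y))"
      using iu test_function_partial[OF test_function_partial[OF t]] by (subst Bochner_Integration.integral_sum) auto
    also have "\<dots> = (LINT y|lborel. (inverse r)\<^sup>2 * (u0 y * laplace ?Q (inverse r *\<^sub>R (y - x))))"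
      unfolding pp laplace_def by (simp add: sum_distrib_left mult_ac)
    also have "\<dots> = (inverse r)\<^sup>2 * (r ^ CARD('n) * av (laplace ?Q) r u0 x)"
      by (simp only: integral_mult_right_zero av_rescale[OF um test_function_measurable[OF test_function_laplace[OF test_function_bump]] r])
    also have "(LINT x|lborel. u0 x * \<phi> x) = r ^ CARD('n) * av ?Q r u0 x"
      unfolding \<phi>_def by (rule av_rescale[OF um test_function_measurable[OF test_function_bump] r])
    finally have 2: "(LINT x|lebesgue. u x * \<phi> x + weak_gradient u x \<bullet> weak_gradient \<phi> x)
      = r ^ CARD('n) * av ?Q r u0 x + - ((inverse r)\<^sup>2 * (r ^ CARD('n) * av (laplace ?Q) r u0 x))"
      unfolding 1 .
    have 3: "(LINT (x, y)|lebesgue. (u x - u y) * (\<phi> x - \<phi> y) / norm (x - y) powr (real CARD('n) + 2 * s))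
      = r powr (real CARD('n) - 2 * s) * nlav s r u0 x"
      unfolding double_integral_representative[OF um ae tm] nonlocal_integration_by_parts[OF s t g(1) b]
      unfolding \<phi>_def by (rule nlav_rescale[OF um r])
    have "(LINT x|lebesgue. \<bar>u x\<bar> powr (p - 1) * u x * \<phi> x) = (LINT x|lborel. f x * \<phi> x)"
    proof (rule lebesgue_integral_AE_eq)
      show "AE x in lebesgue. \<bar>u x\<bar> powr (p - 1) * u x * \<phi> x = f x * \<phi> x"
        using ae by eventually_elim (simp add: f_def)
    qed measurable
    also have "\<dots> = r ^ CARD('n) * av ?Q r f x"
      unfolding \<phi>_def by (rule av_rescale[OF fm test_function_measurable[OF test_function_bump] r])
    finally have 4: "(LINT x|lebesgue. \<bar>u x\<bar> powr (p - 1) * u x * \<phi> x) = r ^ CARD('n) * av ?Q r f x" .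
    have rp: "r powr (real CARD('n) - 2 * s) = r ^ CARD('n) * r powr (- 2 * s)"
      using r by (simp add: powr_realpow[symmetric] powr_add[symmetric])
    \<comment> \<open>Once \<open>r ^ CARD('n)\<close> is cancelled, multiplication by r gives the
      Laplacian term the factor \<open>inverse r\<close> of the radius derivative.\<close>
    have "r ^ CARD('n) * (av ?Q r u0 x - (inverse r)\<^sup>2 * av (laplace ?Q) r u0 x + r powr (- 2 * s) * nlav s r u0 x)
      = r ^ CARD('n) * av ?Q r f x"
      using E unfolding 2 3 4 rp by (simp add: algebra_simps)
    then have "av ?Q r u0 x - (inverse r)\<^sup>2 * av (laplace ?Q) r u0 x + r powr (- 2 * s) * nlav s r u0 x = av ?Q r f x"
      using r by simp
    then have "(inverse r)\<^sup>2 * av (laplace ?Q) r u0 x = av ?Q r u0 x + r powr (- 2 * s) * nlav s r u0 x - av ?Q r f x" by linarith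
    then have "r * ((inverse r)\<^sup>2 * av (laplace ?Q) r u0 x) = r * (av ?Q r u0 x + r powr (- 2 * s) * nlav s r u0 x - av ?Q r f x)" by simp
    moreover have "r * ((inverse r)\<^sup>2 * av (laplace ?Q) r u0 x) = inverse r * av (laplace ?Q) r u0 x"
      using r by (simp add: power2_eq_square)
    moreover have "r * r powr (- 2 * s) = r powr (1 - 2 * s)"
    proof -
      have "r * r powr (- 2 * s) = r powr 1 * r powr (- 2 * s)" using r by simp
      then show ?thesis unfolding powr_add[symmetric] by simp
    qed
    ultimately have "inverse r * av (laplace ?Q) r u0 x = r powr (1 - 2 * s) * nlav s r u0 x + r * av ?Q r u0 x - r * av ?Q r f x"
      by (simp add: algebra_simps)
    moreover have "((\<lambda>r. av ker r u0 x) has_real_derivative inverse r * av (laplace ?Q) r u0 x) (at r)"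
      using av_has_derivative_radius[OF test_function_ker b r, of x] unfolding laplace_bump_0[symmetric] .
    ultimately show ?thesis by simp
  qed
  then show ?thesis using b fb unfolding sol_def f_def[symmetric] by blast
qed

section \<open>A priori estimates\<close>

lemma nlav_integrable:
  fixes g :: "real^'n::finite \<Rightarrow> real"
  assumes s: "0 < s" "s < 1" and b: "bounded_borel g S"
  shows "integrable (lborel \<Otimes>\<^sub>M lborel) (\<lambda>p. g (x + r *\<^sub>R snd p) * (diff (fst p) (diff (- fst p) (bump 0)) (snd p) * nker s (fst p)))"
    and "\<bar>nlav s r g x\<bar> \<le> S * (LINT p|(lborel \<Otimes>\<^sub>M lborel). \<bar>diff (fst p) (diff (- fst p) (bump 0 :: real^'n \<Rightarrow> real)) (snd p) * nker s (fst p)\<bar>)"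
proof -
  have [measurable]: "g \<in> borel_measurable borel" by (rule bounded_borelD(1)[OF b])
  let ?D = "\<lambda>p::(real^'n) \<times> (real^'n). diff (fst p) (diff (- fst p) (bump 0)) (snd p) * nker s (fst p)"
  have D: "integrable (lborel \<Otimes>\<^sub>M lborel) ?D" by (rule diff_diff_kernel_integrable[OF s test_function_bump])
  then have [measurable]: "?D \<in> borel_measurable (lborel \<Otimes>\<^sub>M lborel)" by (rule borel_measurable_integrable)
  have le: "\<bar>g (x + r *\<^sub>R snd p) * ?D p\<bar> \<le> S * \<bar>?D p\<bar>" for p
    unfolding abs_mult[of "g _"] by (intro mult_right_mono bounded_borelD(2)[OF b]) auto
  show i: "integrable (lborel \<Otimes>\<^sub>M lborel) (\<lambda>p. g (x + r *\<^sub>R snd p) * ?D p)"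
  proof (rule Bochner_Integration.integrable_bound[OF integrable_mult_right[OF integrable_abs[OF D], of S]])
    show "AE p in (lborel \<Otimes>\<^sub>M lborel). norm (g (x + r *\<^sub>R snd p) * ?D p) \<le> norm (S * \<bar>?D p\<bar>)"
      unfolding real_norm_def by (intro AE_I2 order_trans[OF le abs_ge_self])
  qed measurable
  have "\<bar>nlav s r g x\<bar> \<le> (LINT p|(lborel \<Otimes>\<^sub>M lborel). \<bar>g (x + r *\<^sub>R snd p) * ?D p\<bar>)"
    unfolding nlav_def by (rule integral_abs_bound)
  also have "\<dots> \<le> (LINT p|(lborel \<Otimes>\<^sub>M lborel). S * \<bar>?D p\<bar>)"
    by (intro integral_mono integrable_abs i integrable_mult_right D le)
  finally show "\<bar>nlav s r g x\<bar> \<le> S * (LINT p|(lborel \<Otimes>\<^sub>M lborel). \<bar>?D p\<bar>)" by simp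
qed

lemma nlav_diff:
  fixes g :: "real^'n::finite \<Rightarrow> real"
  assumes s: "0 < s" "s < 1" and b: "bounded_borel g S"
  shows "nlav s r (diff a g) x = diff a (nlav s r g) x"
proof -
  have "nlav s r (diff a g) x = (LINT p|(lborel \<Otimes>\<^sub>M lborel).
      g (x + a + r *\<^sub>R snd p) * (diff (fst p) (diff (- fst p) (bump 0)) (snd p) * nker s (fst p))
      - g (x + r *\<^sub>R snd p) * (diff (fst p) (diff (- fst p) (bump 0)) (snd p) * nker s (fst p)))"
    unfolding nlav_def diff_def[of a g] by (simp only: left_diff_distrib add.assoc add.commute[of a])
  also have "\<dots> = nlav s r g (x + a) - nlav s r g x"
    unfolding nlav_def by (intro Bochner_Integration.integral_diff nlav_integrable(1)[OF s b])
  finally show ?thesis by (simp add: diff_def)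
qed

lemma sol_bounded: "sol s g q \<Longrightarrow> \<exists>S. bounded_borel g S" "sol s g q \<Longrightarrow> \<exists>S. bounded_borel q S"
  by (auto simp: sol_def)

lemma sol_diff:
  fixes g q :: "real^'n::finite \<Rightarrow> real"
  assumes s: "0 < s" "s < 1" and g: "sol s g q"
  shows "sol s (diff a g) (diff a q)"
proof -
  obtain S S' where b: "bounded_borel g S" "bounded_borel q S'" using g by (auto simp: sol_def)
  note ki = test_function_integrable[OF test_function_ker] and Qi = test_function_integrable[OF test_function_bump]
  have "((\<lambda>r. av ker r (diff a g) x) has_real_derivative
        (r powr (1 - 2 * s) * nlav s r (diff a g) x + r * av (bump 0) r (diff a g) x - r * av (bump 0) r (diff a q) x)) (at r)"
    if r: "r > 0" for x r
  proof -
    have d: "((\<lambda>r. av ker r g x) has_real_derivative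
        (r powr (1 - 2 * s) * nlav s r g x + r * av (bump 0) r g x - r * av (bump 0) r q x)) (at r)" for x
      using g r by (simp add: sol_def)
    from DERIV_diff[OF d[of "x + a"] d[of x]] show ?thesis
      unfolding nlav_diff[OF s b(1)] av_diff[OF b(1) ki] av_diff[OF b(1) Qi] av_diff[OF b(2) Qi] diff_def
      by (simp add: algebra_simps)
  qed
  then show ?thesis
    using bounded_borel_diff[OF b(1)] bounded_borel_diff[OF b(2)] unfolding sol_def by blast
qed

text \<open>The averages of q may blow up like \<open>r powr (- 1 - \<theta>)\<close>: the weight r
  reduces this to \<open>r powr (- \<theta>)\<close>, integrable at 0 since \<theta> < 1. K is
  quantified first, so it depends only on the dimension and s.\<close>

lemma radius_estimate:
  assumes s: "0 < s" "s < 1"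
  shows "\<exists>K\<ge>0. \<forall>(g :: real^'n::finite \<Rightarrow> real) q S B \<theta> x \<epsilon> R. sol s g q \<and> bounded_borel g S \<and> \<theta> < 1 \<and> 0 \<le> B \<and> 0 < \<epsilon> \<and> \<epsilon> < R \<and> R \<le> 1 \<and>
      (\<forall>r. 0 < r \<and> r \<le> 1 \<longrightarrow> \<bar>av (bump 0) r q x\<bar> \<le> B * r powr (- 1 - \<theta>)) \<longrightarrow>
      \<bar>av ker R g x - av ker \<epsilon> g x\<bar> \<le> K * S * R powr (2 - 2 * s) + B * R powr (1 - \<theta>) / (1 - \<theta>)"
proof -
  define CD where "CD = (LINT p|(lborel \<Otimes>\<^sub>M lborel). \<bar>diff (fst p) (diff (- fst p) (bump 0 :: real^'n \<Rightarrow> real)) (snd p) * nker s (fst p)\<bar>)"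
  define CQ where "CQ = (LINT z|lborel. \<bar>bump 0 (z :: real^'n)\<bar>)"
  have C0: "CD \<ge> 0" "CQ \<ge> 0" by (auto simp: CD_def CQ_def)
  show ?thesis
  proof (intro exI[of _ "(CD + CQ) / (2 - 2 * s)"] conjI allI impI)
    show "(CD + CQ) / (2 - 2 * s) \<ge> 0" using C0 s by simp
    fix g q :: "real^'n \<Rightarrow> real" and S B \<theta> :: real and x :: "real^'n" and \<epsilon> R :: real
    assume H: "sol s g q \<and> bounded_borel g S \<and> \<theta> < 1 \<and> 0 \<le> B \<and> 0 < \<epsilon> \<and> \<epsilon> < R \<and> R \<le> 1 \<and>
      (\<forall>r. 0 < r \<and> r \<le> 1 \<longrightarrow> \<bar>av (bump 0) r q x\<bar> \<le> B * r powr (- 1 - \<theta>))"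
    then have b: "bounded_borel g S" and th: "\<theta> < 1" and B0: "B \<ge> 0" and e: "0 < \<epsilon>" "\<epsilon> < R" "R \<le> 1"
      and q: "\<And>r. 0 < r \<Longrightarrow> r \<le> 1 \<Longrightarrow> \<bar>av (bump 0) r q x\<bar> \<le> B * r powr (- 1 - \<theta>)" by auto
    have S0: "S \<ge> 0" by (rule bounded_borelD(3)[OF b])
    define F' where "F' = (\<lambda>r. r powr (1 - 2 * s) * nlav s r g x + r * av (bump 0) r g x - r * av (bump 0) r q x)"
    have d: "((\<lambda>r. av ker r g x) has_real_derivative F' r) (at r)" if "r > 0" for r
      using H that unfolding sol_def F'_def by blast
    \<comment> \<open>A primitive of the bound \<phi>' for the radius derivative; both of its
      exponents are positive.\<close>
    define \<phi> where "\<phi> = (\<lambda>r. (CD + CQ) * S * (r powr (2 - 2 * s) / (2 - 2 * s)) + B * (r powr (1 - \<theta>) / (1 - \<theta>)))"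
    define \<phi>' where "\<phi>' = (\<lambda>r. (CD + CQ) * S * r powr (1 - 2 * s) + B * r powr (- \<theta>))"
    have pd: "((\<lambda>r. r powr a / a) has_real_derivative r powr (a - 1)) (at r)" if "r > 0" "a \<noteq> 0" for r a :: real
      using that by (auto intro!: derivative_eq_intros simp: powr_diff field_simps)
    have \<phi>d: "(\<phi> has_real_derivative \<phi>' r) (at r)" if r: "r > 0" for r
    proof -
      have "(\<phi> has_real_derivative (CD + CQ) * S * r powr (2 - 2 * s - 1) + B * r powr (1 - \<theta> - 1)) (at r)"
        unfolding \<phi>_def using r s th by (intro DERIV_add DERIV_cmult pd) auto
      then show ?thesis by (simp add: \<phi>'_def algebra_simps)
    qed
    have "norm (av ker R g x - av ker \<epsilon> g x) \<le> \<phi> R - \<phi> \<epsilon>"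
    proof (rule differentiable_bound_general[OF e(2), where f'=F' and \<phi>'=\<phi>'])
      show "continuous_on {\<epsilon>..R} (\<lambda>r. av ker r g x)"
        by (intro continuous_at_imp_continuous_on ballI DERIV_isCont[OF d]) (use e in auto)
      show "continuous_on {\<epsilon>..R} \<phi>"
        by (intro continuous_at_imp_continuous_on ballI DERIV_isCont[OF \<phi>d]) (use e in auto)
      fix r assume r: "\<epsilon> < r" "r < R"
      then have r0: "0 < r" "r \<le> 1" using e by auto
      show "((\<lambda>r. av ker r g x) has_vector_derivative F' r) (at r)"
        using d[OF r0(1)] by (simp add: has_real_derivative_iff_has_vector_derivative)
      show "(\<phi> has_vector_derivative \<phi>' r) (at r)"
        using \<phi>d[OF r0(1)] by (simp add: has_real_derivative_iff_has_vector_derivative)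
      have "\<bar>F' r\<bar> \<le> r powr (1 - 2 * s) * \<bar>nlav s r g x\<bar> + r * \<bar>av (bump 0) r g x\<bar> + r * \<bar>av (bump 0) r q x\<bar>"
        unfolding F'_def using r0 by (intro order_trans[OF abs_triangle_ineq4] add_mono order_trans[OF abs_triangle_ineq]) (auto simp: abs_mult)
      also have "\<dots> \<le> r powr (1 - 2 * s) * (S * CD) + r powr (1 - 2 * s) * (S * CQ) + r * (B * r powr (- 1 - \<theta>))"
      proof (intro add_mono mult_mono)
        show "\<bar>nlav s r g x\<bar> \<le> S * CD" unfolding CD_def by (rule nlav_integrable(2)[OF s b])
        show "\<bar>av (bump 0) r g x\<bar> \<le> S * CQ" unfolding CQ_def by (rule av_bound[OF b test_function_integrable[OF test_function_bump]])
        \<comment> \<open>For r at most 1 the zero-order term is no worse than the nonlocal one, so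
          both share one power of r.\<close>
        show "r \<le> r powr (1 - 2 * s)" using powr_mono'[of "1 - 2 * s" 1 r] r0 s by simp
      qed (use q[OF r0] r0 in auto)
      also have "r * (B * r powr (- 1 - \<theta>)) = B * r powr (- \<theta>)"
      proof -
        have "r * r powr (- 1 - \<theta>) = r powr 1 * r powr (- 1 - \<theta>)" using r0 by simp
        also have "\<dots> = r powr (- \<theta>)" unfolding powr_add[symmetric] by simp
        finally show ?thesis by (simp add: mult.left_commute)
      qed
      finally show "norm (F' r) \<le> \<phi>' r" by (simp add: \<phi>'_def algebra_simps)
    qed
    \<comment> \<open>Dropping the lower end makes the bound independent of \<epsilon>, which will
      tend to 0.\<close>
    also have "\<dots> \<le> \<phi> R"
    proof -
      have "\<phi> \<epsilon> \<ge> 0" unfolding \<phi>_def using C0 S0 B0 s th by simp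
      then show ?thesis by simp
    qed
    finally show "\<bar>av ker R g x - av ker \<epsilon> g x\<bar> \<le> (CD + CQ) / (2 - 2 * s) * S * R powr (2 - 2 * s) + B * R powr (1 - \<theta>) / (1 - \<theta>)"
      by (simp add: \<phi>_def)
  qed
qed

lemma abs_ker_integral: "(LINT z|lborel. \<bar>ker (z :: real^'n::finite)\<bar>) = (LINT z|lborel. ker (z :: real^'n))"
  by (simp add: ker_def bump_nonneg)

text \<open>As the lower radius tends to 0, the average tends to c g(x). So c g is bounded by the
  average at a fixed radius R, by B, and by c times half the supremum of g, which is absorbed. The
  function q enters only through its averages, so that differences of q can be measured on the
  kernel.\<close>

lemma sup_estimate:
  assumes s: "0 < s" "s < 1" and \<theta>: "0 \<le> \<theta>" "\<theta> < 1"
  shows "\<exists>R C. 0 < R \<and> R \<le> 1 \<and> C > 0 \<and> (\<forall>(g :: real^'n::finite \<Rightarrow> real) q A B. sol s g q \<and> continuous_on UNIV g \<and> 0 \<le> B \<and>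
      (\<forall>x. \<bar>av ker R g x\<bar> \<le> A) \<and> (\<forall>x r. 0 < r \<and> r \<le> 1 \<longrightarrow> \<bar>av (bump 0) r q x\<bar> \<le> B * r powr (- 1 - \<theta>)) \<longrightarrow>
      (\<forall>x. \<bar>g x\<bar> \<le> C * (A + B)))"
proof -
  obtain K where K: "K \<ge> 0" "\<And>(g :: real^'n \<Rightarrow> real) q S B \<theta> x \<epsilon> R. sol s g q \<and> bounded_borel g S \<and> \<theta> < 1 \<and> 0 \<le> B \<and> 0 < \<epsilon> \<and> \<epsilon> < R \<and> R \<le> 1 \<and>
      (\<forall>r. 0 < r \<and> r \<le> 1 \<longrightarrow> \<bar>av (bump 0) r q x\<bar> \<le> B * r powr (- 1 - \<theta>)) \<Longrightarrow>
      \<bar>av ker R g x - av ker \<epsilon> g x\<bar> \<le> K * S * R powr (2 - 2 * s) + B * R powr (1 - \<theta>) / (1 - \<theta>)"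
    using radius_estimate[OF s] by blast
  define c where "c = (LINT z|lborel. ker (z :: real^'n))"
  have c: "c > 0" unfolding c_def by (rule ker_integral_pos)
  \<comment> \<open>Chosen to give K R powr (2 - 2 s) \<le> c / 2; K + 1 avoids a division by
    0.\<close>
  define R where "R = min 1 ((c / (2 * (K + 1))) powr (1 / (2 - 2 * s)))"
  have R: "0 < R" "R \<le> 1" using c K(1) by (auto simp: R_def)
  have KR: "K * R powr (2 - 2 * s) \<le> c / 2"
  proof -
    have "R powr (2 - 2 * s) \<le> ((c / (2 * (K + 1))) powr (1 / (2 - 2 * s))) powr (2 - 2 * s)"
      using R s by (intro powr_mono2) (auto simp: R_def)
    also have "\<dots> = c / (2 * (K + 1))" using c K(1) s by (simp add: powr_powr)
    finally have "K * R powr (2 - 2 * s) \<le> K * (c / (2 * (K + 1)))" using K(1) by (rule mult_left_mono)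
    also have "\<dots> \<le> c / 2" using K(1) c by (simp add: field_simps)
    finally show ?thesis .
  qed
  show ?thesis
  proof (rule exI[of _ R], rule exI[of _ "2 / c * (1 / (1 - \<theta>))"], intro conjI allI impI R)
    show "2 / c * (1 / (1 - \<theta>)) > 0" using c \<theta> by simp
    fix g q :: "real^'n \<Rightarrow> real" and A B :: real and x :: "real^'n"
    assume H: "sol s g q \<and> continuous_on UNIV g \<and> 0 \<le> B \<and>
      (\<forall>x. \<bar>av ker R g x\<bar> \<le> A) \<and> (\<forall>x r. 0 < r \<and> r \<le> 1 \<longrightarrow> \<bar>av (bump 0) r q x\<bar> \<le> B * r powr (- 1 - \<theta>))"
    then obtain S0 where b0: "bounded_borel g S0" using sol_bounded by blast
    have bdd: "bdd_above (range (\<lambda>x. \<bar>g x\<bar>))" by (rule bdd_aboveI2) (rule bounded_borelD(2)[OF b0])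
    \<comment> \<open>Absorption compares a bound with half of itself, so S must be the exact
      supremum; S0 only guarantees that it is finite.\<close>
    define S where "S = (SUP x. \<bar>g x\<bar>)"
    have gS: "\<bar>g x\<bar> \<le> S" for x unfolding S_def by (intro cSUP_upper bdd) simp
    have b: "bounded_borel g S" using bounded_borelD(1)[OF b0] gS by (simp add: bounded_borel_def)
    have B0: "B \<ge> 0" using H by simp
    have A0: "A \<ge> 0" using H abs_ge_zero order_trans by metis
    define Z where "Z = S / 2 + (A + B / (1 - \<theta>)) / c"
    have "\<bar>g x\<bar> \<le> Z" for x
    proof -
      have est: "\<bar>av ker R g x - av ker \<epsilon> g x\<bar> \<le> c / 2 * S + B / (1 - \<theta>)" if "0 < \<epsilon>" "\<epsilon> < R" for \<epsilon>
      proof -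
        have "\<bar>av ker R g x - av ker \<epsilon> g x\<bar> \<le> K * S * R powr (2 - 2 * s) + B * R powr (1 - \<theta>) / (1 - \<theta>)"
          using K(2)[of g q S \<theta> B \<epsilon> R x] H b that R \<theta> by blast
        also have "\<dots> \<le> c / 2 * S + B * 1 / (1 - \<theta>)"
        proof (intro add_mono divide_right_mono mult_left_mono)
          show "K * S * R powr (2 - 2 * s) \<le> c / 2 * S"
            using mult_right_mono[OF KR bounded_borelD(3)[OF b]] by (simp add: mult_ac)
          show "R powr (1 - \<theta>) \<le> 1" using R \<theta> powr_le1 by simp
        qed (use B0 \<theta> in auto)
        finally show ?thesis by simp
      qed
      have "isCont g x" using H by (simp add: continuous_on_eq_continuous_at)
      then have "((\<lambda>\<epsilon>. av ker \<epsilon> g x) \<longlongrightarrow> g x * c) (at_right 0)"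
        unfolding c_def by (intro av_tendsto[OF test_function_integrable[OF test_function_ker] b])
      then have "((\<lambda>\<epsilon>. \<bar>av ker R g x - av ker \<epsilon> g x\<bar>) \<longlongrightarrow> \<bar>av ker R g x - g x * c\<bar>) (at_right 0)"
        by (intro tendsto_intros)
      then have "\<bar>av ker R g x - g x * c\<bar> \<le> c / 2 * S + B / (1 - \<theta>)"
      proof (rule tendsto_upperbound)
        show "\<forall>\<^sub>F \<epsilon> in at_right 0. \<bar>av ker R g x - av ker \<epsilon> g x\<bar> \<le> c / 2 * S + B / (1 - \<theta>)"
          using est R by (auto simp: eventually_at_right_field)
      qed simp
      moreover have "\<bar>av ker R g x\<bar> \<le> A" using H by blast
      ultimately have "\<bar>g x * c\<bar> \<le> A + (c / 2 * S + B / (1 - \<theta>))" by linarith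
      then have "\<bar>g x\<bar> * c \<le> A + (c / 2 * S + B / (1 - \<theta>))" using c by (simp add: abs_mult)
      then show ?thesis using c by (simp add: Z_def field_simps)
    qed
    then have "S \<le> Z" unfolding S_def by (intro cSUP_least) auto
    then have "S \<le> 2 * ((A + B / (1 - \<theta>)) / c)" unfolding Z_def by linarith
    also have "\<dots> = 2 / c * (A + B / (1 - \<theta>))" by simp
    also have "\<dots> \<le> 2 / c * (A / (1 - \<theta>) + B / (1 - \<theta>))"
    proof (intro mult_left_mono add_mono)
      show "A \<le> A / (1 - \<theta>)" using A0 \<theta> by (simp add: le_divide_eq mult_left_le)
    qed (use c in auto)
    also have "\<dots> = 2 / c * (1 / (1 - \<theta>)) * (A + B)" by (simp add: add_divide_distrib distrib_left)
    finally show "\<bar>g x\<bar> \<le> 2 / c * (1 / (1 - \<theta>)) * (A + B)" using gS[of x] by linarith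
  qed
qed

section \<open>Estimates for iterated differences\<close>

lemma min_1_le_powr:
  fixes t :: real
  assumes "0 \<le> t" "0 < \<alpha>" "\<alpha> < 1"
  shows "min 1 t \<le> t powr \<alpha>"
proof (cases "t \<le> 1")
  case True
  then show ?thesis using assms powr_mono'[of \<alpha> 1 t] by (cases "t = 0") auto
next
  case False
  then show ?thesis using assms ge_one_powr_ge_zero[of t \<alpha>] by auto
qed

lemma diff_commute: "diff a (diff b f) = diff b (diff a f)"
  by (rule ext) (simp add: diff_def algebra_simps)

lemma continuous_diff: "continuous_on UNIV b \<Longrightarrow> continuous_on UNIV (diff a b)"
  unfolding diff_def by (intro continuous_intros continuous_on_compose2[of UNIV b "UNIV" "\<lambda>x. x + a"]) auto

text \<open>One difference of q, moved onto Q, is of order 1 / r, the case \<theta> = 0. At the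
  fixed radius R the difference of b is moved onto \<open>ker\<close> and costs only the constant 1
  / R.\<close>

lemma first_difference_estimate:
  assumes s: "0 < s" "s < 1"
  shows "\<exists>C>0. \<forall>(b :: real^'n::finite \<Rightarrow> real) q S T. sol s b q \<and> continuous_on UNIV b \<and> bounded_borel b S \<and> bounded_borel q T \<longrightarrow>
      (\<forall>a x. \<bar>diff a b x\<bar> \<le> C * norm a * (S + T))"
proof -
  obtain R C where est: "0 < R \<and> R \<le> 1 \<and> C > 0 \<and> (\<forall>(g :: real^'n::finite \<Rightarrow> real) q A B. sol s g q \<and> continuous_on UNIV g \<and> 0 \<le> B \<and>
      (\<forall>x. \<bar>av ker R g x\<bar> \<le> A) \<and> (\<forall>x r. 0 < r \<and> r \<le> 1 \<longrightarrow> \<bar>av (bump 0) r q x\<bar> \<le> B * r powr (- 1 - 0)) \<longrightarrow>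
      (\<forall>x. \<bar>g x\<bar> \<le> C * (A + B)))"
    using sup_estimate[OF s order_refl zero_less_one] by (elim exE) (rule that)
  note RC = conjunct1[OF est] conjunct1[OF conjunct2[OF est]] conjunct1[OF conjunct2[OF conjunct2[OF est]]]
    conjunct2[OF conjunct2[OF conjunct2[OF est]], THEN spec, THEN spec, THEN spec, THEN spec, THEN mp]
  obtain C1 where C1': "C1 \<ge> 0 \<and> (\<forall>r>0. \<forall>b S a (x :: real^'n). bounded_borel b S \<longrightarrow> \<bar>av ker r (diff a b) x\<bar> \<le> C1 * S * norm a / r)"
    using av_diff_bound[OF test_function_ker] by (elim exE) (rule that)
  note C1 = conjunct1[OF C1'] C1'[THEN conjunct2, rule_format]
  obtain C2 where C2': "C2 \<ge> 0 \<and> (\<forall>r>0. \<forall>b S a (x :: real^'n). bounded_borel b S \<longrightarrow> \<bar>av (bump 0) r (diff a b) x\<bar> \<le> C2 * S * norm a / r)"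
    using av_diff_bound[OF test_function_bump[of 0]] by (elim exE) (rule that)
  note C2 = conjunct1[OF C2'] C2'[THEN conjunct2, rule_format]
  \<comment> \<open>The summand 1 secures D > 0, as C1 and C2 may both be 0.\<close>
  define D where "D = C * (C1 / R + C2) + 1"
  have D: "D > 0" using RC C1 C2 by (auto simp: D_def intro!: add_nonneg_pos)
  show ?thesis
  proof (intro exI[of _ D] conjI allI impI D)
    fix b q :: "real^'n \<Rightarrow> real" and S T :: real and a x :: "real^'n"
    assume H: "sol s b q \<and> continuous_on UNIV b \<and> bounded_borel b S \<and> bounded_borel q T"
    then have S0: "S \<ge> 0" and T0: "T \<ge> 0" using bounded_borelD(3) by blast+
    have "\<forall>x. \<bar>diff a b x\<bar> \<le> C * (C1 * S * norm a / R + C2 * T * norm a)"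
    proof (rule RC(4), intro conjI allI impI)
      show "sol s (diff a b) (diff a q)" using H sol_diff[OF s] by blast
      show "continuous_on UNIV (diff a b)" using H continuous_diff by blast
      show "0 \<le> C2 * T * norm a" using C2 T0 by simp
      show "\<bar>av ker R (diff a b) x\<bar> \<le> C1 * S * norm a / R" for x using H C1(2) RC(1) by blast
      fix x and r :: real assume "0 < r \<and> r \<le> 1"
      then show "\<bar>av (bump 0) r (diff a q) x\<bar> \<le> C2 * T * norm a * r powr (- 1 - 0)"
        using C2(2)[of r q T a x] H by (simp add: powr_minus divide_inverse)
    qed
    then have "\<bar>diff a b x\<bar> \<le> C * (C1 * S * norm a / R + C2 * T * norm a)" by blast
    also have "\<dots> \<le> C * ((C1 / R + C2) * norm a * (S + T))"
    proof (intro mult_left_mono)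
      have "C1 / R * norm a * T \<ge> 0" "C2 * norm a * S \<ge> 0" using C1 C2 RC S0 T0 by auto
      then show "C1 * S * norm a / R + C2 * T * norm a \<le> (C1 / R + C2) * norm a * (S + T)"
        by (simp add: algebra_simps add_divide_distrib)
    qed (use RC in auto)
    also have "\<dots> \<le> D * norm a * (S + T)"
      using S0 T0 by (simp add: D_def algebra_simps)
    finally show "\<bar>diff a b x\<bar> \<le> D * norm a * (S + T)" .
  qed
qed

text \<open>Two differences on Q cost r powr (- 2), the excluded case \<theta> = 1. The difference
  in a' is therefore paid in full, while for a the trivial and the linear bound are interpolated,
  which gives \<theta> = \<alpha>. Here S is a Lipschitz constant of b.\<close>

lemma second_difference_estimate:
  assumes s: "0 < s" "s < 1" and \<alpha>: "0 < \<alpha>" "\<alpha> < 1"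
  shows "\<exists>C>0. \<forall>(b :: real^'n::finite \<Rightarrow> real) q S T. sol s b q \<and> continuous_on UNIV b \<and> 0 \<le> S \<and> (\<forall>a x. \<bar>diff a b x\<bar> \<le> S * norm a) \<and> bounded_borel q T \<longrightarrow>
      (\<forall>a a' x. \<bar>diff a (diff a' b) x\<bar> \<le> C * norm a' * norm a powr \<alpha> * (S + T))"
proof -
  obtain R C where est: "0 < R \<and> R \<le> 1 \<and> C > 0 \<and> (\<forall>(g :: real^'n::finite \<Rightarrow> real) q A B. sol s g q \<and> continuous_on UNIV g \<and> 0 \<le> B \<and>
      (\<forall>x. \<bar>av ker R g x\<bar> \<le> A) \<and> (\<forall>x r. 0 < r \<and> r \<le> 1 \<longrightarrow> \<bar>av (bump 0) r q x\<bar> \<le> B * r powr (- 1 - \<alpha>)) \<longrightarrow>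
      (\<forall>x. \<bar>g x\<bar> \<le> C * (A + B)))"
    using sup_estimate[OF s less_imp_le[OF \<alpha>(1)] \<alpha>(2)] by (elim exE) (rule that)
  note RC = conjunct1[OF est] conjunct1[OF conjunct2[OF est]] conjunct1[OF conjunct2[OF conjunct2[OF est]]]
    conjunct2[OF conjunct2[OF conjunct2[OF est]], THEN spec, THEN spec, THEN spec, THEN spec, THEN mp]
  obtain C1 where C1': "C1 \<ge> 0 \<and> (\<forall>r>0. \<forall>b S a (x :: real^'n). bounded_borel b S \<longrightarrow> \<bar>av ker r (diff a b) x\<bar> \<le> C1 * S * norm a / r)"
    using av_diff_bound[OF test_function_ker] by (elim exE) (rule that)
  note C1 = conjunct1[OF C1'] C1'[THEN conjunct2, rule_format]
  obtain C2 where C2': "C2 \<ge> 0 \<and> (\<forall>r>0. \<forall>b S a (x :: real^'n). bounded_borel b S \<longrightarrow> \<bar>av (bump 0) r (diff a b) x\<bar> \<le> C2 * S * norm a / r)"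
    using av_diff_bound[OF test_function_bump[of 0]] by (elim exE) (rule that)
  note C2 = conjunct1[OF C2'] C2'[THEN conjunct2, rule_format]
  obtain C3 where C3': "C3 \<ge> 0 \<and> (\<forall>r>0. \<forall>b S a a' (x :: real^'n). bounded_borel b S \<longrightarrow> \<bar>av (bump 0) r (diff a (diff a' b)) x\<bar> \<le> C3 * S * norm a * norm a' / r\<^sup>2)"
    using av_diff2_bound[OF test_function_bump[of 0]] by (elim exE) (rule that)
  note C3 = conjunct1[OF C3'] C3'[THEN conjunct2, rule_format]
  define c where "c = (LINT z|lborel. ker (z :: real^'n))"
  have c: "c > 0" unfolding c_def by (rule ker_integral_pos)
  define D1 where "D1 = C1 / R + 2 * c"
  define D2 where "D2 = C3 + 2 * C2"
  have D12: "D1 \<ge> 0" "D2 \<ge> 0" using RC C1 C2 C3 c by (auto simp: D1_def D2_def)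
  define D where "D = C * (D1 + D2) + 1"
  have D: "D > 0" using RC D12 by (auto simp: D_def intro!: add_nonneg_pos)
  \<comment> \<open>Interpolates a trivial and a linear bound; t will be \<open>norm a\<close> at
    radius R and \<open>norm a / r\<close> for the source term.\<close>
  have split: "m \<le> (p + q) * t powr \<alpha>" if "m \<le> p * t" "m \<le> q" "0 \<le> p" "0 \<le> q" "0 \<le> t" for m p q t :: real
  proof -
    have "m \<le> (p + q) * min 1 t"
      using that by (auto simp: min_def algebra_simps intro: add_increasing add_increasing2)
    also have "\<dots> \<le> (p + q) * t powr \<alpha>" using that by (intro mult_left_mono min_1_le_powr \<alpha>) auto
    finally show ?thesis .
  qed
  show ?thesis
  proof (intro exI[of _ D] conjI allI impI D)
    fix b q :: "real^'n \<Rightarrow> real" and S T :: real and a a' x :: "real^'n"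
    assume H: "sol s b q \<and> continuous_on UNIV b \<and> 0 \<le> S \<and> (\<forall>a x. \<bar>diff a b x\<bar> \<le> S * norm a) \<and> bounded_borel q T"
    then have S0: "S \<ge> 0" and qT: "bounded_borel q T" and sb: "sol s b q" by auto
    have T0: "T \<ge> 0" by (rule bounded_borelD(3)[OF qT])
    obtain S' where b': "bounded_borel b S'" using sol_bounded(1)[OF sb] by blast
    have bd: "bounded_borel (diff a' b) (S * norm a')"
      using H diff_measurable[OF bounded_borelD(1)[OF b']] by (simp add: bounded_borel_def)
    have "\<forall>x. \<bar>diff a (diff a' b) x\<bar> \<le> C * (D1 * S * norm a' * norm a powr \<alpha> + D2 * T * norm a' * norm a powr \<alpha>)"
    proof (rule RC(4), intro conjI allI impI)
      show "sol s (diff a (diff a' b)) (diff a (diff a' q))" by (intro sol_diff[OF s] sb)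
      show "continuous_on UNIV (diff a (diff a' b))" using H by (intro continuous_diff) blast
      show "0 \<le> D2 * T * norm a' * norm a powr \<alpha>" using D12 T0 by simp
      fix x
      have 1: "\<bar>av ker R (diff a (diff a' b)) x\<bar> \<le> (C1 / R * (S * norm a')) * norm a"
        using C1(2)[OF RC(1) bd, of a x] by (simp add: mult_ac)
      have 2: "\<bar>av ker R (diff a (diff a' b)) x\<bar> \<le> 2 * c * (S * norm a')"
        using av_bound[OF bounded_borel_diff[OF bd] test_function_integrable[OF test_function_ker], of R a x]
        unfolding abs_ker_integral c_def by (simp add: mult_ac)
      have "\<bar>av ker R (diff a (diff a' b)) x\<bar> \<le> (C1 / R * (S * norm a') + 2 * c * (S * norm a')) * norm a powr \<alpha>"
        by (rule split[OF 1 2]) (use C1 RC c S0 in auto)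
      then show "\<bar>av ker R (diff a (diff a' b)) x\<bar> \<le> D1 * S * norm a' * norm a powr \<alpha>"
        by (simp add: D1_def algebra_simps)
    next
      fix x and r :: real assume "0 < r \<and> r \<le> 1"
      then have r: "0 < r" by simp
      have 1: "\<bar>av (bump 0) r (diff a (diff a' q)) x\<bar> \<le> (C3 * (T * norm a' / r)) * (norm a / r)"
        using C3(2)[OF r qT, of a a' x] by (simp add: mult_ac power2_eq_square)
      \<comment> \<open>Only a' is moved onto the kernel here; the difference in a is bounded by
        twice the bound of q.\<close>
      have 2: "\<bar>av (bump 0) r (diff a (diff a' q)) x\<bar> \<le> 2 * C2 * (T * norm a' / r)"
        using C2(2)[OF r bounded_borel_diff[OF qT], of a' a x] unfolding diff_commute[of a a'] by (simp add: mult_ac)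
      have "\<bar>av (bump 0) r (diff a (diff a' q)) x\<bar> \<le> (C3 * (T * norm a' / r) + 2 * C2 * (T * norm a' / r)) * (norm a / r) powr \<alpha>"
        by (rule split[OF 1 2]) (use C2 C3 T0 r in auto)
      also have "\<dots> = D2 * T * norm a' * (norm a / r) powr \<alpha> / r"
        by (simp add: D2_def algebra_simps add_divide_distrib)
      also have "\<dots> = D2 * T * norm a' * norm a powr \<alpha> * r powr (- 1 - \<alpha>)"
      proof -
        have rp: "r powr (- 1 - \<alpha>) = inverse (r * r powr \<alpha>)"
        proof -
          have "r powr (- 1 - \<alpha>) = inverse (r powr (1 + \<alpha>))" by (simp add: powr_minus[symmetric])
          then show ?thesis using r by (simp add: powr_add)
        qed
        have pd: "(norm a / r) powr \<alpha> = norm a powr \<alpha> / r powr \<alpha>"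
          using r by (intro powr_divide)
        show ?thesis unfolding rp pd using r by (simp add: field_simps)
      qed
      finally show "\<bar>av (bump 0) r (diff a (diff a' q)) x\<bar> \<le> D2 * T * norm a' * norm a powr \<alpha> * r powr (- 1 - \<alpha>)" .
    qed
    then have "\<bar>diff a (diff a' b) x\<bar> \<le> C * (D1 * S * norm a' * norm a powr \<alpha> + D2 * T * norm a' * norm a powr \<alpha>)" by blast
    also have "\<dots> = C * (D1 * S + D2 * T) * (norm a' * norm a powr \<alpha>)" by (simp add: algebra_simps)
    also have "\<dots> \<le> D * (S + T) * (norm a' * norm a powr \<alpha>)"
    proof (intro mult_right_mono)
      have "D1 * T \<ge> 0" "D2 * S \<ge> 0" using D12 S0 T0 by auto
      then have "C * (D1 * S + D2 * T) \<le> C * ((D1 + D2) * (S + T))"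
        using RC(3) by (intro mult_left_mono) (auto simp: algebra_simps)
      also have "\<dots> \<le> D * (S + T)" using S0 T0 by (simp add: D_def algebra_simps)
      finally show "C * (D1 * S + D2 * T) \<le> D * (S + T)" .
    qed auto
    finally show "\<bar>diff a (diff a' b) x\<bar> \<le> D * norm a' * norm a powr \<alpha> * (S + T)" by (simp add: mult_ac)
  qed
qed

text \<open>Because the radius estimate does not see the lower radius, the averages at radii 1 / (m
  + 1) are uniformly Cauchy. Their limit is continuous and equals c u0 almost everywhere.\<close>

lemma continuous_representative:
  fixes u0 q :: "real^'n::finite \<Rightarrow> real"
  assumes s: "0 < s" "s < 1" and sol: "sol s u0 q" and b: "bounded_borel u0 M"
  obtains w where "continuous_on UNIV w" "bounded_borel w M" "AE x in lborel. u0 x = w x"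
proof -
  obtain K where K: "K \<ge> 0" "\<And>(g :: real^'n \<Rightarrow> real) q S B \<theta> x \<epsilon> R. sol s g q \<and> bounded_borel g S \<and> \<theta> < 1 \<and> 0 \<le> B \<and> 0 < \<epsilon> \<and> \<epsilon> < R \<and> R \<le> 1 \<and>
      (\<forall>r. 0 < r \<and> r \<le> 1 \<longrightarrow> \<bar>av (bump 0) r q x\<bar> \<le> B * r powr (- 1 - \<theta>)) \<Longrightarrow>
      \<bar>av ker R g x - av ker \<epsilon> g x\<bar> \<le> K * S * R powr (2 - 2 * s) + B * R powr (1 - \<theta>) / (1 - \<theta>)"
    using radius_estimate[OF s] by blast
  obtain T where T: "bounded_borel q T" using sol_bounded(2)[OF sol] by blast
  define B where "B = T * (LINT z|lborel. \<bar>bump 0 (z :: real^'n)\<bar>)"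
  have B0: "B \<ge> 0" using bounded_borelD(3)[OF T] by (simp add: B_def)
  have M0: "M \<ge> 0" by (rule bounded_borelD(3)[OF b])
  \<comment> \<open>Boundedness of q is more than the case \<theta> = 0 asks for, as 1 \<le> 1 /
    r.\<close>
  have qB: "\<bar>av (bump 0) r q x\<bar> \<le> B * r powr (- 1 - 0)" if "0 < r \<and> r \<le> 1" for r x
  proof -
    have "\<bar>av (bump 0) r q x\<bar> \<le> B" unfolding B_def by (rule av_bound[OF T test_function_integrable[OF test_function_bump]])
    also have "\<dots> \<le> B * (1 / r)" using that B0 by (simp add: le_divide_eq mult_left_le)
    finally show ?thesis using that by (simp add: powr_minus divide_inverse)
  qed
  define c where "c = (LINT z|lborel. ker (z :: real^'n))"
  have c: "c > 0" unfolding c_def by (rule ker_integral_pos)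
  define F where "F = (\<lambda>m. av ker (inverse (real (Suc m))) u0)"
  define \<omega> where "\<omega> = (\<lambda>m. K * M * inverse (real (Suc m)) powr (2 - 2 * s) + B * inverse (real (Suc m)))"
  have \<omega>0: "\<omega> \<longlonglongrightarrow> 0"
  proof -
    have "\<omega> \<longlonglongrightarrow> K * M * 0 + B * 0"
      unfolding \<omega>_def using LIMSEQ_inverse_real_of_nat s
      by (intro tendsto_intros tendsto_zero_powrI[where b="2 - 2 * s"]) auto
    then show ?thesis by simp
  qed
  have est: "\<bar>F m x - F n x\<bar> \<le> \<omega> m" if "m \<le> n" for m n x
  proof (cases "m = n")
    case True
    then show ?thesis using K(1) M0 B0 by (simp add: \<omega>_def)
  next
    case False
    then have mn: "inverse (real (Suc n)) < inverse (real (Suc m))" using that by simp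
    show ?thesis
      using K(2)[of u0 q M 0 B "inverse (real (Suc n))" "inverse (real (Suc m))" x] sol b B0 mn qB
      by (simp add: F_def \<omega>_def field_simps)
  qed
  have "uniformly_Cauchy_on UNIV F"
  proof (rule uniformly_Cauchy_onI')
    fix e :: real assume "e > 0"
    then obtain N where N: "\<And>n. n \<ge> N \<Longrightarrow> \<omega> n < e"
      using order_tendstoD(2)[OF \<omega>0] by (auto simp: eventually_sequentially)
    show "\<exists>M. \<forall>x\<in>UNIV. \<forall>m\<ge>M. \<forall>n>m. dist (F m x) (F n x) < e"
    proof (intro exI[of _ N] ballI allI impI)
      fix x m n assume "N \<le> m" "m < n"
      then show "dist (F m x) (F n x) < e"
        using est[of m n x] N[of m] by (simp add: dist_real_def)
    qed
  qed
  then have "uniformly_convergent_on UNIV F" by (rule Cauchy_uniformly_convergent)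
  then obtain H where H: "uniform_limit UNIV F H sequentially" by (auto simp: uniformly_convergent_on_def)
  have contH: "continuous_on UNIV H"
  proof (rule uniform_limit_theorem[OF _ H])
    show "\<forall>\<^sub>F n in sequentially. continuous_on UNIV (F n)"
      unfolding F_def by (intro always_eventually allI av_continuous[OF test_function_ker b]) simp
  qed simp
  have lim: "(\<lambda>m. F m x) \<longlonglongrightarrow> H x" for x by (rule tendsto_uniform_limitI[OF H]) simp
  have bound: "\<bar>F m x\<bar> \<le> M * c" for m x
    using av_bound[OF b test_function_integrable[OF test_function_ker]] unfolding abs_ker_integral F_def c_def .
  have Hb: "\<bar>H x\<bar> \<le> M * c" for x
    by (rule LIMSEQ_le_const2[OF tendsto_rabs[OF lim[of x]]]) (use bound in auto)
  have Hm: "H \<in> borel_measurable borel" by (rule borel_measurable_continuous_onI[OF contH])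
  have ae: "AE x in lborel. H x = c * u0 x"
    unfolding c_def
    by (rule mollification_limit_AE[OF test_function_ker, where C="M * c"])
      (use bounded_borel_imp_locally_integrable[OF b] lim bound Hm in \<open>auto simp: locally_integrable_borel_def F_def\<close>)
  show ?thesis
  proof (rule that[of "\<lambda>x. H x / c"])
    show "continuous_on UNIV (\<lambda>x. H x / c)" using contH c by (intro continuous_intros) auto
    show "bounded_borel (\<lambda>x. H x / c) M"
      using Hm Hb c by (auto simp: bounded_borel_def pos_divide_le_eq abs_of_pos)
    show "AE x in lborel. u0 x = H x / c" using ae by eventually_elim (use c in simp)
  qed
qed

section \<open>Differentiability from difference bounds\<close>

lemma partial_limit:
  fixes F :: "real^'n::finite \<Rightarrow> real"
  assumes "F differentiable (at x)"
  shows "((\<lambda>t. diff (t *\<^sub>R axis i 1) F x / t) \<longlongrightarrow> partial i F x) (at 0)"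
proof -
  have g: "((\<lambda>t. x + t *\<^sub>R axis i (1::real)) has_derivative (\<lambda>\<tau>. \<tau> *\<^sub>R axis i 1)) (at 0)"
    by (auto intro!: derivative_eq_intros)
  have "(F has_derivative (\<lambda>v. \<Sum>j\<in>UNIV. v $ j * partial j F x)) (at (x + 0 *\<^sub>R axis i (1::real)))"
    using has_derivative_partials[OF assms] by simp
  from has_derivative_compose[OF g this]
  have "((\<lambda>t. F (x + t *\<^sub>R axis i 1)) has_derivative (\<lambda>\<tau>. \<tau> * partial i F x)) (at 0)"
    by (rule has_derivative_eq_rhs)
      (rule ext, simp add: axis_def if_distrib[where f="\<lambda>z. _ * z * _"] if_distrib[where f="\<lambda>z. z * _"] cong: if_cong)
  then have "((\<lambda>t. F (x + t *\<^sub>R axis i 1)) has_real_derivative partial i F x) (at 0)"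
    by (simp add: has_field_derivative_def mult.commute[of _ "partial i F x"])
  then show ?thesis by (simp add: DERIV_def diff_def)
qed

lemma tendsto_abs_upperbound:
  fixes f :: "real \<Rightarrow> real"
  assumes "(f \<longlongrightarrow> l) (at 0)" and "\<And>t. t \<noteq> 0 \<Longrightarrow> \<bar>f t\<bar> \<le> B"
  shows "\<bar>l\<bar> \<le> B"
proof (rule tendsto_upperbound[OF tendsto_rabs[OF assms(1)]])
  show "\<forall>\<^sub>F t in at 0. \<bar>f t\<bar> \<le> B" using assms(2) by (auto simp: eventually_at_filter)
qed simp

text \<open>Dividing by the step t and letting it tend to 0 exchanges the innermost difference for a
  partial derivative; the outer differences are finite combinations of values and survive the
  limit.\<close>

lemma partial_bounds:
  fixes F :: "real^'n::finite \<Rightarrow> real"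
  assumes d: "\<And>x. F differentiable (at x)"
  shows "(\<And>t. t \<noteq> 0 \<Longrightarrow> \<bar>diff (t *\<^sub>R axis i 1) F x\<bar> \<le> B * \<bar>t\<bar>) \<Longrightarrow> \<bar>partial i F x\<bar> \<le> B"
    and "(\<And>t. t \<noteq> 0 \<Longrightarrow> \<bar>diff a (diff (t *\<^sub>R axis i 1) F) x\<bar> \<le> B * \<bar>t\<bar>) \<Longrightarrow> \<bar>diff a (partial i F) x\<bar> \<le> B"
    and "(\<And>t. t \<noteq> 0 \<Longrightarrow> \<bar>diff a (diff b (diff (t *\<^sub>R axis i 1) F)) x\<bar> \<le> B * \<bar>t\<bar>) \<Longrightarrow> \<bar>diff a (diff b (partial i F)) x\<bar> \<le> B"
proof -
  note l = partial_limit[OF d]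
  have q: "\<bar>m / t\<bar> \<le> B" if "t \<noteq> 0" "\<bar>m\<bar> \<le> B * \<bar>t\<bar>" for m t :: real
    using that by (simp add: divide_le_eq)
  show "\<bar>partial i F x\<bar> \<le> B" if "\<And>t. t \<noteq> 0 \<Longrightarrow> \<bar>diff (t *\<^sub>R axis i 1) F x\<bar> \<le> B * \<bar>t\<bar>"
    by (rule tendsto_abs_upperbound[OF l]) (use that q in blast)
  show "\<bar>diff a (partial i F) x\<bar> \<le> B" if h: "\<And>t. t \<noteq> 0 \<Longrightarrow> \<bar>diff a (diff (t *\<^sub>R axis i 1) F) x\<bar> \<le> B * \<bar>t\<bar>"
  proof (rule tendsto_abs_upperbound)
    show "((\<lambda>t. diff (t *\<^sub>R axis i 1) F (x + a) / t - diff (t *\<^sub>R axis i 1) F x / t) \<longlongrightarrow> diff a (partial i F) x) (at 0)"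
      unfolding diff_def[of a] by (intro tendsto_diff l)
    fix t :: real assume "t \<noteq> 0"
    from q[OF this h[OF this]]
    show "\<bar>diff (t *\<^sub>R axis i 1) F (x + a) / t - diff (t *\<^sub>R axis i 1) F x / t\<bar> \<le> B"
      unfolding diff_def[of a] diff_divide_distrib .
  qed
  show "\<bar>diff a (diff b (partial i F)) x\<bar> \<le> B" if h: "\<And>t. t \<noteq> 0 \<Longrightarrow> \<bar>diff a (diff b (diff (t *\<^sub>R axis i 1) F)) x\<bar> \<le> B * \<bar>t\<bar>"
  proof (rule tendsto_abs_upperbound)
    show "((\<lambda>t. (diff (t *\<^sub>R axis i 1) F (x + a + b) / t - diff (t *\<^sub>R axis i 1) F (x + a) / t)
        - (diff (t *\<^sub>R axis i 1) F (x + b) / t - diff (t *\<^sub>R axis i 1) F x / t)) \<longlongrightarrow> diff a (diff b (partial i F)) x) (at 0)"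
      unfolding diff_def[of a] diff_def[of b] by (intro tendsto_diff l)
    fix t :: real assume "t \<noteq> 0"
    from q[OF this h[OF this]]
    show "\<bar>(diff (t *\<^sub>R axis i 1) F (x + a + b) / t - diff (t *\<^sub>R axis i 1) F (x + a) / t)
        - (diff (t *\<^sub>R axis i 1) F (x + b) / t - diff (t *\<^sub>R axis i 1) F x / t)\<bar> \<le> B"
      unfolding diff_def[of a] diff_def[of b] diff_divide_distrib .
  qed
qed

text \<open>Up to an error of order \<open>t powr \<alpha>\<close>, the partial derivatives of the mollifications are difference quotients with
  step \<open>t\<close>, and these converge uniformly; so the partial derivatives form a uniform Cauchy sequence.\<close>

lemma differentiable_of_difference_bounds:
  fixes F :: "real^'n::finite \<Rightarrow> real"
  assumes b: "bounded_borel F S" and L: "\<And>a x. \<bar>diff a F x\<bar> \<le> L * norm a"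
    and K: "\<And>a a' x. \<bar>diff a (diff a' F) x\<bar> \<le> K * norm a' * norm a powr \<alpha>" and \<alpha>: "0 < \<alpha>"
  shows "F differentiable (at x)"
proof -
  define c where "c = (LINT z|lborel. ker (z :: real^'n))"
  have c: "c > 0" unfolding c_def by (rule ker_integral_pos)
  \<comment> \<open>Unit steps in the difference bounds show that L and K are nonnegative.\<close>
  have L0: "L \<ge> 0" using order_trans[OF abs_ge_zero L[of "axis undefined 1" 0]] by simp
  have K0: "K \<ge> 0" using order_trans[OF abs_ge_zero K[of "axis undefined 1" "axis undefined 1" 0]] by simp
  define r where "r = (\<lambda>m. inverse (real (Suc m)))"
  have r: "r m > 0" for m by (simp add: r_def)
  have r0: "r \<longlonglongrightarrow> 0" unfolding r_def by (rule LIMSEQ_inverse_real_of_nat)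
  note ki = test_function_integrable[OF test_function_ker]
  have Fm: "F \<in> borel_measurable borel" by (rule bounded_borelD(1)[OF b])
  define V where "V = (\<lambda>m x. av ker (r m) F x / c)"
  define P where "P = (\<lambda>m i x. partial i (V m) x)"
  have Vd: "V m differentiable (at x)" for m x
  proof -
    have "av ker (r m) F differentiable (at x)"
      using av_has_derivative[OF test_function_ker b r] by (auto simp: differentiable_def)
    then have "(\<lambda>x. inverse c * av ker (r m) F x) differentiable (at x)" by (intro derivative_intros)
    then show ?thesis by (simp add: V_def divide_inverse mult.commute)
  qed
  have Vdd: "diff a (diff a' (V m)) x = av ker (r m) (diff a (diff a' F)) x / c" for a a' m x
    unfolding av_diff[OF bounded_borel_diff[OF b] ki]
    unfolding diff_def[of a] av_diff[OF b ki] unfolding diff_def[of a'] V_def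
    by (simp add: diff_divide_distrib)
  have avb: "\<bar>av ker (r m) G x\<bar> / c \<le> B" if "bounded_borel G B" for G :: "real^'n \<Rightarrow> real" and B m x
    using av_bound[OF that ki, of "r m" x] c unfolding abs_ker_integral by (simp add: pos_divide_le_eq c_def)
  have VK: "\<bar>diff a (diff a' (V m)) x\<bar> \<le> K * norm a' * norm a powr \<alpha>" for a a' m x
  proof -
    have "bounded_borel (diff a (diff a' F)) (K * norm a' * norm a powr \<alpha>)"
      using K diff_measurable[OF diff_measurable[OF Fm]] by (simp add: bounded_borel_def)
    from avb[OF this, of m x] show ?thesis unfolding Vdd using c by (simp add: abs_divide)
  qed
  have PK: "\<bar>diff a (P m i) x\<bar> \<le> K * norm a powr \<alpha>" for a m i x
    unfolding P_def
  proof (rule partial_bounds(2)[OF Vd])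
    fix t :: real
    show "\<bar>diff a (diff (t *\<^sub>R axis i 1) (V m)) x\<bar> \<le> K * norm a powr \<alpha> * \<bar>t\<bar>"
      using VK[of a "t *\<^sub>R axis i 1" m x] by (simp add: mult_ac)
  qed
  have VF: "\<bar>V m x - F x\<bar> \<le> L * r m" for m x
  proof -
    have i1: "integrable lborel (\<lambda>z. F (x + r m *\<^sub>R z) * ker z)" by (rule av_integrable[OF b ki])
    have i2: "integrable lborel (\<lambda>z::real^'n. F x * ker z)" using ki by (rule integrable_mult_right)
    have "av ker (r m) F x - F x * c = (LINT z|lborel. F (x + r m *\<^sub>R z) * ker z - F x * ker z)"
      unfolding av_def c_def using i1 i2 by simp
    also have "\<bar>\<dots>\<bar> \<le> (LINT z|lborel. \<bar>F (x + r m *\<^sub>R z) * ker z - F x * ker z\<bar>)" by (rule integral_abs_bound)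
    also have "\<dots> \<le> (LINT z|lborel. L * r m * ker (z :: real^'n))"
    proof (rule integral_mono)
      fix z :: "real^'n"
      have kz: "ker z \<ge> 0" by (simp add: ker_def bump_nonneg)
      show "\<bar>F (x + r m *\<^sub>R z) * ker z - F x * ker z\<bar> \<le> L * r m * ker z"
      proof (cases "norm z \<ge> 1")
        case True
        then show ?thesis by (simp add: ker_def bump_eq_0)
      next
        case False
        have "\<bar>F (x + r m *\<^sub>R z) - F x\<bar> \<le> L * norm (r m *\<^sub>R z)" using L[of "r m *\<^sub>R z" x] by (simp add: diff_def)
        also have "\<dots> \<le> L * r m" using False r[of m] L0 by (intro mult_left_mono) auto
        finally have "\<bar>F (x + r m *\<^sub>R z) - F x\<bar> * ker z \<le> L * r m * ker z" using kz by (rule mult_right_mono)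
        then show ?thesis using kz by (simp add: left_diff_distrib[symmetric] abs_mult)
      qed
    qed (use i1 i2 ki in auto)
    also have "\<dots> = L * r m * c" by (simp add: c_def)
    finally have "\<bar>av ker (r m) F x - F x * c\<bar> / c \<le> L * r m" using c by (simp add: pos_divide_le_eq)
    moreover have "V m x - F x = (av ker (r m) F x - F x * c) / c" using c by (simp add: V_def diff_divide_distrib)
    ultimately show ?thesis using c by (simp add: abs_divide)
  qed
  \<comment> \<open>By the mean value theorem the quotient is the same partial derivative at a point
    less than t away, and the partials satisfy a Hoelder bound uniform in m.\<close>
  have quot: "\<bar>P m i x - diff (t *\<^sub>R axis i 1) (V m) x / t\<bar> \<le> K * t powr \<alpha>" if t: "t > 0" for m i x t
  proof -
    obtain \<tau> where \<tau>: "0 < \<tau>" "\<tau> < 1" "V m (x + t *\<^sub>R axis i 1) - V m x = (\<Sum>j\<in>UNIV. (t *\<^sub>R axis i 1) $ j * partial j (V m) (x + \<tau> *\<^sub>R t *\<^sub>R axis i 1))"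
      using mean_value_partials[OF Vd] by blast
    have "(\<Sum>j\<in>UNIV. (t *\<^sub>R axis i 1) $ j * partial j (V m) (x + \<tau> *\<^sub>R t *\<^sub>R axis i 1)) = t * P m i (x + \<tau> *\<^sub>R t *\<^sub>R axis i 1)"
      by (simp add: P_def axis_def if_distrib[where f="\<lambda>z. _ * z * _"] cong: if_cong)
    then have "diff (t *\<^sub>R axis i 1) (V m) x / t = P m i (x + \<tau> *\<^sub>R t *\<^sub>R axis i 1)"
      using \<tau>(3) t by (simp add: diff_def)
    then have "\<bar>P m i x - diff (t *\<^sub>R axis i 1) (V m) x / t\<bar> = \<bar>diff (\<tau> *\<^sub>R t *\<^sub>R axis i 1) (P m i) x\<bar>"
      by (simp add: diff_def abs_minus_commute)
    also have "\<dots> \<le> K * norm (\<tau> *\<^sub>R t *\<^sub>R (axis i 1 :: real^'n)) powr \<alpha>" by (rule PK)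
    also have "\<dots> \<le> K * t powr \<alpha>"
      using \<tau> t \<alpha> K0 by (intro mult_left_mono powr_mono2) (auto intro: mult_left_le_one_le)
    finally show ?thesis .
  qed
  have PP: "\<bar>P m i x - P n i x\<bar> \<le> 2 * K * t powr \<alpha> + 2 * L * (r m + r n) / t" if t: "t > 0" for m n i x t
  proof -
    let ?e = "t *\<^sub>R axis i 1 :: real^'n"
    have "\<bar>diff ?e (V m) x / t - diff ?e (V n) x / t\<bar> \<le> 2 * L * (r m + r n) / t"
    proof -
      have "\<bar>diff ?e (V m) x - diff ?e (V n) x\<bar> \<le> 2 * L * (r m + r n)"
        using VF[of m "x + ?e"] VF[of n "x + ?e"] VF[of m x] VF[of n x] unfolding diff_def
        by (simp add: distrib_left)
      then show ?thesis using t by (simp add: diff_divide_distrib[symmetric] abs_divide divide_right_mono)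
    qed
    with quot[OF t, of m i x] quot[OF t, of n i x] show ?thesis by linarith
  qed
  have small: "\<exists>N. \<forall>m\<ge>N. \<forall>n\<ge>N. \<forall>i x. \<bar>P m i x - P n i x\<bar> \<le> e" if e: "e > 0" for e
  proof -
    \<comment> \<open>The step is fixed first, so that the Hoelder error takes at most half of e;
      the radii are then made small relative to this t.\<close>
    define t where "t = (e / (4 * (K + 1))) powr (1 / \<alpha>)"
    have t: "t > 0" using e K0 by (simp add: t_def)
    have "t powr \<alpha> = e / (4 * (K + 1))" using e K0 \<alpha> by (simp add: t_def powr_powr)
    then have "2 * K * t powr \<alpha> = K / (K + 1) * (e / 2)" using K0 by (simp add: field_simps)
    also have "\<dots> \<le> 1 * (e / 2)" using K0 e by (intro mult_right_mono) auto
    finally have 1: "2 * K * t powr \<alpha> \<le> e / 2" by simp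
    have "(\<lambda>m. 4 * L * r m / t) \<longlonglongrightarrow> 4 * L * 0 / t" using t by (intro tendsto_intros r0) auto
    then have "\<forall>\<^sub>F m in sequentially. 4 * L * r m / t < e / 2" using e by (intro order_tendstoD(2)) auto
    then obtain N where N: "\<And>m. m \<ge> N \<Longrightarrow> 4 * L * r m / t < e / 2" by (auto simp: eventually_sequentially)
    show ?thesis
    proof (intro exI[of _ N] allI impI)
      fix m n i x assume "m \<ge> N" "n \<ge> N"
      then have "2 * (2 * L * (r m + r n) / t) \<le> 2 * (e / 2)"
        using N[of m] N[of n] by (simp add: distrib_left add_divide_distrib)
      with PP[OF t, of m i x n] 1 show "\<bar>P m i x - P n i x\<bar> \<le> e" by linarith
    qed
  qed
  have conv: "convergent (\<lambda>m. P m i x)" for i x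
    unfolding Cauchy_convergent_iff[symmetric]
  proof (rule metric_CauchyI)
    fix e :: real assume e: "e > 0"
    then have "e / 2 > 0" by simp
    from small[OF this] obtain N where N: "\<forall>m\<ge>N. \<forall>n\<ge>N. \<forall>i x. \<bar>P m i x - P n i x\<bar> \<le> e / 2" ..
    show "\<exists>N. \<forall>m\<ge>N. \<forall>n\<ge>N. dist (P m i x) (P n i x) < e"
    proof (intro exI[of _ N] allI impI)
      fix m n assume mn: "m \<ge> N" "n \<ge> N"
      have "\<bar>P m i x - P n i x\<bar> \<le> e / 2" using N mn by blast
      then show "dist (P m i x) (P n i x) < e" using e by (simp add: dist_real_def)
    qed
  qed
  define Q where "Q = (\<lambda>i x. lim (\<lambda>m. P m i x))"
  have PQ: "(\<lambda>m. P m i x) \<longlonglongrightarrow> Q i x" for i x unfolding Q_def using conv convergent_LIMSEQ_iff by blast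
  have unif: "\<exists>N. \<forall>m\<ge>N. \<forall>i x. \<bar>P m i x - Q i x\<bar> \<le> e" if "e > 0" for e
  proof -
    obtain N where N: "\<forall>m\<ge>N. \<forall>n\<ge>N. \<forall>i x. \<bar>P m i x - P n i x\<bar> \<le> e" using small[OF \<open>e > 0\<close>] ..
    have "\<bar>P m i x - Q i x\<bar> \<le> e" if "m \<ge> N" for m i x
    proof (rule LIMSEQ_le_const2)
      show "(\<lambda>n. \<bar>P m i x - P n i x\<bar>) \<longlonglongrightarrow> \<bar>P m i x - Q i x\<bar>" by (intro tendsto_intros PQ)
      show "\<exists>N'. \<forall>n\<ge>N'. \<bar>P m i x - P n i x\<bar> \<le> e" using N that by blast
    qed
    then show ?thesis by blast
  qed
  have VtoF: "(\<lambda>m. V m x) \<longlonglongrightarrow> F x" for x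
  proof (rule LIM_zero_cancel, rule Lim_null_comparison)
    show "\<forall>\<^sub>F m in sequentially. norm (V m x - F x) \<le> L * r m" using VF by simp
    have "(\<lambda>m. L * r m) \<longlonglongrightarrow> L * 0" by (intro tendsto_intros r0)
    then show "(\<lambda>m. L * r m) \<longlonglongrightarrow> 0" by simp
  qed
  \<comment> \<open>The functions converge pointwise and the derivatives uniformly, so the limit is
    differentiable with derivative built from Q.\<close>
  have "\<exists>g. \<forall>x\<in>UNIV. (\<lambda>m. V m x) \<longlonglongrightarrow> g x \<and> (g has_derivative (\<lambda>v. \<Sum>i\<in>UNIV. v $ i * Q i x)) (at x within UNIV)"
  proof (rule has_derivative_sequence[where f'="\<lambda>m x v. \<Sum>i\<in>UNIV. v $ i * P m i x"])
    show "(V m has_derivative (\<lambda>v. \<Sum>i\<in>UNIV. v $ i * P m i x)) (at x within UNIV)" for m x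
      using has_derivative_partials[OF Vd] by (simp add: P_def)
    fix e :: real assume e: "e > 0"
    then obtain N where N: "\<forall>m\<ge>N. \<forall>i x. \<bar>P m i x - Q i x\<bar> \<le> e / real CARD('n)"
      using unif[of "e / real CARD('n)"] by auto
    show "\<forall>\<^sub>F m in sequentially. \<forall>x\<in>UNIV. \<forall>h. norm ((\<Sum>i\<in>UNIV. h $ i * P m i x) - (\<Sum>i\<in>UNIV. h $ i * Q i x)) \<le> e * norm h"
      unfolding eventually_sequentially
    proof (intro exI[of _ N] allI impI ballI)
      fix m x and h :: "real^'n" assume m: "m \<ge> N"
      have "norm ((\<Sum>i\<in>UNIV. h $ i * P m i x) - (\<Sum>i\<in>UNIV. h $ i * Q i x)) = \<bar>\<Sum>i\<in>UNIV. h $ i * (P m i x - Q i x)\<bar>"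
        by (simp add: sum_subtractf right_diff_distrib)
      also have "\<dots> \<le> (\<Sum>i\<in>(UNIV::'n set). norm h * (e / real CARD('n)))"
      proof (rule order_trans[OF sum_abs], intro sum_mono)
        fix i show "\<bar>h $ i * (P m i x - Q i x)\<bar> \<le> norm h * (e / real CARD('n))"
          unfolding abs_mult using N m by (intro mult_mono component_le_norm_cart) auto
      qed
      also have "\<dots> = e * norm h" by simp
      finally show "norm ((\<Sum>i\<in>UNIV. h $ i * P m i x) - (\<Sum>i\<in>UNIV. h $ i * Q i x)) \<le> e * norm h" .
    qed
  qed (use VtoF[of 0] in auto)
  then obtain g where g: "\<And>x. (\<lambda>m. V m x) \<longlonglongrightarrow> g x" "\<And>x. (g has_derivative (\<lambda>v. \<Sum>i\<in>UNIV. v $ i * Q i x)) (at x)"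
    by auto
  have "g = F" using LIMSEQ_unique[OF g(1) VtoF] by blast
  then show ?thesis using g(2) by (auto simp: differentiable_def)
qed

section \<open>The power nonlinearity, representatives and the final bounds\<close>

lemma norm_vec_le_sum:
  fixes x :: "'a::real_normed_vector ^ 'n::finite"
  shows "norm x \<le> (\<Sum>i\<in>UNIV. norm (x $ i))"
  unfolding norm_vec_def by (rule L2_set_le_sum) simp

text \<open>For M \<le> 1 the exponent 1 dominates, otherwise b does; this is the source of the
  maximum in the final estimate.\<close>

lemma powr_le_max:
  fixes M a b :: real
  assumes "0 \<le> M" "1 \<le> a" "a \<le> b"
  shows "M powr a \<le> max (M powr b) M"
proof (cases "M \<le> 1")
  case True
  have "M powr a \<le> M powr 1"
    using powr_mono'[of 1 a M] assms True by (cases "M = 0") auto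
  then show ?thesis using assms by simp
next
  case False
  then have "M powr a \<le> M powr b" using assms by (intro powr_mono) auto
  then show ?thesis by simp
qed

text \<open>As p > 1, the derivative \<open>p * \<bar>t\<bar> powr (p - 1)\<close> exists at 0 as
  well, and it is largest at the ends of [-M, M].\<close>

lemma abs_powr_Lipschitz:
  fixes p M :: real
  assumes p: "p > 1" and a: "\<bar>a\<bar> \<le> M" and b: "\<bar>b\<bar> \<le> M"
  shows "\<bar>\<bar>a\<bar> powr (p - 1) * a - \<bar>b\<bar> powr (p - 1) * b\<bar> \<le> p * M powr (p - 1) * \<bar>a - b\<bar>"
proof -
  have der: "((\<lambda>t. \<bar>t\<bar> powr (p - 1) * t) has_real_derivative p * \<bar>t\<bar> powr (p - 1)) (at t)" for t :: real
  proof -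
    consider "t > 0" | "t < 0" | "t = 0" by linarith
    then show ?thesis
    proof cases
      case 1
      have "((\<lambda>t. t powr p) has_real_derivative p * t powr (p - 1)) (at t)" using 1 by (rule has_real_derivative_powr)
      then have "((\<lambda>t. t powr p) has_real_derivative p * \<bar>t\<bar> powr (p - 1)) (at t)" using 1 by simp
      then show ?thesis
      proof (rule has_field_derivative_transform_within_open[where S="{0<..}"])
        fix x :: real assume "x \<in> {0<..}"
        then show "x powr p = \<bar>x\<bar> powr (p - 1) * x" by (simp add: powr_diff)
      qed (use 1 in auto)
    next
      case 2
      have "((\<lambda>t. - ((- t) powr p)) has_real_derivative - (p * (- t) powr (p - 1) * (- 1))) (at t)"
        using 2 by (intro DERIV_minus DERIV_chain2[where f="\<lambda>t. t powr p" and g="\<lambda>t. - t"] has_real_derivative_powr)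
          (auto intro!: derivative_eq_intros)
      then have "((\<lambda>t. - ((- t) powr p)) has_real_derivative p * \<bar>t\<bar> powr (p - 1)) (at t)" using 2 by simp
      then show ?thesis
      proof (rule has_field_derivative_transform_within_open[where S="{..<0}"])
        fix x :: real assume "x \<in> {..<0}"
        then show "- ((- x) powr p) = \<bar>x\<bar> powr (p - 1) * x" by (simp add: powr_diff)
      qed (use 2 in auto)
    next
      case 3
      have "((\<lambda>h. \<bar>h\<bar> powr (p - 1)) \<longlongrightarrow> 0) (at (0::real))"
      proof (rule tendsto_zero_powrI)
        have "((\<lambda>h::real. \<bar>h\<bar>) \<longlongrightarrow> \<bar>0\<bar>) (at 0)" by (intro tendsto_intros)
        then show "((\<lambda>h::real. \<bar>h\<bar>) \<longlongrightarrow> 0) (at 0)" by simp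
      qed (use p in \<open>auto intro: tendsto_const\<close>)
      then have "((\<lambda>h. (\<bar>0 + h\<bar> powr (p - 1) * (0 + h) - \<bar>0\<bar> powr (p - 1) * 0) / h) \<longlongrightarrow> 0) (at (0::real))"
        by (rule Lim_transform_eventually) (auto simp: eventually_at_filter)
      then show ?thesis using 3 p by (simp add: DERIV_def)
    qed
  qed
  have "norm (\<bar>a\<bar> powr (p - 1) * a - \<bar>b\<bar> powr (p - 1) * b) \<le> p * M powr (p - 1) * norm (a - b)"
  proof (rule field_differentiable_bound[where S="{-M..M}"])
    fix t assume t: "t \<in> {-M..M}"
    show "((\<lambda>t. \<bar>t\<bar> powr (p - 1) * t) has_field_derivative p * \<bar>t\<bar> powr (p - 1)) (at t within {-M..M})"
      by (rule has_field_derivative_at_within[OF der])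
    show "norm (p * \<bar>t\<bar> powr (p - 1)) \<le> p * M powr (p - 1)"
      using t p by (auto simp: abs_mult intro!: mult_left_mono powr_mono2)
  qed (use a b in auto)
  then show ?thesis by simp
qed

lemma Linfty_borel_representative:
  fixes u :: "real^'n::finite \<Rightarrow> real"
  assumes u: "u \<in> Linfty"
  obtains u0 where "bounded_borel u0 (Linfty_norm u)" "AE x in lebesgue. u x = u0 x"
proof -
  have m: "u \<in> borel_measurable lebesgue" and fin: "esssup lebesgue (\<lambda>x. ereal \<bar>u x\<bar>) < \<infinity>"
    using u by (auto simp: Linfty_def)
  define e where "e = esssup lebesgue (\<lambda>x. ereal \<bar>u x\<bar>)"
  \<comment> \<open>Comparison with 0 excludes the value \<open>-\<infinity>\<close>, so that e is a
    real number.\<close>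
  have "esssup lebesgue (\<lambda>x::real^'n. 0 :: ereal) \<le> e" unfolding e_def by (rule esssup_mono) auto
  moreover have "esssup lebesgue (\<lambda>x::real^'n. 0 :: ereal) = 0" by (rule esssup_const) simp
  ultimately have e0: "0 \<le> e" by simp
  define M where "M = Linfty_norm u"
  have eM: "e = ereal M" using e0 fin by (cases e) (auto simp: M_def Linfty_norm_def e_def[symmetric])
  have M0: "M \<ge> 0" using e0 eM by simp
  have ae: "AE x in lebesgue. \<bar>u x\<bar> \<le> M"
    using esssup_AE[of "\<lambda>x. ereal \<bar>u x\<bar>" lebesgue] unfolding e_def[symmetric] eM by simp
  obtain u1 where u1: "u1 \<in> borel_measurable lborel" "AE x in lborel. u x = u1 x"
    using completion_ex_borel_measurable_real[OF m] by blast
  have u1m[measurable]: "u1 \<in> borel_measurable borel" using u1(1) by simp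
  show ?thesis
  \<comment> \<open>Truncation to [-M, M] changes nothing almost everywhere, but makes the bound
    hold at every point.\<close>
  proof (rule that[of "\<lambda>x. max (- M) (min M (u1 x))"])
    show "bounded_borel (\<lambda>x. max (- M) (min M (u1 x))) (Linfty_norm u)"
      unfolding bounded_borel_def M_def[symmetric] using M0 by (auto simp: abs_le_iff)
    show "AE x in lebesgue. u x = max (- M) (min M (u1 x))"
      using ae AE_completion[OF u1(2)] by eventually_elim auto
  qed
qed

lemma continuous_of_difference_bound:
  fixes F :: "real^'n::finite \<Rightarrow> real"
  assumes K: "\<And>a x. \<bar>diff a F x\<bar> \<le> K * norm a powr \<alpha>" and \<alpha>: "0 < \<alpha>"
  shows "continuous_on UNIV F"
  unfolding continuous_on_eq_continuous_at[OF open_UNIV]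
proof (intro ballI)
  fix x
  have "((\<lambda>h. F (x + h)) \<longlongrightarrow> F x) (at 0)"
  proof (rule LIM_zero_cancel, rule Lim_null_comparison)
    show "\<forall>\<^sub>F h in at 0. norm (F (x + h) - F x) \<le> K * norm h powr \<alpha>" using K[of _ x] by (simp add: diff_def)
    have "((\<lambda>h::real^'n. norm h powr \<alpha>) \<longlongrightarrow> 0) (at 0)"
    proof (rule tendsto_zero_powrI)
      have "((\<lambda>h::real^'n. norm h) \<longlongrightarrow> norm (0::real^'n)) (at 0)" by (intro tendsto_intros)
      then show "((\<lambda>h::real^'n. norm h) \<longlongrightarrow> 0) (at 0)" by simp
    qed (use \<alpha> in \<open>auto intro: tendsto_const\<close>)
    from tendsto_mult[OF tendsto_const[of K] this] show "((\<lambda>h::real^'n. K * norm h powr \<alpha>) \<longlongrightarrow> 0) (at 0)" by simp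
  qed
  then show "isCont F x" by (simp add: isCont_iff)
qed

text \<open>The third difference bound does double duty: it makes the first partials differentiable
  and bounds the Hoelder quotients of the Hessian. The powers of CARD('n) come from estimating norms
  by sums of entries.\<close>

lemma C2_holder_of_difference_bounds:
  fixes w :: "real^'n::finite \<Rightarrow> real"
  assumes b: "bounded_borel w M" and \<alpha>: "0 < \<alpha>"
    and 1: "\<And>a x. \<bar>diff a w x\<bar> \<le> L1 * norm a"
    and 2: "\<And>a a' x. \<bar>diff a (diff a' w) x\<bar> \<le> L2 * norm a' * norm a"
    and 3: "\<And>a a' a'' x. \<bar>diff a (diff a' (diff a'' w)) x\<bar> \<le> L3 * norm a'' * norm a' * norm a powr \<alpha>"
  shows "w \<in> C2_holder \<alpha>"
    and "C2_holder_norm \<alpha> w \<le> M + real CARD('n) * L1 + (real CARD('n))\<^sup>2 * L2 + (real CARD('n))\<^sup>2 * L3"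
proof -
  \<comment> \<open>The differentiability criterion is used with exponent 1 here, and with exponent
    \<alpha> for the first partials.\<close>
  have wd: "w differentiable (at x)" for x
    by (rule differentiable_of_difference_bounds[OF b 1, where K=L2 and \<alpha>=1]) (use 2 in auto)
  have g1: "\<bar>partial i w x\<bar> \<le> L1" for i x
    by (rule partial_bounds(1)[OF wd]) (use 1[of "_ *\<^sub>R axis i 1" x] in simp)
  have g2: "\<bar>diff a (partial i w) x\<bar> \<le> L2 * norm a" for a i x
    by (rule partial_bounds(2)[OF wd]) (use 2[of a "_ *\<^sub>R axis i 1" x] in \<open>simp add: mult_ac\<close>)
  have g3: "\<bar>diff a (diff a' (partial i w)) x\<bar> \<le> L3 * norm a' * norm a powr \<alpha>" for a a' i x
    by (rule partial_bounds(3)[OF wd]) (use 3[of a a' "_ *\<^sub>R axis i 1" x] in \<open>simp add: mult_ac\<close>)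
  have gc: "continuous_on UNIV (partial i w)" for i
    by (rule continuous_of_difference_bound[where K=L2 and \<alpha>=1]) (use g2 in auto)
  have gb: "bounded_borel (partial i w) L1" for i
    using g1 borel_measurable_continuous_onI[OF gc] by (simp add: bounded_borel_def)
  have gd: "partial i w differentiable (at x)" for i x
    by (rule differentiable_of_difference_bounds[OF gb g2 g3 \<alpha>])
  have h1: "\<bar>partial j (partial i w) x\<bar> \<le> L2" for i j x
    by (rule partial_bounds(1)[OF gd]) (use g2[of "_ *\<^sub>R axis j 1" i x] in simp)
  have h2: "\<bar>diff a (partial j (partial i w)) x\<bar> \<le> L3 * norm a powr \<alpha>" for a i j x
    by (rule partial_bounds(2)[OF gd]) (use g3[of a "_ *\<^sub>R axis j 1" i x] in \<open>simp add: mult_ac\<close>)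
  have hc: "continuous_on UNIV (partial j (partial i w))" for i j
    by (rule continuous_of_difference_bound[OF h2 \<alpha>])
  have Ck: "Ck 2 w" using wd gd hc by (simp add: numeral_2_eq_2)
  have wb: "\<bar>w x\<bar> \<le> M" for x by (rule bounded_borelD(2)[OF b])
  have Gb: "norm (gradient w x) \<le> real CARD('n) * L1" for x
  proof -
    have "norm (gradient w x) \<le> (\<Sum>i\<in>UNIV. norm (gradient w x $ i))" by (rule norm_vec_le_sum)
    also have "\<dots> \<le> (\<Sum>i\<in>(UNIV::'n set). L1)" using g1 by (intro sum_mono) (simp add: gradient_def)
    finally show ?thesis by simp
  qed
  have mat: "norm A \<le> (real CARD('n))\<^sup>2 * L" if "\<And>i j. \<bar>A $ i $ j\<bar> \<le> L" for A :: "real^'n^'n" and L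
  proof -
    have row: "norm (A $ i) \<le> real CARD('n) * L" for i
    proof -
      have "norm (A $ i) \<le> (\<Sum>j\<in>UNIV. norm (A $ i $ j))" by (rule norm_vec_le_sum)
      also have "\<dots> \<le> (\<Sum>j\<in>(UNIV::'n set). L)" using that by (intro sum_mono) simp
      finally show ?thesis by simp
    qed
    have "norm A \<le> (\<Sum>i\<in>UNIV. norm (A $ i))" by (rule norm_vec_le_sum)
    also have "\<dots> \<le> (\<Sum>i\<in>(UNIV::'n set). real CARD('n) * L)" by (intro sum_mono row)
    finally show ?thesis by (simp add: power2_eq_square)
  qed
  have Hb: "norm (hessian w x) \<le> (real CARD('n))\<^sup>2 * L2" for x
    by (rule mat) (simp add: hessian_def h1)
  have Hq: "q \<le> (real CARD('n))\<^sup>2 * L3" if q: "q \<in> holder_quotients \<alpha> (hessian w)" for q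
  proof -
    obtain x y where q: "q = norm (hessian w x - hessian w y) / norm (x - y) powr \<alpha>" and xy: "x \<noteq> y"
      using q unfolding holder_quotients_def by blast
    have "norm (hessian w x - hessian w y) \<le> (real CARD('n))\<^sup>2 * (L3 * norm (x - y) powr \<alpha>)"
    proof (rule mat)
      fix i j
      show "\<bar>(hessian w x - hessian w y) $ i $ j\<bar> \<le> L3 * norm (x - y) powr \<alpha>"
        using h2[of "x - y" i j y] by (simp add: hessian_def diff_def)
    qed
    then show ?thesis using xy by (simp add: q divide_le_eq mult.assoc)
  qed
  show "w \<in> C2_holder \<alpha>"
    unfolding C2_holder_def
    using Ck wb Gb Hb Hq
    by (auto simp: bounded_iff intro!: bdd_aboveI)
  have ne: "holder_quotients \<alpha> (hessian w) \<noteq> {}"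
  proof -
    have "(axis undefined 1 :: real^'n) \<noteq> 0" by (simp add: axis_eq_0_iff)
    then show ?thesis unfolding holder_quotients_def by blast
  qed
  show "C2_holder_norm \<alpha> w \<le> M + real CARD('n) * L1 + (real CARD('n))\<^sup>2 * L2 + (real CARD('n))\<^sup>2 * L3"
    unfolding C2_holder_norm_def
    by (intro add_mono cSUP_least cSup_least ne wb Gb Hb Hq) auto
qed

theorem theorem1p4:
  fixes s p :: real
  assumes "CARD('n::finite) \<ge> 2"
    and "0 < s" and "s < 1"
    and "1 < p"
    and "CARD('n) > 2 \<Longrightarrow> p < (real CARD('n) + 2) / (real CARD('n) - 2)"
  shows "\<forall>\<alpha>. 0 < \<alpha> \<and> \<alpha> < 1 \<longrightarrow>
    (\<exists>C>0. \<forall>u :: real^'n \<Rightarrow> real. u \<in> H1 \<and> u \<in> Linfty \<and> weak_solution s p u \<longrightarrow>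
      (\<exists>w \<in> C2_holder \<alpha>. (AE x in lebesgue. u x = w x) \<and>
        C2_holder_norm \<alpha> w \<le> C * max (Linfty_norm u powr (p^2)) (Linfty_norm u)))"
proof (intro allI impI)
  fix \<alpha> :: real assume "0 < \<alpha> \<and> \<alpha> < 1"
  then have \<alpha>: "0 < \<alpha>" "\<alpha> < 1" by auto
  note s = \<open>0 < s\<close> \<open>s < 1\<close>
  obtain C1 where C1': "C1 > 0 \<and> (\<forall>(b :: real^'n \<Rightarrow> real) q S T. sol s b q \<and> continuous_on UNIV b \<and> bounded_borel b S \<and> bounded_borel q T \<longrightarrow>
      (\<forall>a x. \<bar>diff a b x\<bar> \<le> C1 * norm a * (S + T)))"
    using first_difference_estimate[OF s] by (elim exE) (rule that)
  have C1: "C1 > 0" by (rule conjunct1[OF C1'])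
  have first: "\<bar>diff a b x\<bar> \<le> C1 * norm a * (S + T)"
    if "sol s b q" "continuous_on UNIV b" "bounded_borel b S" "bounded_borel q T" for b q :: "real^'n \<Rightarrow> real" and S T a x
    using C1' that by blast
  obtain C2 where C2': "C2 > 0 \<and> (\<forall>(b :: real^'n \<Rightarrow> real) q S T. sol s b q \<and> continuous_on UNIV b \<and> 0 \<le> S \<and> (\<forall>a x. \<bar>diff a b x\<bar> \<le> S * norm a) \<and> bounded_borel q T \<longrightarrow>
      (\<forall>a a' x. \<bar>diff a (diff a' b) x\<bar> \<le> C2 * norm a' * norm a powr \<alpha> * (S + T)))"
    using second_difference_estimate[OF s \<alpha>] by (elim exE) (rule that)
  have C2: "C2 > 0" by (rule conjunct1[OF C2'])
  have second: "\<bar>diff a (diff a' b) x\<bar> \<le> C2 * norm a' * norm a powr \<alpha> * (S + T)"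
    if "sol s b q" "continuous_on UNIV b" "0 \<le> S" "\<And>a x. \<bar>diff a b x\<bar> \<le> S * norm a" "bounded_borel q T"
    for b q :: "real^'n \<Rightarrow> real" and S T a a' x
    using C2' that by blast
  \<comment> \<open>These constants are fixed before u and depend only on n, s, p and \<alpha>. With
    m the maximum in the claim, k1, k2, k3 and k will be the factors of m in the bounds for L1, L2,
    L3 and for the Lipschitz constant L of f.\<close>
  define k1 where "k1 = 2 * C1"
  define k where "k = 2 * p * C1"
  define k2 where "k2 = C1 * (k1 + k)"
  define k3 where "k3 = C2 * (k2 + k)"
  have k0: "k1 > 0" "k > 0" "k2 > 0" "k3 > 0"
    using C1 C2 \<open>1 < p\<close> by (simp_all add: k1_def k_def k2_def k3_def add_pos_pos)
  define N where "N = real CARD('n)"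
  have N0: "N \<ge> 0" by (simp add: N_def)
  show "\<exists>C>0. \<forall>u :: real^'n \<Rightarrow> real. u \<in> H1 \<and> u \<in> Linfty \<and> weak_solution s p u \<longrightarrow>
      (\<exists>w \<in> C2_holder \<alpha>. (AE x in lebesgue. u x = w x) \<and>
        C2_holder_norm \<alpha> w \<le> C * max (Linfty_norm u powr (p^2)) (Linfty_norm u))"
  proof (rule exI[of _ "1 + N * k1 + N\<^sup>2 * k2 + N\<^sup>2 * k3"], intro conjI allI impI)
    show "1 + N * k1 + N\<^sup>2 * k2 + N\<^sup>2 * k3 > 0"
      using N0 k0 by (intro add_pos_nonneg) auto
    fix u :: "real^'n \<Rightarrow> real"
    assume "u \<in> H1 \<and> u \<in> Linfty \<and> weak_solution s p u"
    then have uL: "u \<in> Linfty" and ws: "weak_solution s p u" by auto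
    define M where "M = Linfty_norm u"
    define m where "m = max (M powr (p^2)) M"
    obtain u0 where u0: "bounded_borel u0 M" "AE x in lebesgue. u x = u0 x"
      unfolding M_def by (rule Linfty_borel_representative[OF uL])
    have M0: "M \<ge> 0" by (rule bounded_borelD(3)[OF u0(1)])
    \<comment> \<open>The Borel representative satisfies the averaged equation, which yields a
      continuous one; the equation is then derived afresh for w, since the estimates need
      continuity.\<close>
    obtain w where wc: "continuous_on UNIV w" and wb: "bounded_borel w M" and wu: "AE x in lborel. u0 x = w x"
      by (rule continuous_representative[OF s weak_solution_imp_sol[OF s \<open>1 < p\<close> ws u0] u0(1)])
    have uw: "AE x in lebesgue. u x = w x"
      using u0(2) AE_completion[OF wu] by eventually_elim simp
    define f where "f = (\<lambda>x. \<bar>w x\<bar> powr (p - 1) * w x)"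
    have sw: "sol s w f" unfolding f_def by (rule weak_solution_imp_sol[OF s \<open>1 < p\<close> ws wb uw])
    have fm: "f \<in> borel_measurable borel"
      using bounded_borelD(1)[OF wb] unfolding f_def by measurable
    have fb: "bounded_borel f (M powr (p - 1) * M)"
      unfolding bounded_borel_def
    proof (intro conjI fm allI)
      fix x
      show "\<bar>f x\<bar> \<le> M powr (p - 1) * M" unfolding f_def abs_mult
        using \<open>1 < p\<close> M0 bounded_borelD(2)[OF wb, of x] by (intro mult_mono) (auto intro: powr_mono2)
    qed
    define L1 where "L1 = C1 * (M + M powr (p - 1) * M)"
    \<comment> \<open>The Lipschitz constant of the nonlinearity on [-M, M] times that of w.\<close>
    define L where "L = p * M powr (p - 1) * L1"
    define L2 where "L2 = C1 * (L1 + L)"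
    define L3 where "L3 = C2 * (L2 + L)"
    have L0: "L1 \<ge> 0" "L \<ge> 0" "L2 \<ge> 0"
      using C1 \<open>1 < p\<close> M0 by (auto simp: L1_def L_def L2_def)
    have d1: "\<bar>diff a w x\<bar> \<le> L1 * norm a" for a x
      using first[OF sw wc wb fb, of a x] by (simp add: L1_def mult_ac)
    have f1: "\<bar>diff a f x\<bar> \<le> L * norm a" for a x
    proof -
      have "\<bar>diff a f x\<bar> \<le> p * M powr (p - 1) * \<bar>diff a w x\<bar>"
        unfolding diff_def f_def by (rule abs_powr_Lipschitz[OF \<open>1 < p\<close> bounded_borelD(2)[OF wb] bounded_borelD(2)[OF wb]])
      also have "\<dots> \<le> p * M powr (p - 1) * (L1 * norm a)" using \<open>1 < p\<close> by (intro mult_left_mono d1) auto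
      finally show ?thesis by (simp add: L_def mult.assoc)
    qed
    have db: "bounded_borel (diff a w) (L1 * norm a)" "bounded_borel (diff a f) (L * norm a)" for a
      using d1 f1 diff_measurable[OF bounded_borelD(1)[OF wb]] diff_measurable[OF fm] by (auto simp: bounded_borel_def)
    \<comment> \<open>\<open>first\<close> is applied to \<open>diff a' w\<close>, a solution with
      source \<open>diff a' f\<close>; the bounds of this pair are the Lipschitz bounds just
      found.\<close>
    have d2: "\<bar>diff a (diff a' w) x\<bar> \<le> L2 * norm a' * norm a" for a a' x
      using first[OF sol_diff[OF s sw] continuous_diff[OF wc] db, of a a' x] by (simp add: L2_def algebra_simps)
    have d3: "\<bar>diff a (diff a' (diff a'' w)) x\<bar> \<le> L3 * norm a'' * norm a' * norm a powr \<alpha>" for a a' a'' x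
    proof -
      \<comment> \<open>Now \<open>diff a'' w\<close> is the solution: it has Lipschitz constant
        \<open>L2 * norm a''\<close>, and its source is bounded by
        \<open>L * norm a''\<close>.\<close>
      have "\<bar>diff a (diff a' (diff a'' w)) x\<bar> \<le> C2 * norm a' * norm a powr \<alpha> * (L2 * norm a'' + L * norm a'')"
        by (rule second[OF sol_diff[OF s sw] continuous_diff[OF wc] _ d2 db(2)]) (use L0 in simp)
      then show ?thesis by (simp add: L3_def algebra_simps)
    qed
    \<comment> \<open>The exponents of M that occur are 1, p and 2 p - 1, the last because L
      multiplies M powr (p - 1) by M powr p; p^2 exceeds it by (p - 1)^2.\<close>
    have pp: "p \<le> p\<^sup>2" "2 * p - 1 \<le> p\<^sup>2"
    proof -
      show "p \<le> p\<^sup>2" using \<open>1 < p\<close> by (simp add: power2_eq_square)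
      have "0 \<le> (p - 1)\<^sup>2" by simp
      then show "2 * p - 1 \<le> p\<^sup>2" by (simp add: power2_diff)
    qed
    have m1: "M \<le> m" by (simp add: m_def)
    have Mp: "M powr (p - 1) * M = M powr p" using M0 by (cases "M = 0") (auto simp: powr_diff)
    have m2: "M powr p \<le> m" unfolding m_def using M0 \<open>1 < p\<close> pp by (intro powr_le_max) auto
    have m3: "M powr (p - 1) * M powr p \<le> m"
    proof -
      have "M powr (p - 1) * M powr p = M powr (2 * p - 1)" by (simp add: powr_add[symmetric])
      then show ?thesis unfolding m_def using M0 \<open>1 < p\<close> pp powr_le_max[of M "2 * p - 1" "p\<^sup>2"] by simp
    qed
    have b1: "L1 \<le> k1 * m"
      unfolding L1_def k1_def Mp using m1 m2 C1 by simp
    have b: "L \<le> k * m"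
    proof -
      have "L = p * C1 * (M powr p + M powr (p - 1) * M powr p)"
        unfolding L_def L1_def Mp using Mp by (simp add: algebra_simps)
      also have "\<dots> \<le> p * C1 * (m + m)" using m2 m3 C1 \<open>1 < p\<close> by (intro mult_left_mono add_mono) auto
      finally show ?thesis by (simp add: k_def mult_ac)
    qed
    have b2: "L2 \<le> k2 * m"
    proof -
      have "L2 \<le> C1 * (k1 * m + k * m)" unfolding L2_def using b1 b C1 by (intro mult_left_mono add_mono) auto
      then show ?thesis by (simp add: k2_def algebra_simps)
    qed
    have b3: "L3 \<le> k3 * m"
    proof -
      have "L3 \<le> C2 * (k2 * m + k * m)" unfolding L3_def using b2 b C2 by (intro mult_left_mono add_mono) auto
      then show ?thesis by (simp add: k3_def algebra_simps)
    qed
    have "C2_holder_norm \<alpha> w \<le> M + N * L1 + N\<^sup>2 * L2 + N\<^sup>2 * L3"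
      unfolding N_def by (rule C2_holder_of_difference_bounds(2)[OF wb \<alpha>(1) d1 d2 d3])
    also have "\<dots> \<le> m + N * (k1 * m) + N\<^sup>2 * (k2 * m) + N\<^sup>2 * (k3 * m)"
      using N0 by (intro add_mono mult_left_mono m1 b1 b2 b3) auto
    also have "\<dots> = (1 + N * k1 + N\<^sup>2 * k2 + N\<^sup>2 * k3) * m" by (simp add: algebra_simps)
    finally show "\<exists>w \<in> C2_holder \<alpha>. (AE x in lebesgue. u x = w x) \<and>
        C2_holder_norm \<alpha> w \<le> (1 + N * k1 + N\<^sup>2 * k2 + N\<^sup>2 * k3) * max (Linfty_norm u powr (p^2)) (Linfty_norm u)"
      using uw C2_holder_of_difference_bounds(1)[OF wb \<alpha>(1) d1 d2 d3]
      unfolding m_def M_def by blast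
  qed
qed

end
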